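(* Let $s\in\mathbb{R}$. Assume the following three hypotheses: (a) $\partial_x\mathcal{A}\psi_k=i\lambda_k\psi_k$ with $\lambda_k=k\,a(k)$, for all $k\in\mathbb{Z}$; (b) there is $n_0\in\mathbb{N}$ such that $m(k_1)\le n_0$ for all $k_1\in\mathbb{Z}$; (c) there is $k_1^*\in\mathbb{N}$ such that $m(k_1)=1$ for all $k_1\in\mathbb{Z}$ with $|k_1|\ge k_1^*$. Let $\mathbb{I}\subseteq\mathbb{Z}$ be an index set obtained by counting only distinct eigenvalues, that is, $\mathbb{I}$ contains exactly one index from each class $I(k)$, so that $\lambda_{k_1}\ne\lambda_{k_2}$ for all $k_1\neq k_2$ in $\mathbb{I}$. Suppose that $$\gamma:=\inf_{\substack{k,n\in\mathbb{I}\\ k\ne n}}|\lambda_k-\lambda_n|>0\qquad\text{and}\qquad \gamma':=\sup_{S\subset\mathbb{I}}\ \inf_{\substack{k,n\in\mathbb{I}\setminus S\\ k\neq n}}|\lambda_k-\lambda_n|>0,$$ where $S$ runs over all finite subsets of $\mathbb{I}$. Then for any $T>\frac{2\pi}{\gamma'}$ and for each $u_0,u_1\in H^s_p(\mathbb{T})$ with $\widehat{u_0}(0)=\widehat{u_1}(0)$, there exists a function $h\in L^2([0,T];H^s_p(\mathbb{T}))$ such that the unique solution $u$ of the non-homogeneous system $$\begin{cases}u\in C([0,T];H^s_p(\mathbb{T})),\\ \partial_tu(t)=\partial_x\mathcal{A}u(t)+G(h)(t)\in H^{s-r}_p(\mathbb{T}),\quad t\in(0,T),\\ u(0)=u_0,\end{cases}$$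 satisfies $u(T)=u_1$. Furthermore, $$\|h\|_{L^2([0,T];H^s_p(\mathbb{T}))}\le\nu\,\bigl(\|u_0\|_{H^s_p(\mathbb{T})}+\|u_1\|_{H^s_p(\mathbb{T})}\bigr)$$ for some positive constant $\nu\equiv\nu(s,g,T)$.
   Context: Notation. $\mathbb{T}=\mathbb{R}/(2\pi\mathbb{Z})$; $\mathscr{P}=C_p^\infty(\mathbb{T})$ is the space of $2\pi$-periodic $C^\infty$ functions, $\mathscr{P}'$ the space of periodic distributions, $\langle\cdot,\cdot\rangle$ the (bilinear) pairing between $\mathscr{P}'$ and $\mathscr{P}$. For $v\in\mathscr{P}'$, $\widehat v(k)=\frac1{2\pi}\langle v,e^{-ikx}\rangle$, $k\in\mathbb{Z}$. $\psi_k(x)=e^{ikx}/\sqrt{2\pi}$. For $s\in\mathbb{R}$, $H^s_p(\mathbb{T})=\{v\in\mathscr{P}':\|v\|^2_{H^s_p(\mathbb{T})}=2\pi\sum_{k\in\mathbb{Z}}(1+|k|)^{2s}|\widehat v(k)|^2<\infty\}$. The operator $\mathcal{A}$. $\mathcal{A}$ is a linear Fourier multiplier with real symbol $a:\mathbb{Z}\to\mathbb{R}$, i.e. $\widehat{\mathcal{A}u}(k)=a(k)\widehat u(k)$, and there are $r\ge1$, $k_0\ge0$ and $C>0$ with $|a(k)|\le C|k|^{r-1}$ for all $|k|\ge k_0$. Multiplicities. With $\lambda_k=k\,a(k)$, for $k_1\in\mathbb{Z}$ put $I(k_1)=\{k\in\mathbb{Z}:\lambda_k=\lambda_{k_1}\}$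 and $m(k_1)=|I(k_1)|$ (number of elements). The operator $G$. $g\in C_p^\infty(\mathbb{T})$ is a fixed real non-negative function with $2\pi\widehat g(0)=\int_0^{2\pi}g(x)\,dx=1$, supported in $\omega$, where $\omega=\{x\in\mathbb{T}:g(x)>0\}$ is an open interval. $G(\phi)=g\phi-g\,\langle\phi,g\rangle$ for $\phi\in H^s_p(\mathbb{T})$; it is a bounded linear operator on $H^s_p(\mathbb{T})$, applied to $h$ as $G(h)(t)=G(h(\cdot,t))$. The solution of the non-homogeneous system is understood in the mild sense $u(t)=U(t)u_0+\int_0^tU(t-t')G(h)(t')\,dt'$, where $\widehat{U(t)\varphi}(k)=e^{ika(k)t}\widehat\varphi(k)$. If $\gamma'=+\infty$, $2\pi/\gamma'$ is read as $0$. *)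

theory Defs
  imports "HOL-Analysis.Analysis"
begin

section \<open>Periodic test functions and periodic distributions\<close>

definition vderiv :: "(real \<Rightarrow> complex) \<Rightarrow> real \<Rightarrow> complex" where
  "vderiv \<phi> = (\<lambda>x. vector_derivative \<phi> (at x))"

definition periodic_smooth :: "(real \<Rightarrow> complex) set" where
  "periodic_smooth = {\<phi>. (\<forall>x. \<phi> (x + 2 * pi) = \<phi> x) \<and>
      (\<forall>n x. (vderiv ^^ n) \<phi> differentiable (at x))}"

text \<open>Convergence in the Frechet space \<open>periodic_smooth\<close>: uniform convergence of all derivatives.
  The topology is metrizable, so sequential continuity below is continuity.\<close>

definition smooth_tendsto :: "(nat \<Rightarrow> real \<Rightarrow> complex) \<Rightarrow> (real \<Rightarrow> complex) \<Rightarrow> bool" where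
  "smooth_tendsto X \<phi> \<longleftrightarrow>
     (\<forall>j. uniform_limit UNIV (\<lambda>n. (vderiv ^^ j) (X n)) ((vderiv ^^ j) \<phi>) sequentially)"

lemma vderiv_at: "(\<phi> has_vector_derivative d) (at x) \<Longrightarrow> vderiv \<phi> x = d"
  by (simp add: vderiv_def vector_derivative_at)

lemma periodic_smooth_zero: "(\<lambda>x. 0) \<in> periodic_smooth"
proof -
  have "(vderiv ^^ n) (\<lambda>x. 0) = (\<lambda>x. 0)" for n
    by (induction n) (auto simp: vderiv_def)
  then show ?thesis by (simp add: periodic_smooth_def)
qed

lemma periodic_smooth_differentiable:
  "\<phi> \<in> periodic_smooth \<Longrightarrow> (vderiv ^^ n) \<phi> differentiable (at x)"
  by (simp add: periodic_smooth_def)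

lemma periodic_smooth_has_vderiv:
  assumes "\<phi> \<in> periodic_smooth"
  shows "((vderiv ^^ n) \<phi> has_vector_derivative (vderiv ^^ Suc n) \<phi> x) (at x)"
proof -
  have "(vderiv ^^ Suc n) \<phi> x = vector_derivative ((vderiv ^^ n) \<phi>) (at x)"
    by (simp add: vderiv_def)
  then show ?thesis
    using periodic_smooth_differentiable[OF assms, of n x] vector_derivative_works by metis
qed

lemma periodic_smooth_vderiv:
  assumes "\<phi> \<in> periodic_smooth"
  shows "vderiv \<phi> \<in> periodic_smooth"
proof -
  have "vderiv \<phi> (x + 2 * pi) = vderiv \<phi> x" for x
  proof -
    have "(\<phi> has_vector_derivative vderiv \<phi> (x + 2 * pi)) (at (x + 2 * pi))"
      using periodic_smooth_has_vderiv[OF assms, of 0] by simp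
    then have "(\<phi> \<circ> (\<lambda>y. y + 2 * pi) has_vector_derivative 1 *\<^sub>R vderiv \<phi> (x + 2 * pi)) (at x)"
      by (intro vector_diff_chain_at) (auto intro!: derivative_eq_intros)
    moreover have "\<phi> \<circ> (\<lambda>y. y + 2 * pi) = \<phi>"
      using assms by (auto simp: periodic_smooth_def)
    ultimately have "(\<phi> has_vector_derivative vderiv \<phi> (x + 2 * pi)) (at x)" by simp
    then show ?thesis by (simp add: vderiv_def vector_derivative_at)
  qed
  moreover have "(vderiv ^^ n) (vderiv \<phi>) differentiable (at x)" for n x
    using periodic_smooth_differentiable[OF assms, of "Suc n" x]
    by (simp add: funpow_swap1)
  ultimately show ?thesis by (simp add: periodic_smooth_def)
qed

lemma vderiv_add:
  assumes "\<phi> \<in> periodic_smooth" "\<eta> \<in> periodic_smooth"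
  shows "(vderiv ^^ n) (\<lambda>x. \<phi> x + \<eta> x) = (\<lambda>x. (vderiv ^^ n) \<phi> x + (vderiv ^^ n) \<eta> x)"
proof (induction n)
  case (Suc n)
  show ?case
  proof
    fix x
    have "((\<lambda>x. (vderiv ^^ n) \<phi> x + (vderiv ^^ n) \<eta> x) has_vector_derivative
        (vderiv ^^ Suc n) \<phi> x + (vderiv ^^ Suc n) \<eta> x) (at x)"
      by (intro has_vector_derivative_add periodic_smooth_has_vderiv assms)
    then show "(vderiv ^^ Suc n) (\<lambda>x. \<phi> x + \<eta> x) x
        = (vderiv ^^ Suc n) \<phi> x + (vderiv ^^ Suc n) \<eta> x"
      using Suc by (simp add: vderiv_at)
  qed
qed simp

lemma periodic_smooth_add:
  assumes "\<phi> \<in> periodic_smooth" "\<eta> \<in> periodic_smooth"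
  shows "(\<lambda>x. \<phi> x + \<eta> x) \<in> periodic_smooth"
  using assms vderiv_add[OF assms] by (auto simp: periodic_smooth_def)

lemma vderiv_mult:
  assumes "\<phi> \<in> periodic_smooth" "\<eta> \<in> periodic_smooth"
  shows "vderiv (\<lambda>x. \<phi> x * \<eta> x) = (\<lambda>x. \<phi> x * vderiv \<eta> x + vderiv \<phi> x * \<eta> x)"
proof
  fix x
  have "((\<lambda>x. \<phi> x * \<eta> x) has_vector_derivative \<phi> x * vderiv \<eta> x + vderiv \<phi> x * \<eta> x) (at x)"
    using has_vector_derivative_mult[OF periodic_smooth_has_vderiv[OF assms(1), of 0]
        periodic_smooth_has_vderiv[OF assms(2), of 0]] by simp
  then show "vderiv (\<lambda>x. \<phi> x * \<eta> x) x = \<phi> x * vderiv \<eta> x + vderiv \<phi> x * \<eta> x"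
    by (simp add: vderiv_def vector_derivative_at)
qed

lemma differentiable_add_all:
  fixes F H :: "real \<Rightarrow> complex"
  assumes "\<And>n x. n \<le> N \<Longrightarrow> (vderiv ^^ n) F differentiable (at x)"
    and "\<And>n x. n \<le> N \<Longrightarrow> (vderiv ^^ n) H differentiable (at x)"
  shows "n \<le> Suc N \<Longrightarrow> (vderiv ^^ n) (\<lambda>x. F x + H x) = (\<lambda>x. (vderiv ^^ n) F x + (vderiv ^^ n) H x)"
proof (induction n)
  case (Suc n)
  then have *: "(vderiv ^^ n) (\<lambda>x. F x + H x) = (\<lambda>x. (vderiv ^^ n) F x + (vderiv ^^ n) H x)"
    by simp
  show ?case
  proof
    fix x
    have d: "((vderiv ^^ n) K has_vector_derivative (vderiv ^^ Suc n) K x) (at x)"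
      if "(vderiv ^^ n) K differentiable (at x)" for K
    proof -
      have "(vderiv ^^ Suc n) K x = vector_derivative ((vderiv ^^ n) K) (at x)"
        by (simp add: vderiv_def)
      then show ?thesis using that vector_derivative_works by metis
    qed
    have "((\<lambda>x. (vderiv ^^ n) F x + (vderiv ^^ n) H x) has_vector_derivative
        (vderiv ^^ Suc n) F x + (vderiv ^^ Suc n) H x) (at x)"
      using assms Suc.prems by (intro has_vector_derivative_add d) auto
    then show "(vderiv ^^ Suc n) (\<lambda>x. F x + H x) x = (vderiv ^^ Suc n) F x + (vderiv ^^ Suc n) H x"
      by (simp add: * vderiv_at)
  qed
qed simp

lemma periodic_smooth_mult:
  assumes "\<phi> \<in> periodic_smooth" "\<eta> \<in> periodic_smooth"
  shows "(\<lambda>x. \<phi> x * \<eta> x) \<in> periodic_smooth"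
proof -
  have "\<phi> \<in> periodic_smooth \<Longrightarrow> \<eta> \<in> periodic_smooth \<Longrightarrow>
      \<forall>m\<le>n. \<forall>x. (vderiv ^^ m) (\<lambda>x. \<phi> x * \<eta> x) differentiable (at x)" for n \<phi> \<eta>
  proof (induction n arbitrary: \<phi> \<eta>)
    case 0
    then show ?case
      using periodic_smooth_differentiable[of _ 0] by (auto intro!: differentiable_mult)
  next
    case (Suc n)
    note IH1 = Suc.IH[OF Suc.prems(1) periodic_smooth_vderiv[OF Suc.prems(2)]]
    note IH2 = Suc.IH[OF periodic_smooth_vderiv[OF Suc.prems(1)] Suc.prems(2)]
    have "(vderiv ^^ m) (\<lambda>x. \<phi> x * \<eta> x) differentiable (at x)" if "m \<le> Suc n" for m x
    proof (cases m)
      case 0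
      then show ?thesis using Suc.IH[OF Suc.prems] by auto
    next
      case (Suc j)
      then have "(vderiv ^^ m) (\<lambda>x. \<phi> x * \<eta> x)
          = (vderiv ^^ j) (\<lambda>x. \<phi> x * vderiv \<eta> x + vderiv \<phi> x * \<eta> x)"
        using vderiv_mult[OF Suc.prems] by (simp add: funpow_swap1)
      also have "\<dots> = (\<lambda>x. (vderiv ^^ j) (\<lambda>x. \<phi> x * vderiv \<eta> x) x
          + (vderiv ^^ j) (\<lambda>x. vderiv \<phi> x * \<eta> x) x)"
        using Suc that by (intro differentiable_add_all[where N = n]) (use IH1 IH2 in auto)
      finally show ?thesis using IH1 IH2 Suc that by (auto intro!: differentiable_add)
    qed
    then show ?case by blast
  qed
  then have "(vderiv ^^ n) (\<lambda>x. \<phi> x * \<eta> x) differentiable (at x)" for n x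
    using assms by blast
  then show ?thesis using assms by (simp add: periodic_smooth_def)
qed

lemma periodic_smooth_continuous:
  assumes "\<phi> \<in> periodic_smooth"
  shows "continuous_on A \<phi>"
  using periodic_smooth_differentiable[OF assms, of 0]
  by (auto intro!: continuous_at_imp_continuous_on differentiable_imp_continuous_within)

lemma periodic_smooth_bounded:
  assumes "\<phi> \<in> periodic_smooth"
  shows "bounded (range \<phi>)"
proof -
  have per: "\<phi> (x + of_int n * (2 * pi)) = \<phi> x" for x :: real and n :: int
  proof (induction n rule: int_induct[of _ 0])
    case (step1 i)
    have "\<phi> ((x + of_int i * (2 * pi)) + 2 * pi) = \<phi> (x + of_int i * (2 * pi))"
      using assms by (simp only: periodic_smooth_def mem_Collect_eq)
    then show ?case using step1 by (simp add: algebra_simps)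
  next
    case (step2 i)
    have "\<phi> ((x + of_int (i - 1) * (2 * pi)) + 2 * pi) = \<phi> (x + of_int (i - 1) * (2 * pi))"
      using assms by (simp only: periodic_smooth_def mem_Collect_eq)
    then show ?case using step2 by (simp add: algebra_simps)
  qed simp
  have "range \<phi> \<subseteq> \<phi> ` {0..2 * pi}"
  proof safe
    fix x :: real
    define n where "n = \<lfloor>x / (2 * pi)\<rfloor>"
    have "of_int n \<le> x / (2 * pi)" "x / (2 * pi) < of_int n + 1"
      unfolding n_def by linarith+
    then have "x + of_int (- n) * (2 * pi) \<in> {0..2 * pi}"
      by (auto simp: field_simps)
    then show "\<phi> x \<in> \<phi> ` {0..2 * pi}" using per[of x "- n"] by (metis image_eqI)
  qed
  moreover have "compact (\<phi> ` {0..2 * pi})"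
    by (intro compact_continuous_image periodic_smooth_continuous assms) auto
  ultimately show ?thesis by (meson bounded_subset compact_imp_bounded)
qed

lemma smooth_tendsto_vderiv:
  assumes "smooth_tendsto X \<phi>"
  shows "smooth_tendsto (\<lambda>n. vderiv (X n)) (vderiv \<phi>)"
  unfolding smooth_tendsto_def
proof
  fix j
  show "uniform_limit UNIV (\<lambda>n. (vderiv ^^ j) (vderiv (X n))) ((vderiv ^^ j) (vderiv \<phi>)) sequentially"
    using assms[unfolded smooth_tendsto_def, rule_format, of "Suc j"] by (simp add: funpow_swap1)
qed

lemma smooth_tendsto_mult:
  assumes "f \<in> periodic_smooth" "\<And>n. X n \<in> periodic_smooth" "\<phi> \<in> periodic_smooth"
    and "smooth_tendsto X \<phi>"
  shows "smooth_tendsto (\<lambda>n x. f x * X n x) (\<lambda>x. f x * \<phi> x)"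
proof -
  have "uniform_limit UNIV (\<lambda>n. (vderiv ^^ j) (\<lambda>x. f x * X n x))
      ((vderiv ^^ j) (\<lambda>x. f x * \<phi> x)) sequentially"
    if "f \<in> periodic_smooth" "\<And>n. X n \<in> periodic_smooth" "\<phi> \<in> periodic_smooth"
      "smooth_tendsto X \<phi>" for j f X \<phi>
    using that
  proof (induction j arbitrary: f X \<phi>)
    case 0
    have "uniform_limit UNIV X \<phi> sequentially"
      using 0(4)[unfolded smooth_tendsto_def, rule_format, of 0] by simp
    then show ?case
      using 0 uniform_lim_mult[OF uniform_limit_const _ periodic_smooth_bounded periodic_smooth_bounded]
      by auto
  next
    case (Suc j)
    have *: "(vderiv ^^ Suc j) (\<lambda>x. f x * \<eta> x) = (\<lambda>x. (vderiv ^^ j) (\<lambda>x. f x * vderiv \<eta> x) x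
        + (vderiv ^^ j) (\<lambda>x. vderiv f x * \<eta> x) x)" if "\<eta> \<in> periodic_smooth" for \<eta>
    proof -
      have "(vderiv ^^ Suc j) (\<lambda>x. f x * \<eta> x)
          = (vderiv ^^ j) (\<lambda>x. f x * vderiv \<eta> x + vderiv f x * \<eta> x)"
        using vderiv_mult[OF Suc.prems(1) that] by (simp add: funpow_swap1)
      then show ?thesis
        using Suc.prems(1) that
        by (simp only: vderiv_add periodic_smooth_mult periodic_smooth_vderiv)
    qed
    show ?case
      unfolding *[OF Suc.prems(2)] *[OF Suc.prems(3)]
      by (intro uniform_limit_add Suc.IH periodic_smooth_vderiv smooth_tendsto_vderiv Suc.prems)
  qed
  then show ?thesis using assms by (simp add: smooth_tendsto_def)
qed

text \<open>A distribution is a continuous linear functional on \<open>periodic_smooth\<close>; it is represented by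
  its extension by zero to all functions, which makes the representation unique.\<close>

typedef pdist = "{L :: (real \<Rightarrow> complex) \<Rightarrow> complex.
    (\<forall>\<phi>. \<phi> \<notin> periodic_smooth \<longrightarrow> L \<phi> = 0) \<and>
    (\<forall>\<phi>\<in>periodic_smooth. \<forall>\<eta>\<in>periodic_smooth. L (\<lambda>x. \<phi> x + \<eta> x) = L \<phi> + L \<eta>) \<and>
    (\<forall>c. \<forall>\<phi>\<in>periodic_smooth. L (\<lambda>x. c * \<phi> x) = c * L \<phi>) \<and>
    (\<forall>X. \<forall>\<phi>\<in>periodic_smooth. (\<forall>n. X n \<in> periodic_smooth) \<and> smooth_tendsto X \<phi>
        \<longrightarrow> (\<lambda>n. L (X n)) \<longlonglongrightarrow> L \<phi>)}"
  morphisms pairing Abs_pdist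
  by (rule exI[of _ "\<lambda>_. 0"]) simp

setup_lifting type_definition_pdist

instantiation pdist :: real_vector
begin

lift_definition zero_pdist :: pdist is "\<lambda>_. 0" by simp

lift_definition plus_pdist :: "pdist \<Rightarrow> pdist \<Rightarrow> pdist" is "\<lambda>L M \<phi>. L \<phi> + M \<phi>"
  by (auto simp: algebra_simps intro!: tendsto_add)

lift_definition uminus_pdist :: "pdist \<Rightarrow> pdist" is "\<lambda>L \<phi>. - L \<phi>"
  by (auto intro!: tendsto_minus)

lift_definition minus_pdist :: "pdist \<Rightarrow> pdist \<Rightarrow> pdist" is "\<lambda>L M \<phi>. L \<phi> - M \<phi>"
  by (auto simp: algebra_simps intro!: tendsto_diff)

lift_definition scaleR_pdist :: "real \<Rightarrow> pdist \<Rightarrow> pdist" is "\<lambda>c L \<phi>. c *\<^sub>R L \<phi>"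
  by (auto simp: algebra_simps intro!: tendsto_scaleR)

instance
  by standard (transfer; auto simp: algebra_simps)+

end

lift_definition pd_scale :: "complex \<Rightarrow> pdist \<Rightarrow> pdist" is "\<lambda>c L \<phi>. c * L \<phi>"
  by (auto simp: algebra_simps intro!: tendsto_mult_left)

lemma cmult_periodic_smooth:
  assumes "\<phi> \<in> periodic_smooth"
  shows "(vderiv ^^ n) (\<lambda>x. c * \<phi> x) = (\<lambda>x. c * (vderiv ^^ n) \<phi> x)"
    and "(\<lambda>x. c * \<phi> x) \<in> periodic_smooth"
proof -
  show *: "(vderiv ^^ n) (\<lambda>x. c * \<phi> x) = (\<lambda>x. c * (vderiv ^^ n) \<phi> x)" for n
  proof (induction n)
    case (Suc n)
    show ?case
    proof
      fix x
      have "((\<lambda>x. c * (vderiv ^^ n) \<phi> x) has_vector_derivative c * (vderiv ^^ Suc n) \<phi> x) (at x)"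
        by (intro has_vector_derivative_mult_right periodic_smooth_has_vderiv assms)
      then show "(vderiv ^^ Suc n) (\<lambda>x. c * \<phi> x) x = c * (vderiv ^^ Suc n) \<phi> x"
        using Suc by (simp add: vderiv_at)
    qed
  qed simp
  show "(\<lambda>x. c * \<phi> x) \<in> periodic_smooth"
    using assms by (auto simp: periodic_smooth_def *[unfolded periodic_smooth_def])
qed

lift_definition pd_deriv :: "pdist \<Rightarrow> pdist" is
  "\<lambda>L \<phi>. if \<phi> \<in> periodic_smooth then - L (vderiv \<phi>) else 0"
proof -
  fix L :: "(real \<Rightarrow> complex) \<Rightarrow> complex"
  let ?P = "periodic_smooth"
  assume "(\<forall>\<phi>. \<phi> \<notin> ?P \<longrightarrow> L \<phi> = 0) \<and>
    (\<forall>\<phi>\<in>?P. \<forall>\<eta>\<in>?P. L (\<lambda>x. \<phi> x + \<eta> x) = L \<phi> + L \<eta>) \<and>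
    (\<forall>c. \<forall>\<phi>\<in>?P. L (\<lambda>x. c * \<phi> x) = c * L \<phi>) \<and>
    (\<forall>X. \<forall>\<phi>\<in>?P. (\<forall>n. X n \<in> ?P) \<and> smooth_tendsto X \<phi> \<longrightarrow> (\<lambda>n. L (X n)) \<longlonglongrightarrow> L \<phi>)"
  then show "?thesis L"
    using vderiv_add[of _ _ 1] cmult_periodic_smooth(1)[of _ 1]
    by (auto simp: periodic_smooth_add cmult_periodic_smooth(2) periodic_smooth_vderiv
        smooth_tendsto_vderiv intro!: tendsto_minus)
qed

text \<open>Product of a distribution with a test function \<open>f\<close> (zero by convention for other \<open>f\<close>).\<close>

lift_definition pd_mult :: "(real \<Rightarrow> complex) \<Rightarrow> pdist \<Rightarrow> pdist" is
  "\<lambda>f L \<phi>. if f \<in> periodic_smooth \<and> \<phi> \<in> periodic_smooth then L (\<lambda>x. f x * \<phi> x) else 0"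
proof -
  fix f and L :: "(real \<Rightarrow> complex) \<Rightarrow> complex"
  let ?P = "periodic_smooth"
  assume L: "(\<forall>\<phi>. \<phi> \<notin> ?P \<longrightarrow> L \<phi> = 0) \<and>
    (\<forall>\<phi>\<in>?P. \<forall>\<eta>\<in>?P. L (\<lambda>x. \<phi> x + \<eta> x) = L \<phi> + L \<eta>) \<and>
    (\<forall>c. \<forall>\<phi>\<in>?P. L (\<lambda>x. c * \<phi> x) = c * L \<phi>) \<and>
    (\<forall>X. \<forall>\<phi>\<in>?P. (\<forall>n. X n \<in> ?P) \<and> smooth_tendsto X \<phi> \<longrightarrow> (\<lambda>n. L (X n)) \<longlonglongrightarrow> L \<phi>)"
  have "L (\<lambda>x. f x * (c * \<phi> x)) = c * L (\<lambda>x. f x * \<phi> x)" if "f \<in> ?P" "\<phi> \<in> ?P" for c \<phi>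
  proof -
    have "(\<lambda>x. f x * (c * \<phi> x)) = (\<lambda>x. c * (f x * \<phi> x))" by (simp add: algebra_simps)
    then show ?thesis using L periodic_smooth_mult[OF that] by simp
  qed
  then show "?thesis f L"
    using L by (auto simp: periodic_smooth_add cmult_periodic_smooth(2) periodic_smooth_mult
        smooth_tendsto_mult distrib_left)
qed

text \<open>The regular distribution given by integration against \<open>f\<close>.\<close>

lift_definition pd_of_fun :: "(real \<Rightarrow> complex) \<Rightarrow> pdist" is
  "\<lambda>f \<phi>. if f \<in> periodic_smooth \<and> \<phi> \<in> periodic_smooth
     then integral {0..2 * pi} (\<lambda>x. f x * \<phi> x) else 0"
proof -
  fix f
  let ?P = "periodic_smooth"
  have int: "(\<lambda>x. f x * \<phi> x) integrable_on {0..2 * pi}" if "f \<in> ?P" "\<phi> \<in> ?P" for \<phi>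
    using that by (intro integrable_continuous_interval periodic_smooth_continuous
        periodic_smooth_mult)
  have "(\<lambda>n. integral {0..2 * pi} (\<lambda>x. f x * X n x)) \<longlonglongrightarrow> integral {0..2 * pi} (\<lambda>x. f x * \<phi> x)"
    if "f \<in> ?P" "\<phi> \<in> ?P" "\<And>n. X n \<in> ?P" "smooth_tendsto X \<phi>" for X \<phi>
  proof -
    have "uniform_limit UNIV (\<lambda>n x. f x * X n x) (\<lambda>x. f x * \<phi> x) sequentially"
      using smooth_tendsto_mult[OF that(1,3,2,4), unfolded smooth_tendsto_def, rule_format, of 0]
      by simp
    then have "uniform_limit {0..2 * pi} (\<lambda>n x. f x * X n x) (\<lambda>x. f x * \<phi> x) sequentially"
      by (rule uniform_limit_on_subset) simp
    moreover have "continuous_on {0..2 * pi} (\<lambda>x. f x * X n x)" for n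
      using that by (intro periodic_smooth_continuous periodic_smooth_mult)
    ultimately obtain I J where
      "\<And>n. ((\<lambda>x. f x * X n x) has_integral I n) {0..2 * pi}"
      "((\<lambda>x. f x * \<phi> x) has_integral J) {0..2 * pi}" "I \<longlonglongrightarrow> J"
      using uniform_limit_integral[where F = sequentially] sequentially_bot by blast
    then have "integral {0..2 * pi} (\<lambda>x. f x * X n x) = I n" "integral {0..2 * pi} (\<lambda>x. f x * \<phi> x) = J" for n
      by (blast intro: integral_unique)+
    then show ?thesis using \<open>I \<longlonglongrightarrow> J\<close> by presburger
  qed
  moreover have "integral {0..2 * pi} (\<lambda>x. f x * (c * \<phi> x))
      = c * integral {0..2 * pi} (\<lambda>x. f x * \<phi> x)" for c \<phi>
  proof -
    have "(\<lambda>x. f x * (c * \<phi> x)) = (\<lambda>x. c * (f x * \<phi> x))" by (simp add: algebra_simps)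
    then show ?thesis by (simp only: integral_mult_right)
  qed
  ultimately show "?thesis f"
    using int by (auto simp: periodic_smooth_add cmult_periodic_smooth(2) distrib_left
        Henstock_Kurzweil_Integration.integral_add)
qed

definition fourier_coeff :: "pdist \<Rightarrow> int \<Rightarrow> complex" where
  "fourier_coeff v k = pairing v (\<lambda>x. exp (- (\<i> * of_int k * of_real x))) / (2 * of_real pi)"

definition fourier_basis :: "int \<Rightarrow> pdist" where
  "fourier_basis k = pd_of_fun (\<lambda>x. exp (\<i> * of_int k * of_real x) / of_real (sqrt (2 * pi)))"


section \<open>Sobolev spaces\<close>

definition sobolev :: "real \<Rightarrow> pdist set" where
  "sobolev s = {v. (\<lambda>k::int. (1 + \<bar>of_int k\<bar>) powr (2 * s) * (cmod (fourier_coeff v k))\<^sup>2)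
      summable_on UNIV}"

definition sobolev_norm :: "real \<Rightarrow> pdist \<Rightarrow> real" where
  "sobolev_norm s v = sqrt (2 * pi *
     (\<Sum>\<^sub>\<infinity>k::int. (1 + \<bar>of_int k\<bar>) powr (2 * s) * (cmod (fourier_coeff v k))\<^sup>2))"

definition sobolev_continuous_on :: "real \<Rightarrow> real set \<Rightarrow> (real \<Rightarrow> pdist) \<Rightarrow> bool" where
  "sobolev_continuous_on s S u \<longleftrightarrow> (\<forall>t\<in>S. u t \<in> sobolev s) \<and>
     (\<forall>t\<in>S. ((\<lambda>t'. sobolev_norm s (u t' - u t)) \<longlongrightarrow> 0) (at t within S))"

text \<open>Strong (Bochner) measurability.\<close>

definition sobolev_measurable :: "real \<Rightarrow> real measure \<Rightarrow> (real \<Rightarrow> pdist) \<Rightarrow> bool" where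
  "sobolev_measurable s M f \<longleftrightarrow> (\<forall>t\<in>space M. f t \<in> sobolev s) \<and>
     (\<exists>\<sigma>. (\<forall>n. simple_function M (\<sigma> n)) \<and> (\<forall>n. \<forall>t\<in>space M. \<sigma> n t \<in> sobolev s) \<and>
       (AE t in M. (\<lambda>n. sobolev_norm s (f t - \<sigma> n t)) \<longlonglongrightarrow> 0))"

text \<open>Bochner integral in \<open>sobolev s\<close>: the library's \<open>has_bochner_integral\<close> with the norm of the
  target type replaced by \<open>sobolev_norm s\<close>. (The space depends on the real number \<open>s\<close>, so it is
  not a type.)\<close>

definition has_sobolev_integral ::
    "real \<Rightarrow> real measure \<Rightarrow> (real \<Rightarrow> pdist) \<Rightarrow> pdist \<Rightarrow> bool" where
  "has_sobolev_integral s M f J \<longleftrightarrow> sobolev_measurable s M f \<and> J \<in> sobolev s \<and>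
     (\<exists>\<sigma>. (\<forall>n. Bochner_Integration.simple_bochner_integrable M (\<sigma> n)) \<and> (\<forall>n. \<forall>t\<in>space M. \<sigma> n t \<in> sobolev s) \<and>
       (\<lambda>n. \<integral>\<^sup>+t. ennreal (sobolev_norm s (f t - \<sigma> n t)) \<partial>M) \<longlonglongrightarrow> 0 \<and>
       (\<lambda>n. sobolev_norm s (Bochner_Integration.simple_bochner_integral M (\<sigma> n) - J)) \<longlonglongrightarrow> 0)"

definition L2_sobolev :: "real \<Rightarrow> real \<Rightarrow> (real \<Rightarrow> pdist) set" where
  "L2_sobolev T s = {h. sobolev_measurable s (lebesgue_on {0..T}) h \<and>
     integrable (lebesgue_on {0..T}) (\<lambda>t. (sobolev_norm s (h t))\<^sup>2)}"

definition L2_sobolev_norm :: "real \<Rightarrow> real \<Rightarrow> (real \<Rightarrow> pdist) \<Rightarrow> real" where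
  "L2_sobolev_norm T s h =
     sqrt (integral\<^sup>L (lebesgue_on {0..T}) (\<lambda>t. (sobolev_norm s (h t))\<^sup>2))"


section \<open>The multiplier, its eigenvalues and the spectral gaps\<close>

definition complex_linear :: "(pdist \<Rightarrow> pdist) \<Rightarrow> bool" where
  "complex_linear A \<longleftrightarrow> (\<forall>u v. A (u + v) = A u + A v) \<and> (\<forall>c u. A (pd_scale c u) = pd_scale c (A u))"

definition multiplier_with_symbol :: "(pdist \<Rightarrow> pdist) \<Rightarrow> (int \<Rightarrow> real) \<Rightarrow> bool" where
  "multiplier_with_symbol A a \<longleftrightarrow> complex_linear A \<and>
     (\<forall>u k. fourier_coeff (A u) k = of_real (a k) * fourier_coeff u k)"

definition eigval :: "(int \<Rightarrow> real) \<Rightarrow> int \<Rightarrow> real" where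
  "eigval a k = of_int k * a k"

definition eig_class :: "(int \<Rightarrow> real) \<Rightarrow> int \<Rightarrow> int set" where
  "eig_class a k1 = {k. eigval a k = eigval a k1}"

definition distinct_index_set :: "(int \<Rightarrow> real) \<Rightarrow> int set \<Rightarrow> bool" where
  "distinct_index_set a J \<longleftrightarrow> (\<forall>k. \<exists>!j. j \<in> J \<inter> eig_class a k)"

text \<open>Extended reals, because the supremum \<open>tail_gap\<close> may be infinite.\<close>

definition gap :: "(int \<Rightarrow> real) \<Rightarrow> int set \<Rightarrow> ereal" where
  "gap a J = (INF (k, n) \<in> {(k, n). k \<in> J \<and> n \<in> J \<and> k \<noteq> n}. ereal \<bar>eigval a k - eigval a n\<bar>)"

definition tail_gap :: "(int \<Rightarrow> real) \<Rightarrow> int set \<Rightarrow> ereal" where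
  "tail_gap a J = (SUP S \<in> {S. finite S \<and> S \<subseteq> J}. gap a (J - S))"


section \<open>The controlled system\<close>

text \<open>Open intervals of the circle are images of open intervals of the line.\<close>

definition circle_open_interval :: "real set \<Rightarrow> bool" where
  "circle_open_interval W \<longleftrightarrow>
     (\<exists>\<alpha> \<beta>. \<alpha> < \<beta> \<and> W = {x. \<exists>n::int. \<alpha> < x + 2 * pi * of_int n \<and> x + 2 * pi * of_int n < \<beta>})"

definition control_profile :: "(real \<Rightarrow> real) \<Rightarrow> bool" where
  "control_profile g \<longleftrightarrow> (\<lambda>x. complex_of_real (g x)) \<in> periodic_smooth \<and> (\<forall>x. 0 \<le> g x) \<and>
     integral {0..2 * pi} g = 1 \<and> circle_open_interval {x. 0 < g x}"

definition control_op :: "(real \<Rightarrow> real) \<Rightarrow> pdist \<Rightarrow> pdist" where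
  "control_op g \<phi> = (let gc = (\<lambda>x. complex_of_real (g x)) in
     pd_mult gc \<phi> - pd_scale (pairing \<phi> gc) (pd_of_fun gc))"

text \<open>The unitary group; a distribution is determined by its Fourier coefficients.\<close>

definition evol :: "(int \<Rightarrow> real) \<Rightarrow> real \<Rightarrow> pdist \<Rightarrow> pdist" where
  "evol a t v = (THE w. \<forall>k. fourier_coeff w k
     = exp (\<i> * of_int k * of_real (a k) * of_real t) * fourier_coeff v k)"

text \<open>\<open>u\<close> solves \<open>\<partial>\<^sub>t u = \<partial>\<^sub>x A u + G h\<close>, \<open>u(0) = u0\<close> on \<open>[0,T]\<close>, the differential equation being
  understood in the mild sense, that is, as the Duhamel formula.\<close>

definition mild_solution :: "real \<Rightarrow> real \<Rightarrow> real \<Rightarrow> (pdist \<Rightarrow> pdist) \<Rightarrow> (int \<Rightarrow> real) \<Rightarrow>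
    (real \<Rightarrow> real) \<Rightarrow> (real \<Rightarrow> pdist) \<Rightarrow> pdist \<Rightarrow> (real \<Rightarrow> pdist) \<Rightarrow> bool" where
  "mild_solution T s r A a g h u0 u \<longleftrightarrow>
     sobolev_continuous_on s {0..T} u \<and>
     (\<forall>t\<in>{0<..<T}. pd_deriv (A (u t)) + control_op g (h t) \<in> sobolev (s - r)) \<and>
     (\<forall>t\<in>{0..T}. \<exists>J. has_sobolev_integral s (lebesgue_on {0..t})
           (\<lambda>t'. evol a (t - t') (control_op g (h t'))) J \<and> u t = evol a t u0 + J) \<and>
     u 0 = u0"

end

theory Submission
  imports Defs
begin

text \<open>
  Write \<open>\<Gamma>\<close> for the matrix of \<open>G\<close> in the basis \<open>e\<^sup>i\<^sup>k\<^sup>x\<close>; it is hermitian and decays rapidly off the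
  diagonal, so \<open>G\<close> is bounded on every Sobolev space. Reaching \<open>u\<^sub>1\<close> at time \<open>T\<close> is a moment problem:
  \<open>\<integral>\<^sub>0\<^sup>T e\<^sup>-\<^sup>i\<^sup>\<lambda>\<^sup>t (G h(t))^(k) dt\<close> with \<open>\<lambda> = \<lambda>\<^sub>k\<close> has to take prescribed values \<open>c\<^sub>k\<close> with \<open>c\<^sub>0 = 0\<close>.

  The gap conditions provide functions \<open>q\<^sub>j\<close> on \<open>[0, T]\<close>, one for each distinct eigenvalue, which are
  biorthogonal to the exponentials and bounded uniformly in \<open>j\<close>. When all gaps exceed \<open>2\<pi>/T\<close>, Ingham's
  kernel \<open>\<rho>\<close> gives a strictly diagonally dominant matrix of moments of \<open>\<rho>(t) e\<^sup>i\<^sup>\<lambda>\<^sup>t\<close>, inverted by a Neumann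
  series; the finitely many remaining frequencies are added one at a time, each at the price of an
  arbitrarily small increase of the time.

  With \<open>h = G (\<Sum>\<^sub>m h\<^sub>m q\<^sub>m(t) e\<^sup>i\<^sup>m\<^sup>x)\<close>, where \<open>q\<^sub>m\<close> belongs to the eigenvalue of \<open>m\<close>, the moment problem
  decouples into the linear systems \<open>\<Sum>\<^sub>m (\<Gamma>\<^sup>2)\<^sub>k\<^sub>m h\<^sub>m = c\<^sub>k\<close> over the classes of equal eigenvalues. Their
  matrices are Gram matrices of the columns of \<open>\<Gamma>\<close>, which are linearly independent away from the index
  \<open>0\<close> because a trigonometric polynomial that is constant on an interval is constant. All but finitely
  many classes are singletons with \<open>(\<Gamma>\<^sup>2)\<^sub>k\<^sub>k\<close> bounded below, so the solution is controlled in every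
  Sobolev norm. Since the \<open>q\<^sub>j\<close> are bounded functions, every vector-valued function of time that occurs
  is dominated coefficientwise, and its Bochner integral is computed coefficientwise.
\<close>

section \<open>Sums over the integers\<close>

text \<open>The zero mode shapes the statement: since g has mass 1, row and column 0 of \<Gamma>
  vanish, so no control moves the mean. This forces c_0 = 0 and leaves the unknown h_0 free. Letting
  h itself be an image of G puts \<Gamma>^2 in place of \<Gamma>; invertibility of its blocks is
  then only a question of linear independence of columns.

  The uniform bound on the q_j takes the place of a Riesz sequence in L^2(0, T): at every time the
  m-th coefficient of the argument of G is at most a constant times |h_m|, so the norm estimate
  needs no orthogonality in time. It is also the reason for working in l^1: an l^1 combination of
  uniformly bounded functions is again bounded by a controlled constant.

  The condition T > 2 pi / \<gamma>' enters once. After removal of finitely many frequencies the gap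
  exceeds 2 pi / T, and there is room for \<alpha> strictly between pi / T and half of that gap: the
  kernel, of length pi / \<alpha>, then fits into [0, T] and still gives diagonal dominance.\<close>

lemma summable_on_bounded_sums:
  fixes f :: "'a \<Rightarrow> real"
  assumes "\<And>x. x \<in> A \<Longrightarrow> 0 \<le> f x" "\<And>F. finite F \<Longrightarrow> F \<subseteq> A \<Longrightarrow> sum f F \<le> B"
  shows "f summable_on A" "infsum f A \<le> B"
proof -
  show *: "f summable_on A"
    using assms by (intro nonneg_bdd_above_summable_on) (auto intro!: bdd_aboveI[of _ B])
  show "infsum f A \<le> B"
    by (rule infsum_le_finite_sums[OF * assms(2)])
qed

lemma has_sum_sum':
  fixes f :: "'b \<Rightarrow> 'a \<Rightarrow> 'c::{topological_comm_monoid_add,t2_space}"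
  assumes "\<And>i. i \<in> I \<Longrightarrow> (f i has_sum s i) A"
  shows "((\<lambda>x. \<Sum>i\<in>I. f i x) has_sum (\<Sum>i\<in>I. s i)) A"
  using assms by (induction I rule: infinite_finite_induct) (auto intro!: has_sum_add)

lemma summable_on_sum':
  fixes f :: "'b \<Rightarrow> 'a \<Rightarrow> 'c::{topological_comm_monoid_add,t2_space}"
  assumes "\<And>i. i \<in> I \<Longrightarrow> f i summable_on A"
  shows "(\<lambda>x. \<Sum>i\<in>I. f i x) summable_on A"
  using has_sum_sum'[of I f A "\<lambda>i. infsum (f i) A"] assms by (auto simp: summable_on_def)

lemma infsum_sum':
  fixes f :: "'b \<Rightarrow> 'a \<Rightarrow> 'c::{topological_comm_monoid_add,t2_space}"
  assumes "\<And>i. i \<in> I \<Longrightarrow> f i summable_on A"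
  shows "infsum (\<lambda>x. \<Sum>i\<in>I. f i x) A = (\<Sum>i\<in>I. infsum (f i) A)"
  using has_sum_sum'[of I f A "\<lambda>i. infsum (f i) A"] assms by (auto intro!: infsumI)

lemma summable_on_dominated:
  fixes f :: "'a \<Rightarrow> 'b::banach"
  assumes "c summable_on A" "\<And>x. x \<in> A \<Longrightarrow> norm (f x) \<le> c x"
  shows "(\<lambda>x. norm (f x)) summable_on A" "f summable_on A"
    "norm (infsum f A) \<le> infsum c A"
proof -
  have c0: "0 \<le> c x" if "x \<in> A" for x
    using assms(2)[OF that] norm_ge_zero order_trans by blast
  show *: "(\<lambda>x. norm (f x)) summable_on A"
  proof (rule summable_on_bounded_sums(1))
    show "(\<Sum>x\<in>F. norm (f x)) \<le> infsum c A" if "finite F" "F \<subseteq> A" for F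
    proof -
      have "(\<Sum>x\<in>F. norm (f x)) \<le> sum c F"
        using assms(2) that by (intro sum_mono) auto
      also have "\<dots> \<le> infsum c A"
        using c0 that by (intro finite_sum_le_infsum assms) auto
      finally show ?thesis .
    qed
  qed simp
  then show "f summable_on A" by (rule abs_summable_summable)
  have "norm (infsum f A) \<le> infsum (\<lambda>x. norm (f x)) A"
    by (rule norm_infsum_bound[OF *])
  also have "\<dots> \<le> infsum c A"
    by (intro infsum_mono * assms)
  finally show "norm (infsum f A) \<le> infsum c A" .
qed

text \<open>Tannery's theorem: a finite set A carries all of c up to e / 2, and on A the limit is a
  finite one. The filter is arbitrary because both sequences of approximations and limits in time
  occur.\<close>

lemma infsum_tendsto_zero_dominated:
  fixes f :: "'b \<Rightarrow> 'a \<Rightarrow> real"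
  assumes lim: "\<And>k. ((\<lambda>x. f x k) \<longlongrightarrow> 0) F"
    and dom: "eventually (\<lambda>x. \<forall>k. \<bar>f x k\<bar> \<le> c k) F"
    and c: "c summable_on UNIV"
  shows "((\<lambda>x. infsum (f x) UNIV) \<longlongrightarrow> 0) F"
proof (rule tendstoI)
  fix e :: real assume "e > 0"
  then obtain A where A: "finite A" "dist (sum c A) (infsum c UNIV) \<le> e / 2"
    using infsum_finite_approximation[OF c, of "e/2"] by auto
  have sA: "c summable_on (- A)"
    using c by (rule summable_on_subset_banach) simp
  have tail: "infsum c (- A) \<le> e / 2"
  proof -
    have "infsum c UNIV = infsum c A + infsum c (- A)"
      using infsum_Un_disjoint[of c A "- A"] A(1) sA by simp
    then show ?thesis using A by (simp add: dist_real_def)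
  qed
  have "((\<lambda>x. \<Sum>k\<in>A. \<bar>f x k\<bar>) \<longlongrightarrow> (\<Sum>k\<in>A. 0)) F"
    using lim by (intro tendsto_sum) (simp add: tendsto_rabs_zero_iff)
  then have "eventually (\<lambda>x. \<bar>\<Sum>k\<in>A. \<bar>f x k\<bar>\<bar> < e / 2) F"
    using \<open>e > 0\<close> unfolding tendsto_iff dist_real_def by (auto elim!: allE[of _ "e/2"])
  then show "eventually (\<lambda>x. dist (infsum (f x) UNIV) 0 < e) F"
    using dom
  proof eventually_elim
    case (elim x)
    have s: "f x summable_on (- A)" "norm (infsum (f x) (- A)) \<le> infsum c (- A)"
      using summable_on_dominated[OF sA, of "f x"] elim by auto
    have "infsum (f x) UNIV = sum (f x) A + infsum (f x) (- A)"
      using infsum_Un_disjoint[of "f x" A "- A"] A(1) s by simp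
    moreover have "\<bar>sum (f x) A\<bar> \<le> (\<Sum>k\<in>A. \<bar>f x k\<bar>)" by (rule sum_abs)
    ultimately show ?case
      using elim(1) s(2) tail abs_triangle_ineq[of "sum (f x) A" "infsum (f x) (- A)"]
      unfolding dist_real_def real_norm_def by linarith
  qed
qed

text \<open>Turns unordered sums over the integers into limits of sequences, for which measurability
  and dominated convergence are available.\<close>

lemma filterlim_int_box:
  "filterlim (\<lambda>n::nat. {- int n..int n}) (finite_subsets_at_top UNIV) sequentially"
  unfolding filterlim_finite_subsets_at_top
proof (intro allI impI)
  fix X :: "int set" assume X: "finite X \<and> X \<subseteq> UNIV"
  define N where "N = nat (Max (insert 0 (abs ` X)))"
  have "\<forall>x\<in>X. \<bar>x\<bar> \<le> int N"
    unfolding N_def using X by (auto simp: le_nat_iff)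
  then have "X \<subseteq> {- int n..int n}" if "n \<ge> N" for n
    using that by force
  then show "eventually (\<lambda>n. finite {- int n..int n} \<and> X \<subseteq> {- int n..int n}
      \<and> {- int n..int n} \<subseteq> UNIV) sequentially"
    by (intro eventually_mono[OF eventually_ge_at_top[of N]]) auto
qed

lemma has_sum_int_box:
  assumes "(f has_sum S) (UNIV :: int set)"
  shows "(\<lambda>n::nat. \<Sum>k\<in>{- int n..int n}. f k) \<longlonglongrightarrow> S"
  using filterlim_compose[OF assms[unfolded has_sum_def] filterlim_int_box] .

lemma borel_measurable_infsum_int:
  fixes f :: "int \<Rightarrow> 'a \<Rightarrow> 'b::{banach,second_countable_topology}"
  assumes [measurable]: "\<And>k. f k \<in> borel_measurable M"
    and "\<And>t. t \<in> space M \<Longrightarrow> (\<lambda>k. f k t) summable_on UNIV"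
  shows "(\<lambda>t. \<Sum>\<^sub>\<infinity>k. f k t) \<in> borel_measurable M"
proof (rule borel_measurable_LIMSEQ_metric)
  show "(\<lambda>t. \<Sum>k\<in>{- int n..int n}. f k t) \<in> borel_measurable M" for n by measurable
  show "(\<lambda>n. \<Sum>k\<in>{- int n..int n}. f k t) \<longlonglongrightarrow> (\<Sum>\<^sub>\<infinity>k. f k t)" if "t \<in> space M" for t
    using assms(2)[OF that] by (intro has_sum_int_box) simp
qed

text \<open>Dominated convergence for the symmetric partial sums. The majorant has product form, so
  that \<open>infsum c UNIV * b t\<close> bounds all of them at once.\<close>

lemma integral_infsum_int:
  fixes f :: "int \<Rightarrow> 'a \<Rightarrow> 'b::{banach,second_countable_topology}"
  assumes f[measurable]: "\<And>k. f k \<in> borel_measurable M"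
    and bound: "\<And>k t. t \<in> space M \<Longrightarrow> norm (f k t) \<le> c k * b t"
    and b: "integrable M b" and c: "c summable_on UNIV" and c0: "\<And>k. 0 \<le> c k"
  shows "integrable M (\<lambda>t. \<Sum>\<^sub>\<infinity>k. f k t)"
    and "integral\<^sup>L M (\<lambda>t. \<Sum>\<^sub>\<infinity>k. f k t) = (\<Sum>\<^sub>\<infinity>k. integral\<^sup>L M (f k))"
proof -
  have cb: "(\<lambda>k. c k * b t) summable_on UNIV" for t
    by (rule summable_on_cmult_left[OF c])
  note sm = summable_on_dominated[OF cb bound]
  have meas: "(\<lambda>t. \<Sum>\<^sub>\<infinity>k. f k t) \<in> borel_measurable M"
    by (rule borel_measurable_infsum_int) (auto intro: f sm)
  let ?b = "\<lambda>t. infsum c UNIV * b t"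
  have ib: "integrable M ?b" using b by simp
  have bd: "norm (\<Sum>k\<in>K. f k t) \<le> ?b t" if "t \<in> space M" "finite K" for t K
  proof -
    have "norm (\<Sum>k\<in>K. f k t) \<le> (\<Sum>k\<in>K. norm (f k t))" by (rule norm_sum)
    also have "\<dots> \<le> (\<Sum>\<^sub>\<infinity>k. norm (f k t))"
      using that sm(1) by (intro finite_sum_le_infsum) auto
    also have "\<dots> \<le> (\<Sum>\<^sub>\<infinity>k. c k * b t)"
      using that by (intro infsum_mono sm(1) cb bound) auto
    finally show ?thesis by (simp add: infsum_cmult_left')
  qed
  have lim: "AE t in M. (\<lambda>n. \<Sum>k\<in>{- int n..int n}. f k t) \<longlonglongrightarrow> (\<Sum>\<^sub>\<infinity>k. f k t)"
    using sm(2) by (intro AE_I2 has_sum_int_box has_sum_infsum) auto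
  have bdAE: "AE t in M. norm (\<Sum>k\<in>{- int n..int n}. f k t) \<le> ?b t" for n
    by (rule AE_I2) (auto intro: bd)
  have me: "(\<lambda>t. \<Sum>k\<in>{- int n..int n}. f k t) \<in> borel_measurable M" for n by measurable
  show "integrable M (\<lambda>t. \<Sum>\<^sub>\<infinity>k. f k t)"
    by (rule integrable_dominated_convergence[OF meas me ib lim bdAE])
  have fi: "integrable M (f k)" for k
    by (rule Bochner_Integration.integrable_bound[of M "\<lambda>t. c k * b t"])
       (use b bound in \<open>auto intro!: AE_I2 order_trans[OF bound abs_ge_self]\<close>)
  have "(\<lambda>n. integral\<^sup>L M (\<lambda>t. \<Sum>k\<in>{- int n..int n}. f k t)) \<longlonglongrightarrow> integral\<^sup>L M (\<lambda>t. \<Sum>\<^sub>\<infinity>k. f k t)"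
    by (rule integral_dominated_convergence[OF meas me ib lim bdAE])
  then have 1: "(\<lambda>n. \<Sum>k\<in>{- int n..int n}. integral\<^sup>L M (f k)) \<longlonglongrightarrow> integral\<^sup>L M (\<lambda>t. \<Sum>\<^sub>\<infinity>k. f k t)"
    using fi by (simp add: Bochner_Integration.integral_sum)
  have "norm (integral\<^sup>L M (f k)) \<le> c k * integral\<^sup>L M b" for k
  proof -
    have "norm (integral\<^sup>L M (f k)) \<le> integral\<^sup>L M (\<lambda>t. norm (f k t))" by (rule integral_norm_bound)
    also have "\<dots> \<le> integral\<^sup>L M (\<lambda>t. c k * b t)"
      using fi b bound by (intro integral_mono) auto
    finally show ?thesis by simp
  qed
  then have "(\<lambda>k. integral\<^sup>L M (f k)) summable_on UNIV"
    by (rule summable_on_dominated(2)[OF summable_on_cmult_left[OF c]])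
  then have "(\<lambda>n. \<Sum>k\<in>{- int n..int n}. integral\<^sup>L M (f k)) \<longlonglongrightarrow> (\<Sum>\<^sub>\<infinity>k. integral\<^sup>L M (f k))"
    by (intro has_sum_int_box) simp
  with 1 show "integral\<^sup>L M (\<lambda>t. \<Sum>\<^sub>\<infinity>k. f k t) = (\<Sum>\<^sub>\<infinity>k. integral\<^sup>L M (f k))"
    by (rule LIMSEQ_unique)
qed

section \<open>The Sobolev weight and a summable convolution kernel\<close>

definition jap :: "int \<Rightarrow> real" where "jap k = 1 + \<bar>of_int k\<bar>"

lemma jap_ge_1: "1 \<le> jap k" and jap_pos: "0 < jap k" and jap_nonneg: "0 \<le> jap k"
  by (simp_all add: jap_def)

lemma jap_minus: "jap (- k) = jap k"
  by (simp add: jap_def)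

text \<open>Submultiplicativity, the source of Peetre's inequality
  \<open>jap_powr_le\<close>.\<close>

lemma jap_add_le: "jap (k + m) \<le> jap k * jap m"
proof -
  have "\<bar>real_of_int k + real_of_int m\<bar> \<le> \<bar>real_of_int k\<bar> + \<bar>real_of_int m\<bar>" by (rule abs_triangle_ineq)
  moreover have "0 \<le> \<bar>real_of_int k\<bar> * \<bar>real_of_int m\<bar>" by simp
  moreover have "(1 + \<bar>real_of_int k\<bar>) * (1 + \<bar>real_of_int m\<bar>)
      = 1 + \<bar>real_of_int k\<bar> + \<bar>real_of_int m\<bar> + \<bar>real_of_int k\<bar> * \<bar>real_of_int m\<bar>"
    by (simp add: algebra_simps)
  ultimately show ?thesis unfolding jap_def of_int_add by linarith
qed

text \<open>Two powers of \<open>jap\<close> are enough for summability. Later estimates ask for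
  decay of order n + 2 and spend n powers on weights and two on this kernel.\<close>

definition kern :: "int \<Rightarrow> real" where "kern k = 1 / (jap k)\<^sup>2"

lemma kern_nonneg: "0 \<le> kern k" and kern_pos: "0 < kern k" and kern_le_1: "kern k \<le> 1"
  and kern_minus: "kern (- k) = kern k"
  using jap_ge_1[of k] by (auto simp: kern_def jap_minus divide_le_eq_1 one_le_power)

lemma kern_summable: "kern summable_on UNIV"
proof -
  have s: "(\<lambda>n::nat. 1 / (1 + real n)\<^sup>2) summable_on UNIV"
  proof (rule summable_nonneg_imp_summable_on)
    have "summable (\<lambda>n. inverse (real (Suc n) ^ 2))"
      using inverse_power_summable[of 2, where 'a=real] by (subst summable_Suc_iff) auto
    then show "summable (\<lambda>n. 1 / (1 + real n)\<^sup>2)"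
      by (simp add: inverse_eq_divide add.commute)
  qed simp
  have "kern summable_on range int"
    by (subst summable_on_reindex) (auto simp: comp_def kern_def jap_def s)
  moreover have "kern summable_on (uminus ` range int)"
    unfolding image_image
    by (subst summable_on_reindex) (auto simp: comp_def kern_def jap_def s inj_on_def)
  then have "kern summable_on (uminus ` range int - range int)"
    by (rule summable_on_subset_banach) auto
  ultimately have "kern summable_on (range int \<union> (uminus ` range int - range int))"
    by (rule summable_on_Un_disjoint) auto
  moreover have "range int \<union> (uminus ` range int - range int) = UNIV"
    by (auto simp: image_image) (metis int_cases2 range_eqI)
  ultimately show ?thesis by simp
qed

definition kern_sum :: real where "kern_sum = infsum kern UNIV"

lemma kern_sum_finite: "finite F \<Longrightarrow> (\<Sum>k\<in>F. kern (k - m)) \<le> kern_sum"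
proof -
  assume F: "finite F"
  have "(\<Sum>k\<in>F. kern (k - m)) = sum kern ((\<lambda>k. k - m) ` F)"
    by (subst sum.reindex) (auto simp: inj_on_def)
  also have "\<dots> \<le> kern_sum"
    unfolding kern_sum_def
    using F by (intro finite_sum_le_infsum kern_summable) (auto simp: kern_nonneg)
  finally show ?thesis .
qed

lemma kern_sum_ge_1: "1 \<le> kern_sum"
  using kern_sum_finite[of "{0}" 0] by (simp add: kern_def jap_def)

lemma kern_sum_finite': "finite F \<Longrightarrow> (\<Sum>m\<in>F. kern (k - m)) \<le> kern_sum"
  using kern_sum_finite[of F k] kern_minus[of "k - _"] by (simp add: minus_diff_eq)

text \<open>Young's inequality l^1 * l^2, by Schur's test: with the kernel split into two square
  roots, Cauchy-Schwarz bounds the square of the convolution by \<open>kern_sum * Z k\<close>, and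
  summing Z over k costs \<open>kern_sum\<close> once more.\<close>

lemma kern_conv:
  fixes y :: "int \<Rightarrow> real"
  assumes y0: "\<And>m. 0 \<le> y m" and y2: "(\<lambda>m. (y m)\<^sup>2) summable_on UNIV"
  shows "(\<lambda>m. kern (k - m) * y m) summable_on UNIV"
    and "(\<lambda>k. (\<Sum>\<^sub>\<infinity>m. kern (k - m) * y m)\<^sup>2) summable_on UNIV"
    and "(\<Sum>\<^sub>\<infinity>k. (\<Sum>\<^sub>\<infinity>m. kern (k - m) * y m)\<^sup>2) \<le> kern_sum\<^sup>2 * (\<Sum>\<^sub>\<infinity>m. (y m)\<^sup>2)"
proof -
  define Z where "Z k = (\<Sum>\<^sub>\<infinity>m. kern (k - m) * (y m)\<^sup>2)" for k
  have Zs: "(\<lambda>m. kern (k - m) * (y m)\<^sup>2) summable_on UNIV" for k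
    by (rule summable_on_dominated(2)[OF y2]) (simp add: kern_nonneg abs_mult mult_left_le_one_le kern_le_1)
  have S0: "0 \<le> kern_sum" using kern_sum_ge_1 by simp
  have Z0: "0 \<le> Z k" for k unfolding Z_def by (intro infsum_nonneg) (simp add: kern_nonneg)
  have fin: "(\<Sum>m\<in>F. kern (k - m) * y m) \<le> sqrt (kern_sum * Z k)" if "finite F" for F k
  proof (rule real_le_rsqrt)
    have "(\<Sum>m\<in>F. kern (k - m) * y m)\<^sup>2
        = (\<Sum>m\<in>F. sqrt (kern (k - m)) * (sqrt (kern (k - m)) * y m))\<^sup>2"
      by (simp add: kern_nonneg flip: mult.assoc)
    also have "\<dots> \<le> (\<Sum>m\<in>F. (sqrt (kern (k - m)))\<^sup>2) * (\<Sum>m\<in>F. (sqrt (kern (k - m)) * y m)\<^sup>2)"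
      by (rule Cauchy_Schwarz_ineq_sum)
    also have "\<dots> = (\<Sum>m\<in>F. kern (k - m)) * (\<Sum>m\<in>F. kern (k - m) * (y m)\<^sup>2)"
      by (simp add: power_mult_distrib kern_nonneg)
    also have "\<dots> \<le> kern_sum * Z k"
      unfolding Z_def using that
      by (intro mult_mono kern_sum_finite' finite_sum_le_infsum Zs S0 sum_nonneg)
         (auto simp: kern_nonneg)
    finally show "(\<Sum>m\<in>F. kern (k - m) * y m)\<^sup>2 \<le> kern_sum * Z k" .
  qed
  note cs = summable_on_bounded_sums[OF _ fin, of UNIV, simplified]
  show "(\<lambda>m. kern (k - m) * y m) summable_on UNIV" for k
    by (rule cs(1)) (simp add: kern_nonneg y0)
  have c2: "(\<Sum>\<^sub>\<infinity>m. kern (k - m) * y m)\<^sup>2 \<le> kern_sum * Z k" for k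
  proof -
    have "(\<Sum>\<^sub>\<infinity>m. kern (k - m) * y m) \<le> sqrt (kern_sum * Z k)"
      by (rule cs(2)) (simp add: kern_nonneg y0)
    moreover have "0 \<le> (\<Sum>\<^sub>\<infinity>m. kern (k - m) * y m)"
      by (intro infsum_nonneg) (simp add: kern_nonneg y0)
    ultimately have "(\<Sum>\<^sub>\<infinity>m. kern (k - m) * y m)\<^sup>2 \<le> (sqrt (kern_sum * Z k))\<^sup>2"
      by (rule power_mono)
    then show ?thesis using S0 Z0 by simp
  qed
  have Zsum: "(\<Sum>k\<in>F. Z k) \<le> kern_sum * (\<Sum>\<^sub>\<infinity>m. (y m)\<^sup>2)" if "finite F" for F
  proof -
    have "(\<Sum>k\<in>F. Z k) = (\<Sum>\<^sub>\<infinity>m. \<Sum>k\<in>F. kern (k - m) * (y m)\<^sup>2)"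
      unfolding Z_def by (rule infsum_sum'[symmetric]) (rule Zs)
    also have "\<dots> \<le> (\<Sum>\<^sub>\<infinity>m. kern_sum * (y m)\<^sup>2)"
    proof (rule infsum_mono)
      show "(\<lambda>m. \<Sum>k\<in>F. kern (k - m) * (y m)\<^sup>2) summable_on UNIV"
        by (rule summable_on_sum') (rule Zs)
      show "(\<lambda>m. kern_sum * (y m)\<^sup>2) summable_on UNIV" by (rule summable_on_cmult_right[OF y2])
      show "(\<Sum>k\<in>F. kern (k - m) * (y m)\<^sup>2) \<le> kern_sum * (y m)\<^sup>2" for m
        using kern_sum_finite[OF that] by (simp add: mult_right_mono flip: sum_distrib_right)
    qed
    finally show ?thesis by (simp add: infsum_cmult_right')
  qed
  have "(\<Sum>k\<in>F. (\<Sum>\<^sub>\<infinity>m. kern (k - m) * y m)\<^sup>2) \<le> kern_sum * (kern_sum * (\<Sum>\<^sub>\<infinity>m. (y m)\<^sup>2))"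
    if "finite F" for F
    proof -
    have "(\<Sum>k\<in>F. (\<Sum>\<^sub>\<infinity>m. kern (k - m) * y m)\<^sup>2) \<le> (\<Sum>k\<in>F. kern_sum * Z k)"
      by (intro sum_mono c2)
    also have "\<dots> = kern_sum * (\<Sum>k\<in>F. Z k)" by (simp add: sum_distrib_left)
    finally show ?thesis
      using mult_left_mono[OF Zsum[OF that] S0] by linarith
  qed
  then have b: "(\<Sum>k\<in>F. (\<Sum>\<^sub>\<infinity>m. kern (k - m) * y m)\<^sup>2) \<le> kern_sum\<^sup>2 * (\<Sum>\<^sub>\<infinity>m. (y m)\<^sup>2)"
    if "finite F" for F
    using that by (simp add: power2_eq_square mult.assoc)
  show "(\<lambda>k. (\<Sum>\<^sub>\<infinity>m. kern (k - m) * y m)\<^sup>2) summable_on UNIV"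
    "(\<Sum>\<^sub>\<infinity>k. (\<Sum>\<^sub>\<infinity>m. kern (k - m) * y m)\<^sup>2) \<le> kern_sum\<^sup>2 * (\<Sum>\<^sub>\<infinity>m. (y m)\<^sup>2)"
    using summable_on_bounded_sums[OF _ b, of UNIV] by auto
qed

section \<open>Fourier series of smooth periodic functions\<close>

definition emode :: "int \<Rightarrow> real \<Rightarrow> complex" where
  "emode k x = exp (\<i> * of_int k * of_real x)"

lemma emode_add: "emode (k + m) x = emode k x * emode m x"
  by (simp add: emode_def algebra_simps exp_add)

lemma emode_0 [simp]: "emode 0 x = 1"
  by (simp add: emode_def)

lemma norm_emode [simp]: "cmod (emode k x) = 1"
proof -
  have "emode k x = exp (\<i> * of_real (of_int k * x))" by (simp add: emode_def mult.assoc)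
  then show ?thesis by (simp only: norm_exp_i_times)
qed

lemma emode_periodic: "emode k (x + of_int n * (2 * pi)) = emode k x"
proof -
  have "emode k (x + of_int n * (2 * pi)) = emode k x * exp (2 * of_real pi * \<i> * of_int (k * n))"
    by (simp add: emode_def algebra_simps exp_add)
  also have "exp (2 * of_real pi * \<i> * of_int (k * n)) = 1"
    using exp_integer_2pi[of "of_int (k * n)"] by (simp add: algebra_simps)
  finally show ?thesis by simp
qed

lemma cnj_emode: "cnj (emode k x) = emode (- k) x"
  by (simp add: emode_def exp_cnj)

lemma emode_has_vderiv: "(emode k has_vector_derivative \<i> * of_int k * emode k x) (at x)"
proof -
  have "((\<lambda>z. exp (\<i> * of_int k * z)) has_field_derivative \<i> * of_int k * exp (\<i> * of_int k * of_real x)) (at (of_real x))"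
    by (auto intro!: derivative_eq_intros)
  from has_vector_derivative_real_field[OF this] show ?thesis
    by (simp add: emode_def[abs_def])
qed

lemma vderiv_emode: "(vderiv ^^ n) (emode k) = (\<lambda>x. (\<i> * of_int k) ^ n * emode k x)"
proof (induction n)
  case (Suc n)
  show ?case
  proof
    fix x
    have "((\<lambda>x. (\<i> * of_int k) ^ n * emode k x) has_vector_derivative
        (\<i> * of_int k) ^ n * (\<i> * of_int k * emode k x)) (at x)"
      by (intro has_vector_derivative_mult_right emode_has_vderiv)
    then show "(vderiv ^^ Suc n) (emode k) x = (\<i> * of_int k) ^ Suc n * emode k x"
      using Suc by (simp add: vderiv_at algebra_simps)
  qed
qed simp

lemma emode_smooth [simp]: "emode k \<in> periodic_smooth"
proof -
  have "emode k (x + 2 * pi) = emode k x" for x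
    using emode_periodic[of k x 1] by simp
  moreover have "(\<lambda>x. (\<i> * of_int k) ^ n * emode k x) differentiable (at x)" for n x
    by (intro differentiable_mult differentiable_const differentiableI_vector[OF emode_has_vderiv])
  ultimately show ?thesis by (simp add: periodic_smooth_def vderiv_emode)
qed

lemma periodic_smooth_period:
  assumes "\<phi> \<in> periodic_smooth"
  shows "\<phi> (x + of_int n * (2 * pi)) = \<phi> x"
proof (induction n rule: int_induct[of _ 0])
  case (step1 i)
  have "\<phi> ((x + of_int i * (2 * pi)) + 2 * pi) = \<phi> (x + of_int i * (2 * pi))"
    using assms by (simp only: periodic_smooth_def mem_Collect_eq)
  then show ?case using step1 by (simp add: algebra_simps)
next
  case (step2 i)
  have "\<phi> ((x + of_int (i - 1) * (2 * pi)) + 2 * pi) = \<phi> (x + of_int (i - 1) * (2 * pi))"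
    using assms by (simp only: periodic_smooth_def mem_Collect_eq)
  then show ?case using step2 by (simp add: algebra_simps)
qed simp

lemma vderiv_funpow_smooth:
  "\<phi> \<in> periodic_smooth \<Longrightarrow> (vderiv ^^ n) \<phi> \<in> periodic_smooth"
  by (induction n) (simp_all add: periodic_smooth_vderiv)

lemma periodic_smooth_sum:
  assumes "\<And>i. i \<in> I \<Longrightarrow> f i \<in> periodic_smooth"
  shows "(\<lambda>x. \<Sum>i\<in>I. f i x) \<in> periodic_smooth"
    and "(vderiv ^^ n) (\<lambda>x. \<Sum>i\<in>I. f i x) = (\<lambda>x. \<Sum>i\<in>I. (vderiv ^^ n) (f i) x)"
proof -
  have "(\<lambda>x. \<Sum>i\<in>I. f i x) \<in> periodic_smooth \<and>
     (vderiv ^^ n) (\<lambda>x. \<Sum>i\<in>I. f i x) = (\<lambda>x. \<Sum>i\<in>I. (vderiv ^^ n) (f i) x)"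
    using assms
  proof (induction I rule: infinite_finite_induct)
    case (insert i I)
    then show ?case
      by (simp add: periodic_smooth_add vderiv_add)
  qed (use cmult_periodic_smooth(1)[OF periodic_smooth_zero, of n 0] periodic_smooth_zero in simp_all)
  then show "(\<lambda>x. \<Sum>i\<in>I. f i x) \<in> periodic_smooth"
    "(vderiv ^^ n) (\<lambda>x. \<Sum>i\<in>I. f i x) = (\<lambda>x. \<Sum>i\<in>I. (vderiv ^^ n) (f i) x)" by auto
qed

lemma periodic_smooth_sup:
  assumes "\<phi> \<in> periodic_smooth"
  obtains B where "0 \<le> B" "\<And>x. cmod (\<phi> x) \<le> B"
  using periodic_smooth_bounded[OF assms] unfolding bounded_iff
  by (metis norm_ge_zero order_trans rangeI)

section \<open>Fourier coefficients and Bessel's inequality\<close>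

definition fcoef :: "(real \<Rightarrow> complex) \<Rightarrow> int \<Rightarrow> complex" where
  "fcoef \<phi> k = integral {0..2 * pi} (\<lambda>x. \<phi> x * emode (- k) x) / (2 * of_real pi)"

text \<open>Only boundedness and Borel measurability are asked for because the quotient in
  \<open>fourier_series_pointwise\<close> need not be continuous: where its denominator vanishes it
  has the default value 0.\<close>

lemma integrable_bounded_0_2pi:
  fixes H :: "real \<Rightarrow> complex"
  assumes "H \<in> borel_measurable borel" "\<And>x. cmod (H x) \<le> B"
  shows "H integrable_on {0..2 * pi}"
proof -
  have "set_integrable lborel {0..2 * pi} H"
    unfolding set_integrable_def
    by (rule integrableI_bounded_set_indicator[where B = B]) (use assms in auto)
  then show ?thesis by (rule set_borel_integral_eq_integral(1))
qed

lemma emode_measurable [measurable]: "emode k \<in> borel_measurable borel"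
  unfolding emode_def[abs_def] by measurable

lemma emode_integral:
  "(emode k has_integral (if k = 0 then 2 * of_real pi else 0)) {0..2 * pi}"
proof (cases "k = 0")
  case True
  have "((\<lambda>_. 1 :: complex) has_integral (2 * pi) *\<^sub>R 1) {0..2 * pi}"
    using has_integral_const_real[of "1::complex" 0 "2 * pi"] by simp
  then show ?thesis using True by (simp add: scaleR_conv_of_real emode_def[abs_def])
next
  case False
  have "((\<lambda>x. emode k x / (\<i> * of_int k)) has_vector_derivative emode k x) (at x within S)" for x S
  proof -
    have "((\<lambda>x. (1 / (\<i> * of_int k)) * emode k x) has_vector_derivative (1 / (\<i> * of_int k)) * (\<i> * of_int k * emode k x)) (at x)"
      by (intro has_vector_derivative_mult_right emode_has_vderiv)
    then show ?thesis using False by (simp add: has_vector_derivative_at_within)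
  qed
  then have "(emode k has_integral emode k (2 * pi) / (\<i> * of_int k) - emode k 0 / (\<i> * of_int k)) {0..2 * pi}"
    by (intro fundamental_theorem_of_calculus) auto
  then show ?thesis using False emode_periodic[of k 0 1] by simp
qed

lemma has_integral_fcoef:
  assumes "H \<in> borel_measurable borel" "\<And>x. cmod (H x) \<le> B"
  shows "((\<lambda>x. H x * emode (- k) x) has_integral 2 * of_real pi * fcoef H k) {0..2 * pi}"
proof -
  have "(\<lambda>x. H x * emode (- k) x) integrable_on {0..2 * pi}"
    by (rule integrable_bounded_0_2pi[of _ B]) (use assms in \<open>auto simp: norm_mult\<close>)
  then show ?thesis by (simp add: fcoef_def has_integral_iff)
qed

text \<open>Integrate |H - S|^2 \<ge> 0 for the partial Fourier sum S. The integrals of H times the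
  conjugate of S and of |S|^2 both equal 2 pi q, which leaves q \<le> B^2.\<close>

lemma bessel_bounded:
  assumes H: "H \<in> borel_measurable borel" "\<And>x. cmod (H x) \<le> B" and K: "finite K"
  shows "(\<Sum>k\<in>K. (cmod (fcoef H k))\<^sup>2) \<le> B\<^sup>2"
proof -
  define S where "S x = (\<Sum>k\<in>K. fcoef H k * emode k x)" for x
  define q where "q = (\<Sum>k\<in>K. (cmod (fcoef H k))\<^sup>2)"
  have cS: "cnj (S x) = (\<Sum>k\<in>K. cnj (fcoef H k) * emode (- k) x)" for x
    by (simp add: S_def cnj_emode)
  have a: "z * cnj z = of_real ((cmod z)\<^sup>2)" for z :: complex
    by (rule complex_norm_square[symmetric])
  have "((\<lambda>x. \<Sum>k\<in>K. cnj (fcoef H k) * (H x * emode (- k) x)) has_integral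
      (\<Sum>k\<in>K. cnj (fcoef H k) * (2 * of_real pi * fcoef H k))) {0..2 * pi}"
    by (intro has_integral_sum K has_integral_mult_right has_integral_fcoef[OF H])
  also have "(\<lambda>x. \<Sum>k\<in>K. cnj (fcoef H k) * (H x * emode (- k) x)) = (\<lambda>x. H x * cnj (S x))"
    by (simp add: cS sum_distrib_left algebra_simps)
  also have "(\<Sum>k\<in>K. cnj (fcoef H k) * (2 * of_real pi * fcoef H k)) = of_real (2 * pi * q)"
    using a by (simp add: q_def sum_distrib_left algebra_simps)
  finally have "((\<lambda>x. H x * cnj (S x)) has_integral of_real (2 * pi * q)) {0..2 * pi}" .
  from has_integral_Re[OF this]
  have 1: "((\<lambda>x. Re (H x * cnj (S x))) has_integral 2 * pi * q) {0..2 * pi}"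
    by (simp only: Re_complex_of_real)
  have "((\<lambda>x. \<Sum>k\<in>K. \<Sum>m\<in>K. (fcoef H k * cnj (fcoef H m)) * emode (k - m) x) has_integral
      (\<Sum>k\<in>K. \<Sum>m\<in>K. (fcoef H k * cnj (fcoef H m)) * (if k - m = 0 then 2 * of_real pi else 0))) {0..2 * pi}"
    by (intro has_integral_sum K has_integral_mult_right emode_integral)
  also have "(\<lambda>x. \<Sum>k\<in>K. \<Sum>m\<in>K. (fcoef H k * cnj (fcoef H m)) * emode (k - m) x)
      = (\<lambda>x. S x * cnj (S x))"
    unfolding cS unfolding S_def sum_product diff_conv_add_uminus emode_add
    by (simp add: algebra_simps)
  also have "(\<Sum>k\<in>K. \<Sum>m\<in>K. (fcoef H k * cnj (fcoef H m)) * (if k - m = 0 then 2 * of_real pi else 0))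
      = of_real (2 * pi * q)"
    using K a by (simp add: if_distrib[of "\<lambda>z. _ * z"] sum.delta' q_def sum_distrib_left algebra_simps
        cong: if_cong)
  finally have "((\<lambda>x. S x * cnj (S x)) has_integral of_real (2 * pi * q)) {0..2 * pi}" .
  from has_integral_Re[OF this]
  have 2: "((\<lambda>x. Re (S x * cnj (S x))) has_integral 2 * pi * q) {0..2 * pi}"
    by (simp only: Re_complex_of_real)
  have "(\<lambda>x. H x * cnj (H x)) integrable_on {0..2 * pi}"
    unfolding a by (rule integrable_bounded_0_2pi[of _ "B * B"])
       (use H in \<open>auto simp: power2_eq_square norm_mult intro!: mult_mono order_trans[OF norm_ge_zero H(2)]\<close>)
  then have "((\<lambda>x. Re (H x * cnj (H x))) has_integral Re (integral {0..2 * pi} (\<lambda>x. H x * cnj (H x)))) {0..2 * pi}"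
    by (intro has_integral_Re integrable_integral)
  then obtain I where I: "((\<lambda>x. Re (H x * cnj (H x))) has_integral I) {0..2 * pi}" by blast
  have "((\<lambda>x. Re (H x * cnj (H x)) - 2 * Re (H x * cnj (S x)) + Re (S x * cnj (S x)))
      has_integral (I - 2 * (2 * pi * q) + 2 * pi * q)) {0..2 * pi}"
    by (intro has_integral_add has_integral_diff has_integral_mult_right I 1 2)
  moreover have "Re (H x * cnj (H x)) - 2 * Re (H x * cnj (S x)) + Re (S x * cnj (S x)) \<ge> 0" for x
  proof -
    have "0 \<le> (Re (H x) - Re (S x))\<^sup>2 + (Im (H x) - Im (S x))\<^sup>2" by simp
    then show ?thesis by (simp add: power2_eq_square algebra_simps)
  qed
  ultimately have "0 \<le> I - 2 * (2 * pi * q) + 2 * pi * q"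
    by (rule has_integral_nonneg)
  moreover have "I \<le> 2 * pi * B\<^sup>2"
  proof (rule has_integral_le[OF I])
    show "((\<lambda>_. B\<^sup>2) has_integral 2 * pi * B\<^sup>2) {0..2 * pi}"
      using has_integral_const_real[of "B\<^sup>2" 0 "2 * pi"] by (simp add: algebra_simps)
    show "Re (H x * cnj (H x)) \<le> B\<^sup>2" for x
      unfolding a using H(2)[of x] by (simp add: power_mono)
  qed
  ultimately have "2 * pi * q \<le> 2 * pi * B\<^sup>2" by linarith
  then have "q \<le> B\<^sup>2" by simp
  then show ?thesis unfolding q_def .
qed

text \<open>By Bessel the squares are summable along any injective sequence of indices. The two
  sequences of interest are the two ends of a telescoping sum.\<close>

lemma riemann_lebesgue_bounded:
  fixes h :: "nat \<Rightarrow> int"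
  assumes H: "H \<in> borel_measurable borel" "\<And>x. cmod (H x) \<le> B" and h: "inj h"
  shows "(\<lambda>n. fcoef H (h n)) \<longlonglongrightarrow> 0"
proof -
  have "(\<Sum>n<N. norm ((cmod (fcoef H (h n)))\<^sup>2)) \<le> B\<^sup>2" for N
  proof -
    have "(\<Sum>n<N. norm ((cmod (fcoef H (h n)))\<^sup>2)) = (\<Sum>k\<in>h ` {..<N}. (cmod (fcoef H k))\<^sup>2)"
      using h by (subst sum.reindex) (auto simp: inj_def inj_on_def)
    also have "\<dots> \<le> B\<^sup>2" by (rule bessel_bounded[OF H]) simp
    finally show ?thesis .
  qed
  then have "summable (\<lambda>n. (cmod (fcoef H (h n)))\<^sup>2)"
    by (intro summableI_nonneg_bounded[of _ "B\<^sup>2"]) auto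
  from summable_LIMSEQ_zero[OF this] have "(\<lambda>n. sqrt ((cmod (fcoef H (h n)))\<^sup>2)) \<longlonglongrightarrow> sqrt 0"
    by (rule tendsto_real_sqrt)
  then show ?thesis by (simp add: tendsto_norm_zero_iff)
qed

text \<open>Jordan's inequality: by concavity the chord over [0, pi / 2] lies below the
  graph.\<close>

lemma sin_ge_linear:
  assumes "0 \<le> y" "y \<le> pi / 2"
  shows "2 * y / pi \<le> sin y"
proof -
  have "concave_on {0..pi} sin"
    by (rule f''_le0_imp_concave[where f' = cos and f'' = "\<lambda>x. - sin x"])
       (auto intro!: derivative_eq_intros simp: sin_ge_zero)
  from concave_onD[OF this, of "2 * y / pi" 0 "pi / 2"] assms show ?thesis
    by (simp add: field_simps)
qed

text \<open>The chord has length 2 |sin (y / 2)|. The bound serves twice: for the quotient in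
  Chernoff's argument, and to keep the denominators in \<open>biorthogonal_insert\<close> away from
  0.\<close>

lemma chord_lower_bound:
  assumes "\<bar>y\<bar> \<le> pi"
  shows "2 * \<bar>y\<bar> / pi \<le> cmod (exp (\<i> * of_real y) - 1)"
proof -
  have "2 * (\<bar>y\<bar> / 2) / pi \<le> sin (\<bar>y\<bar> / 2)"
    using assms by (intro sin_ge_linear) auto
  then have "\<bar>y\<bar> / pi \<le> \<bar>sin (\<bar>y\<bar> / 2)\<bar>"
    using abs_ge_self[of "sin (\<bar>y\<bar> / 2)"] by simp
  moreover have "\<bar>sin (y / 2)\<bar> = \<bar>sin (\<bar>y\<bar> / 2)\<bar>" by (cases "y \<ge> 0") auto
  ultimately show ?thesis
    unfolding dist_exp_i_1 by simp
qed

lemma periodic_smooth_lipschitz: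
  assumes \<phi>: "\<phi> \<in> periodic_smooth"
  obtains L where "0 \<le> L" "\<And>x y. cmod (\<phi> x - \<phi> y) \<le> L * \<bar>x - y\<bar>"
proof -
  obtain L where L: "0 \<le> L" "\<And>x. cmod (vderiv \<phi> x) \<le> L"
    using periodic_smooth_sup[OF periodic_smooth_vderiv[OF \<phi>]] by blast
  have d: "(\<phi> has_derivative (\<lambda>h. h *\<^sub>R vderiv \<phi> x)) (at x)" for x
    using periodic_smooth_has_vderiv[OF \<phi>, of 0 x] by (simp add: has_vector_derivative_def)
  have "cmod (\<phi> x - \<phi> y) \<le> L * norm (x - y)" for x y
    by (rule differentiable_bound[of UNIV \<phi> "\<lambda>x h. h *\<^sub>R vderiv \<phi> x"])
       (use d L in \<open>auto intro!: onorm_bound simp: mult.commute[of L] mult_left_mono\<close>)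
  with L(1) that show ?thesis by simp
qed

text \<open>Chernoff's proof of pointwise convergence: after division by \<open>e\<^sup>i\<^sup>x - e\<^sup>i\<^sup>y\<close> the partial sums telescope.\<close>

lemma fourier_series_pointwise:
  assumes \<phi>: "\<phi> \<in> periodic_smooth"
  shows "(\<lambda>n. \<Sum>k\<in>{- int n..int n}. fcoef \<phi> k * emode k y) \<longlonglongrightarrow> \<phi> y"
proof -
  define H where "H x = (\<phi> x - \<phi> y) / (emode 1 x - emode 1 y)" for x
  obtain L where L: "0 \<le> L" "\<And>x y. cmod (\<phi> x - \<phi> y) \<le> L * \<bar>x - y\<bar>"
    using periodic_smooth_lipschitz[OF \<phi>] by blast
  obtain B where B: "0 \<le> B" "\<And>x. cmod (\<phi> x) \<le> B"
    using periodic_smooth_sup[OF \<phi>] by blast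
  have lip: "cmod (\<phi> x - \<phi> y) \<le> (L * pi / 2) * cmod (emode 1 x - emode 1 y)" for x
  proof -
    \<comment> \<open>Rounding to the nearest integer moves x by periods to a point z within pi of
      y, where the chord bound applies.\<close>
    define n where "n = \<lfloor>(y - x) / (2 * pi) + 1/2\<rfloor>"
    define z where "z = x + of_int n * (2 * pi)"
    have "of_int n \<le> (y - x) / (2 * pi) + 1/2" "(y - x) / (2 * pi) + 1/2 < of_int n + 1"
      unfolding n_def by linarith+
    then have z: "\<bar>z - y\<bar> \<le> pi"
      unfolding z_def by (auto simp: field_simps abs_le_iff)
    have "cmod (emode 1 z - emode 1 y) = cmod (emode 1 y * (exp (\<i> * of_real (z - y)) - 1))"
      by (simp add: emode_def right_diff_distrib flip: exp_add)
    then have "2 * \<bar>z - y\<bar> / pi \<le> cmod (emode 1 z - emode 1 y)"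
      using chord_lower_bound[OF z] by (simp only: norm_mult norm_emode)
    then have "\<bar>z - y\<bar> \<le> pi / 2 * cmod (emode 1 z - emode 1 y)"
      by (simp add: field_simps)
    then have "L * \<bar>z - y\<bar> \<le> L * (pi / 2 * cmod (emode 1 z - emode 1 y))"
      using L(1) by (rule mult_left_mono)
    with L(2)[of z y] show ?thesis
      unfolding z_def periodic_smooth_period[OF \<phi>] emode_periodic by (simp add: field_simps)
  qed
  have H_bd: "cmod (H x) \<le> L * pi / 2" for x
  proof (cases "emode 1 x = emode 1 y")
    case False
    then show ?thesis using lip[of x] by (simp add: H_def norm_divide field_simps)
  qed (use L in \<open>simp add: H_def\<close>)
  have \<phi>m [measurable]: "\<phi> \<in> borel_measurable borel"
    by (intro borel_measurable_continuous_onI periodic_smooth_continuous[OF \<phi>])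
  have H_m: "H \<in> borel_measurable borel" unfolding H_def[abs_def] by measurable
  have eq: "\<phi> x - \<phi> y = H x * (emode 1 x - emode 1 y)" for x
    using lip[of x] by (cases "emode 1 x = emode 1 y") (auto simp: H_def)
  \<comment> \<open>The k-th coefficient of
    \<open>\<phi> x - \<phi> y = H x * (emode 1 x - emode 1 y)\<close>: the factor
    \<open>emode 1 x\<close> shifts the index of H by one, and multiplication by
    \<open>emode k y\<close> makes the right side a difference of consecutive terms.\<close>
  have coef: "fcoef \<phi> k * emode k y - (if k = 0 then \<phi> y else 0)
      = emode k y * fcoef H (k - 1) - emode (k + 1) y * fcoef H k" for k
  proof -
    have i1: "((\<lambda>x. \<phi> x * emode (- k) x - \<phi> y * emode (- k) x) has_integral
        2 * of_real pi * fcoef \<phi> k - \<phi> y * (if - k = 0 then 2 * of_real pi else 0)) {0..2 * pi}"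
      by (intro has_integral_diff has_integral_mult_right emode_integral has_integral_fcoef[OF \<phi>m B(2)])
    have i2: "((\<lambda>x. H x * emode (- (k - 1)) x - emode 1 y * (H x * emode (- k) x)) has_integral
        2 * of_real pi * fcoef H (k - 1) - emode 1 y * (2 * of_real pi * fcoef H k)) {0..2 * pi}"
      by (intro has_integral_diff has_integral_mult_right has_integral_fcoef[OF H_m H_bd])
    have i12: "(\<lambda>x. \<phi> x * emode (- k) x - \<phi> y * emode (- k) x)
        = (\<lambda>x. H x * emode (- (k - 1)) x - emode 1 y * (H x * emode (- k) x))"
    proof
      fix x
      have "emode (- (k - 1)) x = emode 1 x * emode (- k) x"
        using emode_add[of 1 "- k" x] by simp
      then show "\<phi> x * emode (- k) x - \<phi> y * emode (- k) x
          = H x * emode (- (k - 1)) x - emode 1 y * (H x * emode (- k) x)"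
        using arg_cong[OF eq[of x], of "\<lambda>z. z * emode (- k) x"] by (simp add: algebra_simps)
    qed
    have "2 * of_real pi * fcoef \<phi> k - \<phi> y * (if - k = 0 then 2 * of_real pi else 0)
        = 2 * of_real pi * fcoef H (k - 1) - emode 1 y * (2 * of_real pi * fcoef H k)"
      by (rule has_integral_unique[OF i1 i2[folded i12]])
    then have "2 * of_real pi * (fcoef \<phi> k - (if k = 0 then \<phi> y else 0))
        = 2 * of_real pi * (fcoef H (k - 1) - emode 1 y * fcoef H k)"
      by (cases "k = 0") (simp_all add: algebra_simps)
    then have "fcoef \<phi> k - (if k = 0 then \<phi> y else 0) = fcoef H (k - 1) - emode 1 y * fcoef H k"
      by simp
    then have "emode k y * (fcoef \<phi> k - (if k = 0 then \<phi> y else 0))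
        = emode k y * (fcoef H (k - 1) - emode 1 y * fcoef H k)" by simp
    then show ?thesis by (auto simp: algebra_simps emode_add)
  qed
  define b where "b k = emode (k + 1) y * fcoef H k" for k
  have coef': "fcoef \<phi> k * emode k y - (if k = 0 then \<phi> y else 0) = b (k - 1) - b k" for k
    using coef[of k] by (simp add: b_def)
  \<comment> \<open>The lower end is - n - 1 and not - n, because the difference at k involves the
    coefficient of H at k - 1.\<close>
  have tele: "(\<Sum>k\<in>{- int n..int n}. fcoef \<phi> k * emode k y) = \<phi> y + b (- int n - 1) - b (int n)" for n
  proof (induction n)
    case 0
    show ?case using coef'[of 0] by (simp add: algebra_simps)
  next
    case (Suc n)
    have "{- int (Suc n)..int (Suc n)} = insert (- int n - 1) (insert (int n + 1) {- int n..int n})"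
      by auto
    moreover have "fcoef \<phi> (- int n - 1) * emode (- int n - 1) y = b (- int (Suc n) - 1) - b (- int n - 1)"
      "fcoef \<phi> (int n + 1) * emode (int n + 1) y = b (int n) - b (int (Suc n))"
      using coef'[of "- int n - 1"] coef'[of "int n + 1"] by (simp_all add: add.commute)
    ultimately show ?case
      by (simp add: Suc)
  qed
  have r: "(\<lambda>n. b (h n)) \<longlonglongrightarrow> 0" if "inj h" for h :: "nat \<Rightarrow> int"
    using riemann_lebesgue_bounded[OF H_m H_bd that]
    by (intro tendsto_norm_zero_cancel[where f = "\<lambda>n. b (h n)"])
       (simp add: b_def norm_mult tendsto_norm_zero_iff)
  have r1: "(\<lambda>n. b (- int n - 1)) \<longlonglongrightarrow> 0" and r2: "(\<lambda>n. b (int n)) \<longlonglongrightarrow> 0"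
    by (rule r; simp add: inj_def)+
  show ?thesis unfolding tele
    using tendsto_diff[OF tendsto_add[OF tendsto_const r1] r2, of "\<phi> y"] by simp
qed

section \<open>Decay of the coefficients and convergence of all derivatives\<close>

lemma periodic_smooth_measurable:
  "\<phi> \<in> periodic_smooth \<Longrightarrow> \<phi> \<in> borel_measurable borel"
  by (intro borel_measurable_continuous_onI periodic_smooth_continuous)

lemma fcoef_bound:
  assumes "\<phi> \<in> periodic_smooth" "\<And>x. cmod (\<phi> x) \<le> B"
  shows "cmod (fcoef \<phi> k) \<le> B"
proof (rule power2_le_imp_le)
  show "(cmod (fcoef \<phi> k))\<^sup>2 \<le> B\<^sup>2"
    using bessel_bounded[OF periodic_smooth_measurable[OF assms(1)] assms(2), of "{k}"] by simp
  show "0 \<le> B" using assms(2)[of 0] norm_ge_zero order_trans by blast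
qed

lemma has_integral_fcoef_smooth:
  assumes "\<phi> \<in> periodic_smooth"
  shows "((\<lambda>x. \<phi> x * emode (- k) x) has_integral 2 * of_real pi * fcoef \<phi> k) {0..2 * pi}"
  using periodic_smooth_sup[OF assms] has_integral_fcoef[OF periodic_smooth_measurable[OF assms]] by metis

lemma fcoef_unique:
  assumes "((\<lambda>x. \<phi> x * emode (- k) x) has_integral 2 * of_real pi * c) {0..2 * pi}"
  shows "fcoef \<phi> k = c"
  using integral_unique[OF assms] by (simp add: fcoef_def)

lemma fcoef_vderiv:
  assumes \<phi>: "\<phi> \<in> periodic_smooth"
  shows "fcoef (vderiv \<phi>) k = \<i> * of_int k * fcoef \<phi> k"
proof (rule fcoef_unique)
  let ?F = "\<lambda>x. \<phi> x * emode (- k) x"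
  have d: "(?F has_vector_derivative \<phi> x * (\<i> * of_int (- k) * emode (- k) x) + vderiv \<phi> x * emode (- k) x) (at x)" for x
    using periodic_smooth_has_vderiv[OF \<phi>, of 0 x]
    by (intro has_vector_derivative_mult emode_has_vderiv) simp
  have "((\<lambda>x. \<phi> x * (\<i> * of_int (- k) * emode (- k) x) + vderiv \<phi> x * emode (- k) x) has_integral
      (?F (2 * pi) - ?F 0)) {0..2 * pi}"
    by (intro fundamental_theorem_of_calculus has_vector_derivative_at_within[OF d]) simp
  moreover have "?F (2 * pi) - ?F 0 = 0"
    using periodic_smooth_period[OF periodic_smooth_mult[OF \<phi> emode_smooth], of 0 1] by simp
  ultimately have 1: "((\<lambda>x. \<phi> x * (\<i> * of_int (- k) * emode (- k) x) + vderiv \<phi> x * emode (- k) x) has_integral 0) {0..2 * pi}"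
    by simp
  have 2: "((\<lambda>x. \<i> * of_int k * (\<phi> x * emode (- k) x)) has_integral \<i> * of_int k * (2 * of_real pi * fcoef \<phi> k)) {0..2 * pi}"
    by (intro has_integral_mult_right has_integral_fcoef_smooth[OF \<phi>])
  from has_integral_add[OF 1 2]
  show "((\<lambda>x. vderiv \<phi> x * emode (- k) x) has_integral 2 * of_real pi * (\<i> * of_int k * fcoef \<phi> k)) {0..2 * pi}"
    by (simp add: algebra_simps)
qed

lemma fcoef_vderiv_funpow:
  assumes "\<phi> \<in> periodic_smooth"
  shows "fcoef ((vderiv ^^ n) \<phi>) k = (\<i> * of_int k) ^ n * fcoef \<phi> k"
  by (induction n) (simp_all add: fcoef_vderiv vderiv_funpow_smooth[OF assms] algebra_simps)

text \<open>Derivatives control only powers of |k|; the step to \<open>jap\<close> costs 2^n through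
  1 + |k| \<le> 2 |k| for nonzero k, while k = 0 uses the supremum of \<phi> itself. Only two
  suprema of \<phi> enter, which later gives continuity on test functions.\<close>

lemma fcoef_decay:
  assumes \<phi>: "\<phi> \<in> periodic_smooth" and B: "\<And>x. cmod (\<phi> x) \<le> B" "\<And>x. cmod ((vderiv ^^ n) \<phi> x) \<le> B"
  shows "jap k ^ n * cmod (fcoef \<phi> k) \<le> 2 ^ n * B"
proof (cases "k = 0")
  case True
  have "0 \<le> B" using B(1)[of 0] norm_ge_zero order_trans by blast
  then have "1 * B \<le> 2 ^ n * B" by (intro mult_right_mono) auto
  then show ?thesis using fcoef_bound[OF \<phi> B(1), of 0] True by (simp add: jap_def)
next
  case False
  have "jap k \<le> 2 * \<bar>of_int k\<bar>" using False by (simp add: jap_def flip: of_int_abs)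
  then have "jap k ^ n \<le> (2 * \<bar>of_int k\<bar>) ^ n" by (intro power_mono) (simp_all add: jap_nonneg)
  then have "jap k ^ n * cmod (fcoef \<phi> k) \<le> (2 * \<bar>of_int k\<bar>) ^ n * cmod (fcoef \<phi> k)"
    by (rule mult_right_mono) simp
  also have "\<dots> = 2 ^ n * cmod (fcoef ((vderiv ^^ n) \<phi>) k)"
    by (simp add: fcoef_vderiv_funpow[OF \<phi>] norm_mult norm_power power_mult_distrib)
  also have "\<dots> \<le> 2 ^ n * B"
    by (intro mult_left_mono fcoef_bound vderiv_funpow_smooth \<phi> B(2)) simp
  finally show ?thesis .
qed

lemma fcoef_rapid_decay:
  assumes "\<phi> \<in> periodic_smooth"
  obtains B where "0 \<le> B" "\<And>k. jap k ^ n * cmod (fcoef \<phi> k) \<le> B"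
proof -
  obtain B0 Bn where B: "0 \<le> B0" "\<And>x. cmod (\<phi> x) \<le> B0" "0 \<le> Bn" "\<And>x. cmod ((vderiv ^^ n) \<phi> x) \<le> Bn"
    using periodic_smooth_sup[OF assms] periodic_smooth_sup[OF vderiv_funpow_smooth[OF assms, of n]] by metis
  show ?thesis
  proof
    show "jap k ^ n * cmod (fcoef \<phi> k) \<le> 2 ^ n * (B0 + Bn)" for k
      by (rule fcoef_decay[OF assms]) (use B in \<open>auto intro: add_increasing add_increasing2\<close>)
  qed (use B in simp)
qed

lemma fcoef_abs_summable:
  assumes "\<phi> \<in> periodic_smooth"
  shows "(\<lambda>k. cmod (fcoef \<phi> k)) summable_on UNIV"
proof -
  obtain B where B: "\<And>k. (jap k)\<^sup>2 * cmod (fcoef \<phi> k) \<le> B"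
    using fcoef_rapid_decay[OF assms] by metis
  have "cmod (fcoef \<phi> k) \<le> B * kern k" for k
    using B[of k] jap_pos[of k] by (simp add: kern_def field_simps)
  then show ?thesis
    by (intro summable_on_dominated(1)[OF summable_on_cmult_right[OF kern_summable]])
qed

lemma fourier_series_has_sum:
  assumes "\<phi> \<in> periodic_smooth"
  shows "((\<lambda>k. fcoef \<phi> k * emode k x) has_sum \<phi> x) UNIV"
proof -
  have s: "(\<lambda>k. fcoef \<phi> k * emode k x) summable_on UNIV"
    by (rule summable_on_dominated(2)[OF fcoef_abs_summable[OF assms]]) (simp add: norm_mult)
  from has_sum_int_box[OF has_sum_infsum[OF s]] fourier_series_pointwise[OF assms, of x]
  have "infsum (\<lambda>k. fcoef \<phi> k * emode k x) UNIV = \<phi> x" by (rule LIMSEQ_unique)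
  then show ?thesis using has_sum_infsum[OF s] by simp
qed

lemma fourier_series_uniform:
  assumes "\<phi> \<in> periodic_smooth"
  shows "uniform_limit UNIV (\<lambda>n x. \<Sum>k\<in>{- int n..int n}. fcoef \<phi> k * emode k x) \<phi> sequentially"
proof (rule uniform_limitI)
  fix e :: real assume "e > 0"
  let ?c = "\<lambda>k. cmod (fcoef \<phi> k)"
  note c = fcoef_abs_summable[OF assms]
  have "(\<lambda>n. \<Sum>k\<in>{- int n..int n}. ?c k) \<longlonglongrightarrow> infsum ?c UNIV"
    by (intro has_sum_int_box has_sum_infsum c)
  then have ev: "eventually (\<lambda>n. dist (\<Sum>k\<in>{- int n..int n}. ?c k) (infsum ?c UNIV) < e) sequentially"
    using \<open>e > 0\<close> by (rule tendstoD)
  show "\<forall>\<^sub>F n in sequentially. \<forall>x\<in>UNIV. dist (\<Sum>k\<in>{- int n..int n}. fcoef \<phi> k * emode k x) (\<phi> x) < e"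
    using ev
  proof eventually_elim
    case (elim n)
    let ?K = "{- int n..int n}"
    have "dist (\<Sum>k\<in>?K. fcoef \<phi> k * emode k x) (\<phi> x) < e" for x
    proof -
      let ?f = "\<lambda>k. fcoef \<phi> k * emode k x"
      have c': "?c summable_on (- ?K)" by (rule summable_on_subset_banach[OF c]) simp
      have f': "?f summable_on (- ?K)" "norm (infsum ?f (- ?K)) \<le> infsum ?c (- ?K)"
        using summable_on_dominated[OF c', of ?f] by (auto simp: norm_mult)
      have "\<phi> x = sum ?f ?K + infsum ?f (- ?K)"
        using infsum_Un_disjoint[of ?f ?K "- ?K"] f'(1) infsumI[OF fourier_series_has_sum[OF assms, of x]] by simp
      moreover have "infsum ?c UNIV = sum ?c ?K + infsum ?c (- ?K)"
        using infsum_Un_disjoint[of ?c ?K "- ?K"] c' by simp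
      ultimately show ?thesis using f'(2) elim by (simp add: dist_norm norm_minus_commute)
    qed
    then show ?case by simp
  qed
qed

text \<open>The j-th derivative of a partial sum is the partial sum for the j-th derivative, so
  uniform convergence applies at every order. This is the convergence that distributions
  respect.\<close>

lemma fourier_series_smooth:
  assumes "\<phi> \<in> periodic_smooth"
  shows "smooth_tendsto (\<lambda>n x. \<Sum>k\<in>{- int n..int n}. fcoef \<phi> k * emode k x) \<phi>"
  unfolding smooth_tendsto_def
proof
  fix j
  have "(vderiv ^^ j) (\<lambda>x. \<Sum>k\<in>{- int n..int n}. fcoef \<phi> k * emode k x)
      = (\<lambda>x. \<Sum>k\<in>{- int n..int n}. fcoef ((vderiv ^^ j) \<phi>) k * emode k x)" for n
    by (subst periodic_smooth_sum(2), rule cmult_periodic_smooth(2)[OF emode_smooth])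
       (simp only: cmult_periodic_smooth(1)[OF emode_smooth] vderiv_emode fcoef_vderiv_funpow[OF assms],
        simp only: mult_ac)
  then show "uniform_limit UNIV (\<lambda>n. (vderiv ^^ j) (\<lambda>x. \<Sum>k\<in>{- int n..int n}. fcoef \<phi> k * emode k x))
      ((vderiv ^^ j) \<phi>) sequentially"
    using fourier_series_uniform[OF vderiv_funpow_smooth[OF assms]] by simp
qed

lemma fcoef_zero_imp_zero:
  assumes "\<phi> \<in> periodic_smooth" "\<And>k. fcoef \<phi> k = 0"
  shows "\<phi> x = 0"
  using infsumI[OF fourier_series_has_sum[OF assms(1), of x]] assms(2) by simp

section \<open>Distributions and their Fourier coefficients\<close>

lemma pairing_outside: "\<phi> \<notin> periodic_smooth \<Longrightarrow> pairing v \<phi> = 0"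
  and pairing_add: "\<phi> \<in> periodic_smooth \<Longrightarrow> \<eta> \<in> periodic_smooth \<Longrightarrow>
    pairing v (\<lambda>x. \<phi> x + \<eta> x) = pairing v \<phi> + pairing v \<eta>"
  and pairing_cmult: "\<phi> \<in> periodic_smooth \<Longrightarrow> pairing v (\<lambda>x. c * \<phi> x) = c * pairing v \<phi>"
  and pairing_tendsto: "\<phi> \<in> periodic_smooth \<Longrightarrow> (\<And>n. X n \<in> periodic_smooth) \<Longrightarrow> smooth_tendsto X \<phi> \<Longrightarrow>
    (\<lambda>n. pairing v (X n)) \<longlonglongrightarrow> pairing v \<phi>"
  using pairing[of v] by auto

lemma pairing_sum:
  assumes "finite I" "\<And>i. i \<in> I \<Longrightarrow> f i \<in> periodic_smooth"
  shows "pairing v (\<lambda>x. \<Sum>i\<in>I. c i * f i x) = (\<Sum>i\<in>I. c i * pairing v (f i))"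
  using assms
proof (induction I rule: finite_induct)
  case empty
  show ?case using pairing_cmult[OF periodic_smooth_zero, of v 0] by simp
next
  case (insert i I)
  then show ?case
    by (simp add: pairing_add pairing_cmult cmult_periodic_smooth periodic_smooth_sum)
qed

text \<open>The pairing is bilinear, so testing against the mode k reads off the coefficient at - k;
  hence the reflected indices in the formulas for pairings.\<close>

lemma fourier_coeff_pairing: "pairing v (emode k) = 2 * of_real pi * fourier_coeff v (- k)"
  by (simp add: fourier_coeff_def emode_def[abs_def])

lemma pairing_fourier:
  assumes "\<phi> \<in> periodic_smooth"
  shows "(\<lambda>n. \<Sum>k\<in>{- int n..int n}. 2 * of_real pi * fcoef \<phi> k * fourier_coeff v (- k)) \<longlonglongrightarrow> pairing v \<phi>"
proof -
  have "(\<lambda>n. pairing v (\<lambda>x. \<Sum>k\<in>{- int n..int n}. fcoef \<phi> k * emode k x)) \<longlonglongrightarrow> pairing v \<phi>"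
    by (intro pairing_tendsto assms fourier_series_smooth periodic_smooth_sum cmult_periodic_smooth) simp
  also have "(\<lambda>n. pairing v (\<lambda>x. \<Sum>k\<in>{- int n..int n}. fcoef \<phi> k * emode k x))
      = (\<lambda>n. \<Sum>k\<in>{- int n..int n}. 2 * of_real pi * fcoef \<phi> k * fourier_coeff v (- k))"
    by (subst pairing_sum) (simp_all add: fourier_coeff_pairing mult_ac)
  finally show ?thesis .
qed

text \<open>By continuity along Fourier partial sums a distribution is fixed by its values on
  exponentials. Identities between distributions can therefore be proved coefficient by
  coefficient.\<close>

lemma pdist_eqI:
  assumes "\<And>k. fourier_coeff u k = fourier_coeff v k"
  shows "u = v"
proof -
  have "pairing u \<phi> = pairing v \<phi>" for \<phi>
  proof (cases "\<phi> \<in> periodic_smooth")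
    case True
    show ?thesis
      using pairing_fourier[OF True, of u] pairing_fourier[OF True, of v] LIMSEQ_unique
      unfolding assms by blast
  qed (simp add: pairing_outside)
  then show ?thesis by (metis pairing_inject ext)
qed

lemma fourier_coeff_add [simp]: "fourier_coeff (u + v) k = fourier_coeff u k + fourier_coeff v k"
  and fourier_coeff_diff [simp]: "fourier_coeff (u - v) k = fourier_coeff u k - fourier_coeff v k"
  and fourier_coeff_zero [simp]: "fourier_coeff 0 k = 0"
  and fourier_coeff_scaleR [simp]: "fourier_coeff (r *\<^sub>R v) k = r *\<^sub>R fourier_coeff v k"
  and fourier_coeff_pd_scale [simp]: "fourier_coeff (pd_scale c v) k = c * fourier_coeff v k"
  by (simp_all add: fourier_coeff_def plus_pdist.rep_eq minus_pdist.rep_eq zero_pdist.rep_eq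
      scaleR_pdist.rep_eq pd_scale.rep_eq add_divide_distrib diff_divide_distrib scaleR_conv_of_real)

lemma linear_fourier_coeff: "linear (\<lambda>v. fourier_coeff v k)"
  by (rule linearI) auto

lemma fourier_coeff_sum [simp]: "fourier_coeff (\<Sum>i\<in>I. f i) k = (\<Sum>i\<in>I. fourier_coeff (f i) k)"
  by (induction I rule: infinite_finite_induct) auto

lemma fourier_coeff_pd_deriv: "fourier_coeff (pd_deriv v) k = \<i> * of_int k * fourier_coeff v k"
proof -
  have "vderiv (emode (- k)) = (\<lambda>x. (- (\<i> * of_int k)) * emode (- k) x)"
    using vderiv_emode[of 1 "- k"] by simp
  then have "pairing (pd_deriv v) (emode (- k)) = \<i> * of_int k * pairing v (emode (- k))"
    using pairing_cmult[OF emode_smooth, of v "- (\<i> * of_int k)" "- k"]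
    by (simp add: pd_deriv.rep_eq)
  then show ?thesis by (simp add: fourier_coeff_pairing)
qed

section \<open>Weighted square-summable sequences\<close>

text \<open>The Sobolev condition as a property of real sequences, so that a majorant of Fourier
  coefficients has a norm without belonging to a distribution.\<close>

definition wl2 :: "real \<Rightarrow> (int \<Rightarrow> real) \<Rightarrow> bool" where
  "wl2 s c \<longleftrightarrow> (\<lambda>k. jap k powr (2 * s) * (c k)\<^sup>2) summable_on UNIV"

definition wnorm :: "real \<Rightarrow> (int \<Rightarrow> real) \<Rightarrow> real" where
  "wnorm s c = sqrt (2 * pi * (\<Sum>\<^sub>\<infinity>k. jap k powr (2 * s) * (c k)\<^sup>2))"

lemma sobolev_wl2: "v \<in> sobolev s \<longleftrightarrow> wl2 s (\<lambda>k. cmod (fourier_coeff v k))"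
  by (simp add: sobolev_def wl2_def jap_def)

lemma sobolev_norm_wnorm: "sobolev_norm s v = wnorm s (\<lambda>k. cmod (fourier_coeff v k))"
  by (simp add: sobolev_norm_def wnorm_def jap_def)

lemma wnorm_nonneg: "0 \<le> wnorm s c"
  unfolding wnorm_def by (intro real_sqrt_ge_zero mult_nonneg_nonneg infsum_nonneg) auto

lemma wnorm_sq: "(wnorm s c)\<^sup>2 = 2 * pi * (\<Sum>\<^sub>\<infinity>k. jap k powr (2 * s) * (c k)\<^sup>2)"
  unfolding wnorm_def by (intro real_sqrt_pow2 mult_nonneg_nonneg infsum_nonneg) auto

lemma wl2_mono:
  assumes c: "wl2 s c" and le: "\<And>k. \<bar>d k\<bar> \<le> \<bar>c k\<bar>"
  shows "wl2 s d" "wnorm s d \<le> wnorm s c"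
proof -
  have le2: "jap k powr (2 * s) * (d k)\<^sup>2 \<le> jap k powr (2 * s) * (c k)\<^sup>2" for k
    using le[of k] by (intro mult_left_mono) (auto simp: abs_le_square_iff)
  show d: "wl2 s d"
    unfolding wl2_def by (rule summable_on_dominated(2)[OF c[unfolded wl2_def]]) (use le2 in simp)
  show "wnorm s d \<le> wnorm s c"
    unfolding wnorm_def
    by (intro real_sqrt_le_mono mult_left_mono infsum_mono d[unfolded wl2_def] c[unfolded wl2_def] le2) auto
qed

lemma wl2_cmult:
  assumes c: "wl2 s c"
  shows "wl2 s (\<lambda>k. r * c k)" "wnorm s (\<lambda>k. r * c k) = \<bar>r\<bar> * wnorm s c"
proof -
  have eq: "(\<lambda>k. jap k powr (2 * s) * (r * c k)\<^sup>2) = (\<lambda>k. r\<^sup>2 * (jap k powr (2 * s) * (c k)\<^sup>2))"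
    by (simp add: power_mult_distrib mult_ac)
  show "wl2 s (\<lambda>k. r * c k)"
    using c unfolding wl2_def eq by (rule summable_on_cmult_right)
  show "wnorm s (\<lambda>k. r * c k) = \<bar>r\<bar> * wnorm s c"
    unfolding wnorm_def eq infsum_cmult_right'
    by (simp add: real_sqrt_mult mult_ac)
qed

text \<open>The crude factor 2 comes from (c + d)^2 \<le> 2 c^2 + 2 d^2; it only enters the size of
  the final constant.\<close>

lemma wl2_add:
  assumes c: "wl2 s c" and d: "wl2 s d"
  shows "wl2 s (\<lambda>k. c k + d k)" "wnorm s (\<lambda>k. c k + d k) \<le> 2 * (wnorm s c + wnorm s d)"
proof -
  let ?w = "\<lambda>k. jap k powr (2 * s)"
  have le: "?w k * (c k + d k)\<^sup>2 \<le> 2 * (?w k * (c k)\<^sup>2) + 2 * (?w k * (d k)\<^sup>2)" for k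
  proof -
    have "(c k + d k)\<^sup>2 \<le> 2 * (c k)\<^sup>2 + 2 * (d k)\<^sup>2"
      using zero_le_power2[of "c k - d k"] by (simp add: power2_eq_square algebra_simps)
    then have "?w k * (c k + d k)\<^sup>2 \<le> ?w k * (2 * (c k)\<^sup>2 + 2 * (d k)\<^sup>2)"
      by (rule mult_left_mono) simp
    then show ?thesis by (simp add: algebra_simps)
  qed
  have sm: "(\<lambda>k. 2 * (?w k * (c k)\<^sup>2) + 2 * (?w k * (d k)\<^sup>2)) summable_on UNIV"
    using c d unfolding wl2_def by (intro summable_on_add summable_on_cmult_right)
  show cd: "wl2 s (\<lambda>k. c k + d k)"
    unfolding wl2_def by (rule summable_on_dominated(2)[OF sm]) (use le in simp)
  show "wnorm s (\<lambda>k. c k + d k) \<le> 2 * (wnorm s c + wnorm s d)"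
  proof (rule power2_le_imp_le)
    have "(\<Sum>\<^sub>\<infinity>k. ?w k * (c k + d k)\<^sup>2) \<le> (\<Sum>\<^sub>\<infinity>k. 2 * (?w k * (c k)\<^sup>2) + 2 * (?w k * (d k)\<^sup>2))"
      by (intro infsum_mono cd[unfolded wl2_def] sm le)
    also have "\<dots> = 2 * (\<Sum>\<^sub>\<infinity>k. ?w k * (c k)\<^sup>2) + 2 * (\<Sum>\<^sub>\<infinity>k. ?w k * (d k)\<^sup>2)"
      using c d unfolding wl2_def
      by (subst infsum_add) (auto intro: summable_on_cmult_right simp: infsum_cmult_right')
    finally have "2 * pi * (\<Sum>\<^sub>\<infinity>k. ?w k * (c k + d k)\<^sup>2)
        \<le> 2 * pi * (2 * (\<Sum>\<^sub>\<infinity>k. ?w k * (c k)\<^sup>2) + 2 * (\<Sum>\<^sub>\<infinity>k. ?w k * (d k)\<^sup>2))"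
      by (rule mult_left_mono) simp
    then have "(wnorm s (\<lambda>k. c k + d k))\<^sup>2 \<le> 2 * (wnorm s c)\<^sup>2 + 2 * (wnorm s d)\<^sup>2"
      unfolding wnorm_sq by (simp add: algebra_simps)
    also have "\<dots> \<le> (2 * (wnorm s c + wnorm s d))\<^sup>2"
      using mult_nonneg_nonneg[OF wnorm_nonneg[of s c] wnorm_nonneg[of s d]]
      by (simp add: power2_eq_square algebra_simps)
    finally show "(wnorm s (\<lambda>k. c k + d k))\<^sup>2 \<le> (2 * (wnorm s c + wnorm s d))\<^sup>2" .
  qed (simp add: wnorm_nonneg add_nonneg_nonneg)
qed

lemma wl2_coordinate:
  assumes "wl2 s c"
  shows "\<bar>c k\<bar> \<le> jap k powr (- s) * wnorm s c"
proof -
  let ?S = "\<Sum>\<^sub>\<infinity>k. jap k powr (2 * s) * (c k)\<^sup>2"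
  have "(\<Sum>j\<in>{k}. jap j powr (2 * s) * (c j)\<^sup>2) \<le> ?S"
    using assms by (intro finite_sum_le_infsum) (auto simp: wl2_def)
  moreover have "0 \<le> ?S" by (intro infsum_nonneg) auto
  then have "1 * ?S \<le> 2 * pi * ?S" using pi_ge_two by (intro mult_right_mono) auto
  moreover have "(jap k powr s)\<^sup>2 = jap k powr (2 * s)"
    by (simp add: power2_eq_square flip: powr_add)
  ultimately have "(jap k powr s * \<bar>c k\<bar>)\<^sup>2 \<le> (wnorm s c)\<^sup>2"
    unfolding wnorm_sq by (simp add: power_mult_distrib)
  then have "jap k powr s * \<bar>c k\<bar> \<le> wnorm s c"
    using wnorm_nonneg by (rule power2_le_imp_le)
  then show ?thesis using jap_pos[of k] by (simp add: powr_minus field_simps)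
qed

lemma powr_le_power_jap: "r \<le> real n \<Longrightarrow> jap k powr r \<le> jap k ^ n"
  using jap_ge_1[of k] jap_pos[of k] by (simp add: powr_mono flip: powr_realpow)

lemma wl2_weaken:
  assumes "wl2 s c" "s' \<le> s"
  shows "wl2 s' c"
  unfolding wl2_def
proof (rule summable_on_dominated(2)[OF assms(1)[unfolded wl2_def]])
  show "norm (jap k powr (2 * s') * (c k)\<^sup>2) \<le> jap k powr (2 * s) * (c k)\<^sup>2" for k
    using assms(2) jap_ge_1[of k] by (simp add: mult_right_mono powr_mono)
qed

lemma wl2_finite:
  assumes "finite K" "\<And>k. k \<notin> K \<Longrightarrow> c k = 0"
  shows "wl2 s c"
proof -
  have "(\<lambda>k. jap k powr (2 * s) * (c k)\<^sup>2) summable_on K" using assms(1) by simp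
  then show ?thesis unfolding wl2_def
    by (rule summable_on_cong_neutral[THEN iffD1, rotated -1]) (use assms(2) in auto)
qed

section \<open>Distributions with prescribed Fourier coefficients\<close>

text \<open>Coefficients in a Sobolev space grow at most like the n-th power of \<open>jap\<close>
  with n \<ge> |s|, and N = n + 2 derivatives of \<phi> compensate this growth and leave the
  summable kernel. The bound is linear in B, a seminorm of \<phi>.\<close>

lemma wl2_fcoef_bound:
  assumes c: "wl2 s (\<lambda>k. cmod (c k))"
  obtains C N where "0 \<le> C" "\<And>\<phi> B k. \<phi> \<in> periodic_smooth \<Longrightarrow> (\<And>x. cmod (\<phi> x) \<le> B) \<Longrightarrow>
      (\<And>x. cmod ((vderiv ^^ N) \<phi> x) \<le> B) \<Longrightarrow> cmod (c k * fcoef \<phi> (- k)) \<le> C * B * kern k"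
proof -
  define n where "n = nat \<lceil>\<bar>s\<bar>\<rceil>"
  have n: "\<bar>s\<bar> \<le> real n" unfolding n_def by linarith
  let ?W = "wnorm s (\<lambda>k. cmod (c k))"
  have "cmod (c k * fcoef \<phi> (- k)) \<le> ?W * 2 ^ (n + 2) * B * kern k"
    if \<phi>: "\<phi> \<in> periodic_smooth" and B: "\<And>x. cmod (\<phi> x) \<le> B" "\<And>x. cmod ((vderiv ^^ (n + 2)) \<phi> x) \<le> B"
    for \<phi> B k
  proof -
    have "cmod (c k) \<le> jap k powr (- s) * ?W" using wl2_coordinate[OF c, of k] by simp
    also have "\<dots> \<le> jap k ^ n * ?W"
      using n by (intro mult_right_mono powr_le_power_jap wnorm_nonneg) auto
    finally have "cmod (c k) * cmod (fcoef \<phi> (- k)) \<le> (jap k ^ n * ?W) * cmod (fcoef \<phi> (- k))"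
      by (rule mult_right_mono) simp
    also have "\<dots> = ?W * (jap (- k) ^ (n + 2) * cmod (fcoef \<phi> (- k))) * kern k"
      using jap_pos[of k] by (simp add: kern_def jap_minus power_add field_simps power2_eq_square)
    also have "\<dots> \<le> ?W * (2 ^ (n + 2) * B) * kern k"
      by (intro mult_right_mono mult_left_mono fcoef_decay[OF \<phi> B] wnorm_nonneg kern_nonneg)
    finally show ?thesis by (simp add: norm_mult mult_ac)
  qed
  then show ?thesis using that[of "?W * 2 ^ (n + 2)" "n + 2"] by (simp add: wnorm_nonneg)
qed

lemma wl2_fcoef_summable:
  assumes c: "wl2 s (\<lambda>k. cmod (c k))" and \<phi>: "\<phi> \<in> periodic_smooth"
  shows "(\<lambda>k. cmod (c k * fcoef \<phi> (- k))) summable_on UNIV" "(\<lambda>k. c k * fcoef \<phi> (- k)) summable_on UNIV"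
proof -
  obtain C N where C: "0 \<le> C" "\<And>\<phi> B k. \<phi> \<in> periodic_smooth \<Longrightarrow> (\<And>x. cmod (\<phi> x) \<le> B) \<Longrightarrow>
      (\<And>x. cmod ((vderiv ^^ N) \<phi> x) \<le> B) \<Longrightarrow> cmod (c k * fcoef \<phi> (- k)) \<le> C * B * kern k"
    using wl2_fcoef_bound[OF c] by blast
  obtain B0 Bn where B: "0 \<le> B0" "\<And>x. cmod (\<phi> x) \<le> B0" "0 \<le> Bn" "\<And>x. cmod ((vderiv ^^ N) \<phi> x) \<le> Bn"
    using periodic_smooth_sup[OF \<phi>] periodic_smooth_sup[OF vderiv_funpow_smooth[OF \<phi>, of N]] by metis
  have "cmod (c k * fcoef \<phi> (- k)) \<le> C * (B0 + Bn) * kern k" for k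
    by (rule C(2)[OF \<phi>]) (use B in \<open>auto intro: add_increasing add_increasing2\<close>)
  note * = summable_on_dominated[OF summable_on_cmult_right[OF kern_summable] this]
  show "(\<lambda>k. cmod (c k * fcoef \<phi> (- k))) summable_on UNIV" "(\<lambda>k. c k * fcoef \<phi> (- k)) summable_on UNIV"
    using * by auto
qed

lemma fcoef_add:
  assumes "\<phi> \<in> periodic_smooth" "\<eta> \<in> periodic_smooth"
  shows "fcoef (\<lambda>x. \<phi> x + \<eta> x) k = fcoef \<phi> k + fcoef \<eta> k"
  by (rule fcoef_unique)
     (use has_integral_add[OF has_integral_fcoef_smooth[OF assms(1), of k] has_integral_fcoef_smooth[OF assms(2), of k]]
      in \<open>simp add: algebra_simps\<close>)

lemma fcoef_cmult:
  assumes "\<phi> \<in> periodic_smooth"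
  shows "fcoef (\<lambda>x. c * \<phi> x) k = c * fcoef \<phi> k"
  by (rule fcoef_unique)
     (use has_integral_mult_right[OF has_integral_fcoef_smooth[OF assms(1), of k], of c] in \<open>simp add: algebra_simps\<close>)

lemma fcoef_mult_emode: "fcoef (\<lambda>x. \<phi> x * emode j x) k = fcoef \<phi> (k - j)"
proof -
  have "emode j x * emode (- k) x = emode (- (k - j)) x" for x
    using emode_add[of j "- k" x] by simp
  then show ?thesis unfolding fcoef_def by (simp add: mult.assoc)
qed

lemma fcoef_emode: "fcoef (emode j) k = (if j = k then 1 else 0)"
proof (rule fcoef_unique)
  have "emode j x * emode (- k) x = emode (j - k) x" for x
    using emode_add[of j "- k" x] by simp
  then show "((\<lambda>x. emode j x * emode (- k) x) has_integral 2 * of_real pi * (if j = k then 1 else 0)) {0..2 * pi}"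
    using emode_integral[of "j - k"] by (auto simp: emode_0[abs_def] split: if_splits)
qed

text \<open>The functional is the pairing written out in Fourier coefficients. It is continuous
  because \<open>wl2_fcoef_bound\<close> controls it by the suprema of the test function and of one
  derivative, and both tend to 0 for the differences X n - \<phi>.\<close>

lemma pdist_with_coeffs:
  assumes c: "wl2 s (\<lambda>k. cmod (c k))"
  obtains v where "\<And>k. fourier_coeff v k = c k"
proof -
  define L where "L \<phi> = (if \<phi> \<in> periodic_smooth then 2 * of_real pi * (\<Sum>\<^sub>\<infinity>k. c k * fcoef \<phi> (- k)) else 0)" for \<phi>
  note sm = wl2_fcoef_summable[OF c]
  have add: "L (\<lambda>x. \<phi> x + \<eta> x) = L \<phi> + L \<eta>" if "\<phi> \<in> periodic_smooth" "\<eta> \<in> periodic_smooth" for \<phi> \<eta>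
    using that by (simp add: L_def periodic_smooth_add fcoef_add distrib_left infsum_add sm)
  have cmult: "L (\<lambda>x. r * \<phi> x) = r * L \<phi>" if "\<phi> \<in> periodic_smooth" for \<phi> r
  proof -
    have "(\<Sum>\<^sub>\<infinity>k. c k * fcoef (\<lambda>x. r * \<phi> x) (- k)) = (\<Sum>\<^sub>\<infinity>k. r * (c k * fcoef \<phi> (- k)))"
      using that by (simp add: fcoef_cmult mult_ac)
    then show ?thesis using that by (simp add: L_def cmult_periodic_smooth infsum_cmult_right')
  qed
  obtain C N where C: "0 \<le> C" "\<And>\<phi> B k. \<phi> \<in> periodic_smooth \<Longrightarrow> (\<And>x. cmod (\<phi> x) \<le> B) \<Longrightarrow>
      (\<And>x. cmod ((vderiv ^^ N) \<phi> x) \<le> B) \<Longrightarrow> cmod (c k * fcoef \<phi> (- k)) \<le> C * B * kern k"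
    using wl2_fcoef_bound[OF c] by blast
  have bound: "cmod (L \<phi>) \<le> 2 * pi * C * kern_sum * B"
    if \<phi>: "\<phi> \<in> periodic_smooth" "\<And>x. cmod (\<phi> x) \<le> B" "\<And>x. cmod ((vderiv ^^ N) \<phi> x) \<le> B" for \<phi> B
  proof -
    have "cmod (\<Sum>\<^sub>\<infinity>k. c k * fcoef \<phi> (- k)) \<le> (\<Sum>\<^sub>\<infinity>k. C * B * kern k)"
      by (rule summable_on_dominated(3)[OF summable_on_cmult_right[OF kern_summable] C(2)[OF \<phi>]])
    also have "\<dots> = C * B * kern_sum" by (simp add: infsum_cmult_right' kern_sum_def)
    finally show ?thesis using \<phi>(1) by (simp add: L_def norm_mult mult_ac)
  qed
  have cont: "(\<lambda>n. L (X n)) \<longlonglongrightarrow> L \<phi>"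
    if \<phi>: "\<phi> \<in> periodic_smooth" and X: "\<And>n. X n \<in> periodic_smooth" "smooth_tendsto X \<phi>" for X \<phi>
  proof -
    let ?D = "\<lambda>n x. X n x + (- 1) * \<phi> x"
    note m\<phi> = cmult_periodic_smooth[OF \<phi>, where c = "- 1"]
    have D: "?D n \<in> periodic_smooth" for n by (intro periodic_smooth_add X m\<phi>)
    have LD: "L (X n) - L \<phi> = L (?D n)" for n
      using add[OF X(1) m\<phi>(2), of n] cmult[OF \<phi>, of "- 1"] by simp
    have vD: "(vderiv ^^ j) (?D n) x = (vderiv ^^ j) (X n) x - (vderiv ^^ j) \<phi> x" for j n x
      by (subst vderiv_add[OF X(1) m\<phi>(2)], simp only: m\<phi>(1)) simp
    have ev: "eventually (\<lambda>n. \<forall>x. cmod ((vderiv ^^ j) (?D n) x) \<le> e) sequentially" if "e > 0" for j and e :: real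
    proof -
      have "eventually (\<lambda>n. \<forall>x\<in>UNIV. dist ((vderiv ^^ j) (X n) x) ((vderiv ^^ j) \<phi> x) < e) sequentially"
        using X(2) that unfolding smooth_tendsto_def by (intro uniform_limitD) auto
      then show ?thesis
      proof eventually_elim
        case (elim n)
        then show ?case
          unfolding vD by (auto simp: dist_norm intro: less_imp_le)
      qed
    qed
    have "(\<lambda>n. L (X n) - L \<phi>) \<longlonglongrightarrow> 0"
    proof (rule tendstoI)
      fix e :: real assume "e > 0"
      \<comment> \<open>The summand 1 keeps K positive when C is 0.\<close>
      define K where "K = 2 * pi * C * kern_sum + 1"
      have K: "K > 0" using C(1) kern_sum_ge_1 by (simp add: K_def add_nonneg_pos)
      from \<open>e > 0\<close> K have e2: "e / (2 * K) > 0" by simp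
      show "eventually (\<lambda>n. dist (L (X n) - L \<phi>) 0 < e) sequentially"
        using ev[OF e2, of 0] ev[OF e2, of N]
      proof eventually_elim
        case (elim n)
        have "cmod (L (?D n)) \<le> 2 * pi * C * kern_sum * (e / (2 * K))"
          by (rule bound[OF D]) (use elim in auto)
        also have "\<dots> \<le> K * (e / (2 * K))"
          using e2 by (intro mult_right_mono) (auto simp: K_def)
        also have "\<dots> < e" using K \<open>e > 0\<close> by simp
        finally show ?case unfolding LD by simp
      qed
    qed
    then show ?thesis by (simp add: LIM_zero_iff)
  qed
  have "pairing (Abs_pdist L) = L"
    by (rule Abs_pdist_inverse) (use add cmult cont in \<open>auto simp: L_def\<close>)
  then have "fourier_coeff (Abs_pdist L) k = c k" for k
  proof -
    have "(\<Sum>\<^sub>\<infinity>j. c j * fcoef (emode (- k)) (- j)) = (\<Sum>\<^sub>\<infinity>j\<in>{k}. c j)"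
      by (rule infsum_cong_neutral) (auto simp: fcoef_emode)
    then have "L (emode (- k)) = 2 * of_real pi * c k" by (simp add: L_def)
    with \<open>pairing (Abs_pdist L) = L\<close> fourier_coeff_pairing[of "Abs_pdist L" "- k"] show ?thesis by simp
  qed
  then show ?thesis using that by blast
qed

text \<open>The same definite description as in \<open>evol\<close>. It denotes the intended
  distribution as soon as the sequence is square summable with some Sobolev weight.\<close>

definition pd_of_coeffs :: "(int \<Rightarrow> complex) \<Rightarrow> pdist" where
  "pd_of_coeffs c = (THE v. \<forall>k. fourier_coeff v k = c k)"

lemma pd_of_coeffs_unique:
  assumes "\<And>k. fourier_coeff v k = c k"
  shows "pd_of_coeffs c = v"
  unfolding pd_of_coeffs_def
  by (rule the_equality) (use assms in \<open>auto intro: pdist_eqI\<close>)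

lemma fourier_coeff_pd_of_coeffs:
  assumes "wl2 s (\<lambda>k. cmod (c k))"
  shows "fourier_coeff (pd_of_coeffs c) k = c k"
  using pdist_with_coeffs[OF assms] pd_of_coeffs_unique by metis

lemma evol_pd_of_coeffs:
  "evol a t v = pd_of_coeffs (\<lambda>k. exp (\<i> * of_int k * of_real (a k) * of_real t) * fourier_coeff v k)"
  by (simp add: evol_def pd_of_coeffs_def)

lemma fourier_coeff_evol:
  assumes "v \<in> sobolev s"
  shows "fourier_coeff (evol a t v) k = exp (\<i> * of_real (eigval a k * t)) * fourier_coeff v k"
proof -
  have e: "exp (\<i> * of_int k * of_real (a k) * of_real t) = exp (\<i> * of_real (eigval a k * t))" for k
    by (simp add: eigval_def mult_ac)
  show ?thesis
    unfolding evol_pd_of_coeffs e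
    by (rule fourier_coeff_pd_of_coeffs[of s])
       (use assms in \<open>simp only: sobolev_wl2 norm_mult norm_exp_i_times mult_1\<close>)
qed

lemma pairing_eq_infsum:
  assumes "v \<in> sobolev s" and \<phi>: "\<phi> \<in> periodic_smooth"
  shows "pairing v \<phi> = 2 * of_real pi * (\<Sum>\<^sub>\<infinity>k. fourier_coeff v k * fcoef \<phi> (- k))"
proof -
  let ?f = "\<lambda>k. fcoef \<phi> k * fourier_coeff v (- k)"
  have "(\<lambda>k. fourier_coeff v k * fcoef \<phi> (- k)) summable_on UNIV"
    using wl2_fcoef_summable(2)[OF assms(1)[unfolded sobolev_wl2] \<phi>] .
  then have "(?f \<circ> uminus) summable_on UNIV" by (simp add: comp_def mult_ac)
  then have "?f summable_on range uminus" by (subst summable_on_reindex) auto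
  then have s: "?f summable_on UNIV" by simp
  have "(\<lambda>n. 2 * of_real pi * (\<Sum>k\<in>{- int n..int n}. ?f k)) \<longlonglongrightarrow> 2 * of_real pi * infsum ?f UNIV"
    by (intro tendsto_mult_left has_sum_int_box has_sum_infsum s)
  moreover have "(\<lambda>n. 2 * of_real pi * (\<Sum>k\<in>{- int n..int n}. ?f k)) \<longlonglongrightarrow> pairing v \<phi>"
    using pairing_fourier[OF \<phi>, of v] by (simp add: sum_distrib_left mult_ac)
  ultimately have "pairing v \<phi> = 2 * of_real pi * infsum ?f UNIV" using LIMSEQ_unique by blast
  also have "infsum ?f UNIV = infsum (?f \<circ> uminus) UNIV"
    using infsum_reindex[of uminus UNIV ?f] by simp
  finally show ?thesis by (simp add: comp_def mult_ac)
qed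

section \<open>The matrix of the control operator\<close>

text \<open>The term \<open>f (k - m)\<close> is multiplication by g, a Toeplitz matrix. The other
  term has rank one: pairing the mode m with g gives \<open>2 * of_real pi * f (- m)\<close>, and
  \<open>f k\<close> is the k-th coefficient of the factor g.\<close>

definition Gmat :: "(real \<Rightarrow> real) \<Rightarrow> int \<Rightarrow> int \<Rightarrow> complex" where
  "Gmat g k m = (let f = fcoef (\<lambda>x. complex_of_real (g x)) in
     f (k - m) - 2 * of_real pi * f k * f (- m))"

text \<open>Peetre's inequality. For negative s the submultiplicativity of \<open>jap\<close> is
  used with k and m exchanged.\<close>

lemma jap_powr_le:
  "jap k powr s \<le> jap (k - m) powr \<bar>s\<bar> * jap m powr s"
proof (cases "s \<ge> 0")
  case True
  have "jap k powr s \<le> (jap (k - m) * jap m) powr s"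
    using jap_add_le[of "k - m" m] True by (intro powr_mono2) (auto simp: jap_nonneg)
  then show ?thesis using True by (simp add: powr_mult jap_nonneg)
next
  case False
  have "jap m powr (- s) \<le> (jap (k - m) * jap k) powr (- s)"
    using jap_add_le[of "m - k" k] False jap_minus[of "k - m"]
    by (intro powr_mono2) (auto simp: jap_nonneg)
  then have "jap m powr (- s) \<le> jap (k - m) powr \<bar>s\<bar> * jap k powr (- s)"
    using False by (simp add: powr_mult jap_nonneg)
  then show ?thesis using jap_pos[of k] jap_pos[of m] by (simp add: powr_minus field_simps)
qed

text \<open>The Toeplitz part decays in k - m by smoothness of g. The rank-one part decays in k and
  in m separately, which is stronger because \<open>jap (k - m)\<close> is at most the product of
  the two weights.\<close>

lemma Gmat_decay:
  assumes g: "(\<lambda>x. complex_of_real (g x)) \<in> periodic_smooth"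
  obtains C where "0 \<le> C" "\<And>k m. cmod (Gmat g k m) * jap (k - m) ^ n \<le> C"
proof -
  let ?f = "fcoef (\<lambda>x. complex_of_real (g x))"
  obtain B where B: "0 \<le> B" "\<And>k. jap k ^ n * cmod (?f k) \<le> B"
    using fcoef_rapid_decay[OF g] by blast
  have "cmod (Gmat g k m) * jap (k - m) ^ n \<le> B + 2 * pi * (B * B)" for k m
  proof -
    have "jap (k - m) ^ n \<le> (jap k * jap (- m)) ^ n"
      using jap_add_le[of k "- m"] by (intro power_mono) (auto simp: jap_nonneg)
    then have "cmod (?f k) * cmod (?f (- m)) * jap (k - m) ^ n
        \<le> cmod (?f k) * cmod (?f (- m)) * (jap k * jap (- m)) ^ n"
      by (rule mult_left_mono) simp
    also have "\<dots> = (jap k ^ n * cmod (?f k)) * (jap (- m) ^ n * cmod (?f (- m)))"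
      by (simp add: power_mult_distrib mult_ac)
    also have "\<dots> \<le> B * B"
      by (intro mult_mono B) (auto simp: jap_nonneg)
    finally have 1: "2 * pi * (cmod (?f k) * cmod (?f (- m)) * jap (k - m) ^ n) \<le> 2 * pi * (B * B)"
      by (rule mult_left_mono) simp
    have "cmod (Gmat g k m) \<le> cmod (?f (k - m)) + 2 * pi * (cmod (?f k) * cmod (?f (- m)))"
      unfolding Gmat_def Let_def
      by (rule order_trans[OF norm_triangle_ineq4]) (simp add: norm_mult mult_ac)
    then have "cmod (Gmat g k m) * jap (k - m) ^ n
        \<le> (cmod (?f (k - m)) + 2 * pi * (cmod (?f k) * cmod (?f (- m)))) * jap (k - m) ^ n"
      by (rule mult_right_mono) (simp add: jap_nonneg)
    also have "\<dots> = jap (k - m) ^ n * cmod (?f (k - m)) + 2 * pi * (cmod (?f k) * cmod (?f (- m)) * jap (k - m) ^ n)"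
      by (simp add: algebra_simps)
    finally show ?thesis using 1 B(2)[of "k - m"] by linarith
  qed
  then show ?thesis by (intro that[of "B + 2 * pi * (B * B)"]) (use B(1) in simp)
qed

text \<open>Conjugation with the weights costs at most n powers of \<open>jap (k - m)\<close> by
  Peetre's inequality; decay of order n + 2 pays for them and leaves \<open>kern\<close>.\<close>

lemma Gmat_weighted:
  assumes g: "(\<lambda>x. complex_of_real (g x)) \<in> periodic_smooth"
  obtains D where "0 \<le> D" "\<And>k m. jap k powr s * cmod (Gmat g k m) \<le> D * kern (k - m) * jap m powr s"
proof -
  define n where "n = nat \<lceil>\<bar>s\<bar>\<rceil>"
  have n: "\<bar>s\<bar> \<le> real n" unfolding n_def by linarith
  obtain C where C: "0 \<le> C" "\<And>k m. cmod (Gmat g k m) * jap (k - m) ^ (n + 2) \<le> C"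
    using Gmat_decay[OF g, of "n + 2"] by blast
  have "jap k powr s * cmod (Gmat g k m) \<le> C * kern (k - m) * jap m powr s" for k m
  proof -
    have "jap k powr s \<le> jap (k - m) ^ n * jap m powr s"
      using n by (intro order_trans[OF jap_powr_le[of k s m]] mult_right_mono powr_le_power_jap) auto
    then have "jap k powr s * cmod (Gmat g k m) \<le> (jap (k - m) ^ n * jap m powr s) * cmod (Gmat g k m)"
      by (rule mult_right_mono) simp
    also have "\<dots> = (cmod (Gmat g k m) * jap (k - m) ^ (n + 2)) * kern (k - m) * jap m powr s"
      using jap_pos[of "k - m"] by (simp add: kern_def power_add field_simps power2_eq_square)
    also have "\<dots> \<le> C * kern (k - m) * jap m powr s"
      by (intro mult_right_mono C kern_nonneg) simp
    finally show ?thesis .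
  qed
  with C(1) that show ?thesis by blast
qed

text \<open>Boundedness of G, stated for absolute values and an arbitrary majorant c rather than for
  a distribution: the same estimate then covers functions of time through a majorant independent of
  time.\<close>

lemma Gmat_bounded:
  assumes g: "(\<lambda>x. complex_of_real (g x)) \<in> periodic_smooth"
  shows "\<exists>D\<ge>0. \<forall>c. (\<forall>m. 0 \<le> c m) \<and> wl2 s c \<longrightarrow>
     (\<forall>k. (\<lambda>m. cmod (Gmat g k m) * c m) summable_on UNIV) \<and>
     wl2 s (\<lambda>k. \<Sum>\<^sub>\<infinity>m. cmod (Gmat g k m) * c m) \<and>
     wnorm s (\<lambda>k. \<Sum>\<^sub>\<infinity>m. cmod (Gmat g k m) * c m) \<le> D * wnorm s c"
proof -
  obtain D where D: "0 \<le> D" "\<And>k m. jap k powr s * cmod (Gmat g k m) \<le> D * kern (k - m) * jap m powr s"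
    using Gmat_weighted[OF g] by blast
  have main: "(\<lambda>m. cmod (Gmat g k m) * c m) summable_on UNIV"
    "wl2 s (\<lambda>k. \<Sum>\<^sub>\<infinity>m. cmod (Gmat g k m) * c m)"
    "wnorm s (\<lambda>k. \<Sum>\<^sub>\<infinity>m. cmod (Gmat g k m) * c m) \<le> D * kern_sum * wnorm s c"
    if c0: "\<And>m. 0 \<le> c m" and c: "wl2 s c" for c k
  proof -
    \<comment> \<open>Moving the weight into y reduces the claim to the unweighted l^2 bound
      \<open>kern_conv\<close>.\<close>
    define y where "y m = jap m powr s * c m" for m
    have e2: "(jap m powr s)\<^sup>2 = jap m powr (2 * s)" for m
      by (simp add: power2_eq_square flip: powr_add)
    have y0: "0 \<le> y m" for m by (simp add: y_def c0)
    have ysq: "(y m)\<^sup>2 = jap m powr (2 * s) * (c m)\<^sup>2" for m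
      by (simp add: y_def power_mult_distrib e2)
    have ys: "(\<lambda>m. (y m)\<^sup>2) summable_on UNIV" using c by (simp add: wl2_def ysq)
    note kc = kern_conv[OF y0 ys]
    have le: "jap k powr s * (cmod (Gmat g k m) * c m) \<le> D * (kern (k - m) * y m)" for k m
      using mult_right_mono[OF D(2)[of k m] c0[of m]] by (simp add: y_def mult_ac)
    have le': "cmod (Gmat g k m) * c m \<le> (1 / jap k powr s) * (D * (kern (k - m) * y m))" for k m
      using le[of k m] jap_pos[of k] by (simp add: field_simps)
    have sm: "(\<lambda>m. cmod (Gmat g k m) * c m) summable_on UNIV" for k
      by (rule summable_on_dominated(2)[OF summable_on_cmult_right[OF summable_on_cmult_right[OF kc(1)[of k], of D],
            of "1 / jap k powr s"]])
         (use le'[of k] c0 in simp)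
    then show "(\<lambda>m. cmod (Gmat g k m) * c m) summable_on UNIV" .
    define d where "d k = (\<Sum>\<^sub>\<infinity>m. cmod (Gmat g k m) * c m)" for k
    have d0: "0 \<le> d k" for k unfolding d_def by (intro infsum_nonneg) (simp add: c0)
    have dle: "jap k powr s * d k \<le> D * (\<Sum>\<^sub>\<infinity>m. kern (k - m) * y m)" for k
    proof -
      have "jap k powr s * d k = (\<Sum>\<^sub>\<infinity>m. jap k powr s * (cmod (Gmat g k m) * c m))"
        by (simp add: d_def infsum_cmult_right')
      also have "\<dots> \<le> (\<Sum>\<^sub>\<infinity>m. D * (kern (k - m) * y m))"
        by (intro infsum_mono summable_on_cmult_right sm kc(1) le)
      finally show ?thesis by (simp add: infsum_cmult_right')
    qed
    have sq: "jap k powr (2 * s) * (d k)\<^sup>2 \<le> D\<^sup>2 * (\<Sum>\<^sub>\<infinity>m. kern (k - m) * y m)\<^sup>2" for k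
      using power_mono[OF dle[of k], of 2] d0[of k] by (simp add: power_mult_distrib e2)
    note s2 = summable_on_cmult_right[OF kc(2), of "D\<^sup>2"]
    have wd: "(\<lambda>k. jap k powr (2 * s) * (d k)\<^sup>2) summable_on UNIV"
      by (rule summable_on_dominated(2)[OF s2]) (use sq in simp)
    then show "wl2 s (\<lambda>k. \<Sum>\<^sub>\<infinity>m. cmod (Gmat g k m) * c m)" by (simp add: wl2_def d_def)
    have "(\<Sum>\<^sub>\<infinity>k. jap k powr (2 * s) * (d k)\<^sup>2) \<le> (\<Sum>\<^sub>\<infinity>k. D\<^sup>2 * (\<Sum>\<^sub>\<infinity>m. kern (k - m) * y m)\<^sup>2)"
      by (intro infsum_mono wd s2 sq)
    also have "\<dots> \<le> D\<^sup>2 * (kern_sum\<^sup>2 * (\<Sum>\<^sub>\<infinity>m. (y m)\<^sup>2))"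
      unfolding infsum_cmult_right' by (intro mult_left_mono kc(3)) simp
    finally have "2 * pi * (\<Sum>\<^sub>\<infinity>k. jap k powr (2 * s) * (d k)\<^sup>2)
        \<le> 2 * pi * (D\<^sup>2 * (kern_sum\<^sup>2 * (\<Sum>\<^sub>\<infinity>m. (y m)\<^sup>2)))"
      by (rule mult_left_mono) simp
    then have "(wnorm s d)\<^sup>2 \<le> (D * kern_sum * wnorm s c)\<^sup>2"
      by (simp add: wnorm_sq power_mult_distrib ysq mult_ac)
    then show "wnorm s (\<lambda>k. \<Sum>\<^sub>\<infinity>m. cmod (Gmat g k m) * c m) \<le> D * kern_sum * wnorm s c"
      unfolding d_def[abs_def, symmetric]
      by (rule power2_le_imp_le) (use D(1) kern_sum_ge_1 wnorm_nonneg in auto)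
  qed
  show ?thesis
    by (intro exI[of _ "D * kern_sum"] conjI allI impI) (use main D(1) kern_sum_ge_1 in auto)
qed

section \<open>Symmetry of the matrix and the zero mode\<close>

lemma cnj_fcoef_real: "cnj (fcoef (\<lambda>x. complex_of_real (g x)) k) = fcoef (\<lambda>x. complex_of_real (g x)) (- k)"
proof -
  have "cnj (integral {0..2 * pi} (\<lambda>x. complex_of_real (g x) * emode (- k) x))
      = integral {0..2 * pi} (\<lambda>x. cnj (complex_of_real (g x) * emode (- k) x))"
    by (rule integral_cnj)
  then show ?thesis by (simp add: fcoef_def cnj_emode)
qed

lemma Gmat_hermitian: "cnj (Gmat g k m) = Gmat g m k"
  by (simp add: Gmat_def Let_def cnj_fcoef_real mult_ac)

lemma control_profile_smooth:
  "control_profile g \<Longrightarrow> (\<lambda>x. complex_of_real (g x)) \<in> periodic_smooth"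
  by (simp add: control_profile_def)

lemma control_profile_fcoef_0:
  assumes "control_profile g"
  shows "2 * of_real pi * fcoef (\<lambda>x. complex_of_real (g x)) 0 = 1"
proof -
  have "((\<lambda>x. Re (complex_of_real (g x) * emode (- 0) x)) has_integral
      Re (2 * of_real pi * fcoef (\<lambda>x. complex_of_real (g x)) 0)) {0..2 * pi}"
    by (rule has_integral_Re[OF has_integral_fcoef_smooth[OF control_profile_smooth[OF assms]]])
  then have "(g has_integral Re (2 * of_real pi * fcoef (\<lambda>x. complex_of_real (g x)) 0)) {0..2 * pi}"
    by simp
  then have "Re (2 * of_real pi * fcoef (\<lambda>x. complex_of_real (g x)) 0) = 1"
    using assms by (simp add: control_profile_def has_integral_iff)
  moreover have "Im (2 * of_real pi * fcoef (\<lambda>x. complex_of_real (g x)) 0) = 0"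
    using arg_cong[OF cnj_fcoef_real[of g 0], of Im] by simp
  ultimately show ?thesis by (simp add: complex_eq_iff)
qed

text \<open>Since g has integral 1, G annihilates constants; by symmetry everything in its range has
  mean zero. The zero mode is thus out of reach of the control, and this is why u0 and u1 must have
  the same coefficient at 0.\<close>

lemma Gmat_0_right: "control_profile g \<Longrightarrow> Gmat g k 0 = 0"
  using control_profile_fcoef_0[of g] by (simp add: Gmat_def Let_def mult_ac)

lemma Gmat_0_left: "control_profile g \<Longrightarrow> Gmat g 0 k = 0"
  using Gmat_0_right[of g k] Gmat_hermitian[of g k 0] by simp

lemma fourier_coeff_control_op:
  assumes g: "control_profile g" and v: "v \<in> sobolev s"
  shows "fourier_coeff (control_op g v) k = (\<Sum>\<^sub>\<infinity>m. Gmat g k m * fourier_coeff v m)"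
proof -
  let ?g = "\<lambda>x. complex_of_real (g x)" and ?v = "fourier_coeff v"
  note gs = control_profile_smooth[OF g]
  have ge: "(\<lambda>x. ?g x * emode (- k) x) \<in> periodic_smooth"
    by (intro periodic_smooth_mult gs emode_smooth)
  note sm = wl2_fcoef_summable(2)[OF v[unfolded sobolev_wl2]]
  have s1: "(\<lambda>m. ?v m * fcoef ?g (k - m)) summable_on UNIV"
    using sm[OF ge] by (simp add: fcoef_mult_emode)
  have s2: "(\<lambda>m. ?v m * fcoef ?g (- m)) summable_on UNIV"
    using sm[OF gs] .
  have p1: "pairing (pd_mult ?g v) (emode (- k)) = 2 * of_real pi * (\<Sum>\<^sub>\<infinity>m. ?v m * fcoef ?g (k - m))"
    using gs pairing_eq_infsum[OF v ge] by (simp add: pd_mult.rep_eq fcoef_mult_emode)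
  have p2: "pairing v ?g = 2 * of_real pi * (\<Sum>\<^sub>\<infinity>m. ?v m * fcoef ?g (- m))"
    by (rule pairing_eq_infsum[OF v gs])
  have p3: "pairing (pd_of_fun ?g) (emode (- k)) = 2 * of_real pi * fcoef ?g k"
    using gs integral_unique[OF has_integral_fcoef_smooth[OF gs, of k]] by (simp add: pd_of_fun.rep_eq)
  have f1: "fourier_coeff (pd_mult ?g v) k = (\<Sum>\<^sub>\<infinity>m. ?v m * fcoef ?g (k - m))"
    using p1 fourier_coeff_pairing[of "pd_mult ?g v" "- k"] by simp
  have f3: "fourier_coeff (pd_of_fun ?g) k = fcoef ?g k"
    using p3 fourier_coeff_pairing[of "pd_of_fun ?g" "- k"] by simp
  have "fourier_coeff (control_op g v) k
      = (\<Sum>\<^sub>\<infinity>m. ?v m * fcoef ?g (k - m)) - (2 * of_real pi * (\<Sum>\<^sub>\<infinity>m. ?v m * fcoef ?g (- m))) * fcoef ?g k"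
    by (simp add: control_op_def Let_def f1 f3 p2)
  also have "\<dots> = (\<Sum>\<^sub>\<infinity>m. ?v m * fcoef ?g (k - m)) + (\<Sum>\<^sub>\<infinity>m. (- (2 * of_real pi) * fcoef ?g k) * (?v m * fcoef ?g (- m)))"
    unfolding infsum_cmult_right' by simp
  also have "\<dots> = (\<Sum>\<^sub>\<infinity>m. ?v m * fcoef ?g (k - m) + (- (2 * of_real pi) * fcoef ?g k) * (?v m * fcoef ?g (- m)))"
    by (rule infsum_add[symmetric, OF s1 summable_on_cmult_right[OF s2]])
  also have "\<dots> = (\<Sum>\<^sub>\<infinity>m. Gmat g k m * ?v m)"
    by (simp add: Gmat_def Let_def algebra_simps)
  finally show ?thesis .
qed

lemma control_op_sobolev:
  assumes g: "control_profile g" and v: "v \<in> sobolev s"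
  shows "control_op g v \<in> sobolev s"
proof -
  let ?c = "\<lambda>m. cmod (fourier_coeff v m)"
  have c: "wl2 s ?c" using v by (simp add: sobolev_wl2)
  then have D: "(\<lambda>m. cmod (Gmat g k m) * ?c m) summable_on UNIV"
    "wl2 s (\<lambda>k. \<Sum>\<^sub>\<infinity>m. cmod (Gmat g k m) * ?c m)" for k
    using Gmat_bounded[OF control_profile_smooth[OF g], of s] by auto
  show ?thesis
    unfolding sobolev_wl2
  proof (rule wl2_mono(1)[OF D(2)])
    fix k
    have "cmod (\<Sum>\<^sub>\<infinity>m. Gmat g k m * fourier_coeff v m) \<le> (\<Sum>\<^sub>\<infinity>m. cmod (Gmat g k m) * ?c m)"
      by (rule summable_on_dominated(3)[OF D(1)]) (simp_all add: norm_mult)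
    then show "\<bar>cmod (fourier_coeff (control_op g v) k)\<bar> \<le> \<bar>\<Sum>\<^sub>\<infinity>m. cmod (Gmat g k m) * ?c m\<bar>"
      unfolding fourier_coeff_control_op[OF g v] by simp
  qed
qed

text \<open>A trigonometric polynomial is \<open>e\<^sup>-\<^sup>i\<^sup>N\<^sup>x\<close> times a polynomial in \<open>e\<^sup>i\<^sup>x\<close>, so it has finitely many zeros
  in a period unless it is zero.\<close>

lemma trig_poly_zero:
  assumes F: "finite F" and zero: "\<And>x. \<alpha> < x \<Longrightarrow> x < \<beta> \<Longrightarrow> (\<Sum>k\<in>F. c k * emode k x) = 0"
    and "\<alpha> < \<beta>" and j: "j \<in> F"
  shows "c j = 0"
proof -
  define N where "N = Max (insert 0 (abs ` F))"
  have N: "0 \<le> k + N" if "k \<in> F" for k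
  proof -
    have "\<bar>k\<bar> \<le> N" unfolding N_def using F that by (intro Max_ge) auto
    then show ?thesis by linarith
  qed
  define p where "p = (\<Sum>k\<in>F. monom (c k) (nat (k + N)))"
  have poly: "poly p (emode 1 x) = emode N x * (\<Sum>k\<in>F. c k * emode k x)" for x
  proof -
    have "emode 1 x ^ n = emode (int n) x" for n
      by (induction n) (simp_all add: emode_add)
    then have "poly p (emode 1 x) = (\<Sum>k\<in>F. c k * emode (k + N) x)"
      unfolding p_def poly_sum poly_monom by (intro sum.cong) (use N in auto)
    then show ?thesis by (simp add: emode_add sum_distrib_left mult_ac)
  qed
  \<comment> \<open>Length at most 1 is less than a period, so \<open>emode 1\<close> is injective
    on the shortened interval and yields infinitely many roots of p.\<close>
  define \<beta>' where "\<beta>' = min \<beta> (\<alpha> + 1)"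
  have "inj_on (emode 1) {\<alpha><..<\<beta>'}"
  proof (rule inj_onI)
    fix x y assume xy: "x \<in> {\<alpha><..<\<beta>'}" "y \<in> {\<alpha><..<\<beta>'}" and e: "emode 1 x = emode 1 y"
    have "exp (\<i> * of_real x) = exp (\<i> * of_real y)" using e by (simp add: emode_def)
    then obtain n :: int where n: "\<i> * of_real x = \<i> * of_real y + (of_int (2 * n) * pi) * \<i>"
      unfolding exp_eq by blast
    then have "x = y + of_int (2 * n) * pi" by (simp add: complex_eq_iff)
    moreover have "\<bar>x - y\<bar> < 1" using xy by (auto simp: \<beta>'_def)
    ultimately have "\<bar>of_int n\<bar> * (2 * pi) < 1" by (simp add: abs_mult)
    moreover have "1 * (2 * pi) \<le> \<bar>of_int n\<bar> * (2 * pi)" if "n \<noteq> 0"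
      using that by (intro mult_right_mono) (simp_all flip: of_int_abs)
    ultimately have "n = 0" using pi_ge_two by fastforce
    then show "x = y" using \<open>x = y + of_int (2 * n) * pi\<close> by simp
  qed
  moreover have "infinite {\<alpha><..<\<beta>'}" using \<open>\<alpha> < \<beta>\<close> by (simp add: \<beta>'_def infinite_Ioo)
  ultimately have "infinite (emode 1 ` {\<alpha><..<\<beta>'})" using finite_imageD by blast
  moreover have "emode 1 ` {\<alpha><..<\<beta>'} \<subseteq> {z. poly p z = 0}"
    using zero by (auto simp: poly \<beta>'_def)
  ultimately have "p = 0" using poly_roots_finite finite_subset by blast
  have "coeff p (nat (j + N)) = (\<Sum>k\<in>F. if k = j then c k else 0)"
    unfolding p_def coeff_sum coeff_monom
  proof (intro sum.cong refl)
    fix k assume "k \<in> F"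
    then show "(if nat (k + N) = nat (j + N) then c k else 0) = (if k = j then c k else 0)"
      using N[of k] N[OF j] by (auto simp: eq_nat_nat_iff)
  qed
  then show ?thesis using \<open>p = 0\<close> F j by simp
qed

lemma control_profile_interval:
  assumes "control_profile g"
  obtains \<alpha> \<beta> where "\<alpha> < \<beta>" "\<And>x. \<alpha> < x \<Longrightarrow> x < \<beta> \<Longrightarrow> 0 < g x"
proof -
  obtain \<alpha> \<beta> where "\<alpha> < \<beta>"
    "{x. 0 < g x} = {x. \<exists>n::int. \<alpha> < x + 2 * pi * of_int n \<and> x + 2 * pi * of_int n < \<beta>}"
    using assms unfolding control_profile_def circle_open_interval_def by blast
  moreover from this(2) have "0 < g x" if "\<alpha> < x" "x < \<beta>" for x
    using that by (auto simp: set_eq_iff intro!: exI[of _ 0])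
  ultimately show ?thesis using that by blast
qed

text \<open>The combination of columns is, up to normalisation, the sequence of Fourier coefficients
  of g times a trigonometric polynomial with constant term - \<kappa>, where \<kappa> collects the
  rank-one parts. If it vanishes, so does the polynomial on the interval where g > 0. Because 0 is
  not in F, the term - \<kappa> does not mix with the coefficients y.\<close>

lemma Gmat_injective:
  assumes g: "control_profile g" and F: "finite F" "0 \<notin> F"
    and zero: "\<And>l. (\<Sum>m\<in>F. Gmat g l m * y m) = 0" and j: "j \<in> F"
  shows "y j = 0"
proof -
  let ?g = "\<lambda>x. complex_of_real (g x)"
  note gs = control_profile_smooth[OF g]
  define \<kappa> where "\<kappa> = (\<Sum>m\<in>F. 2 * of_real pi * fcoef ?g (- m) * y m)"
  define \<phi> where "\<phi> x = (\<Sum>m\<in>F. y m * (?g x * emode m x)) + (- \<kappa>) * ?g x" for x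
  have ge: "(\<lambda>x. ?g x * emode m x) \<in> periodic_smooth" for m
    by (intro periodic_smooth_mult gs emode_smooth)
  have s: "(\<lambda>x. \<Sum>m\<in>F. y m * (?g x * emode m x)) \<in> periodic_smooth"
    by (intro periodic_smooth_sum cmult_periodic_smooth ge)
  have \<phi>: "\<phi> \<in> periodic_smooth"
    unfolding \<phi>_def[abs_def] by (intro periodic_smooth_add s cmult_periodic_smooth gs)
  have "((\<lambda>x. (\<Sum>m\<in>F. y m * ((?g x * emode m x) * emode (- l) x)) + (- \<kappa>) * (?g x * emode (- l) x)) has_integral
     (\<Sum>m\<in>F. y m * (2 * of_real pi * fcoef ?g (l - m))) + (- \<kappa>) * (2 * of_real pi * fcoef ?g l)) {0..2 * pi}" for l
    using has_integral_fcoef_smooth[OF ge, of _ l]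
    by (intro has_integral_add has_integral_sum has_integral_mult_right F has_integral_fcoef_smooth gs)
       (simp add: fcoef_mult_emode)
  moreover have "(\<lambda>x. (\<Sum>m\<in>F. y m * ((?g x * emode m x) * emode (- l) x)) + (- \<kappa>) * (?g x * emode (- l) x))
      = (\<lambda>x. \<phi> x * emode (- l) x)" for l
    by (simp add: \<phi>_def sum_distrib_right sum_distrib_left algebra_simps)
  moreover have "(\<Sum>m\<in>F. y m * (2 * of_real pi * fcoef ?g (l - m))) + (- \<kappa>) * (2 * of_real pi * fcoef ?g l)
      = 2 * of_real pi * (\<Sum>m\<in>F. Gmat g l m * y m)" for l
    by (simp add: Gmat_def Let_def \<kappa>_def sum_distrib_left sum_distrib_right algebra_simps sum_subtractf)
  ultimately have "((\<lambda>x. \<phi> x * emode (- l) x) has_integral 2 * of_real pi * (\<Sum>m\<in>F. Gmat g l m * y m)) {0..2 * pi}" for l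
    by simp
  then have "fcoef \<phi> l = 0" for l
    using fcoef_unique[of \<phi> l 0] by (simp add: zero)
  then have \<phi>0: "\<phi> x = 0" for x by (rule fcoef_zero_imp_zero[OF \<phi>])
  obtain \<alpha> \<beta> where ab: "\<alpha> < \<beta>" "\<And>x. \<alpha> < x \<Longrightarrow> x < \<beta> \<Longrightarrow> 0 < g x"
    using control_profile_interval[OF g] by blast
  define c where "c m = (if m = 0 then - \<kappa> else y m)" for m
  have "(\<Sum>k\<in>insert 0 F. c k * emode k x) = 0" if "\<alpha> < x" "x < \<beta>" for x
  proof -
    have "(\<Sum>k\<in>F. c k * emode k x) = (\<Sum>k\<in>F. y k * emode k x)"
      by (intro sum.cong) (use F in \<open>auto simp: c_def\<close>)
    then have "?g x * (\<Sum>k\<in>insert 0 F. c k * emode k x) = \<phi> x"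
      using F by (simp add: \<phi>_def c_def sum_distrib_left algebra_simps)
    then show ?thesis using \<phi>0[of x] ab(2)[OF that] by simp
  qed
  from trig_poly_zero[OF _ this ab(1), of j] F j have "c j = 0" by auto
  moreover have "j \<noteq> 0" using F j by blast
  ultimately show ?thesis by (simp add: c_def)
qed

text \<open>Gaussian elimination: after removal of the pivot row r and the column f, the Schur
  complement M' is again injective. Matrices are functions on finite index sets because the size of
  the system depends on the data.\<close>

lemma injective_imp_solvable:
  fixes M :: "'a \<Rightarrow> 'b \<Rightarrow> 'c::field"
  assumes "finite R" "finite F" "card R = card F"
    and "\<And>x. (\<And>k. k \<in> R \<Longrightarrow> (\<Sum>m\<in>F. M k m * x m) = 0) \<Longrightarrow> (\<forall>m\<in>F. x m = 0)"
  shows "\<exists>x. \<forall>k\<in>R. (\<Sum>m\<in>F. M k m * x m) = c k"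
  using assms(2,1,3,4)
proof (induction F arbitrary: R M c rule: finite_induct)
  case empty
  then show ?case by simp
next
  case (insert f F)
  have "\<exists>r\<in>R. M r f \<noteq> 0"
  proof (rule ccontr)
    assume "\<not> (\<exists>r\<in>R. M r f \<noteq> 0)"
    then have "(\<Sum>m\<in>insert f F. M k m * (if m = f then 1 else 0)) = 0" if "k \<in> R" for k
      using that insert.hyps by (auto intro!: sum.neutral)
    from insert.prems(3)[OF this] show False by auto
  qed
  then obtain r where r: "r \<in> R" "M r f \<noteq> 0" by blast
  define R' where "R' = R - {r}"
  have R': "finite R'" "card R' = card F" "r \<notin> R'" "R = insert r R'"
    using insert.prems r insert.hyps by (auto simp: R'_def)
  define M' where "M' k m = M k m - M k f / M r f * M r m" for k m
  \<comment> \<open>Back substitution: the entry at f is the one that gives the pivot row the value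
    t.\<close>
  define lift where "lift t x = x(f := (t - (\<Sum>m\<in>F. M r m * x m)) / M r f)" for t x
  have lift_F: "(\<Sum>m\<in>F. M k m * lift t x m) = (\<Sum>m\<in>F. M k m * x m)" for k t x
    by (intro sum.cong) (use insert.hyps in \<open>auto simp: lift_def\<close>)
  have lift_r: "(\<Sum>m\<in>insert f F. M r m * lift t x m) = t" for t x
    using insert.hyps r(2) lift_F[of r t x] by (simp add: lift_def)
  have lift_k: "(\<Sum>m\<in>insert f F. M k m * lift t x m) = (\<Sum>m\<in>F. M' k m * x m) + M k f / M r f * t" for k t x
  proof -
    have "(\<Sum>m\<in>F. M' k m * x m) = (\<Sum>m\<in>F. M k m * x m) - M k f / M r f * (\<Sum>m\<in>F. M r m * x m)"
      by (simp add: M'_def left_diff_distrib sum_subtractf sum_distrib_left mult.assoc)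
    moreover have "(\<Sum>m\<in>insert f F. M k m * lift t x m) = M k f * lift t x f + (\<Sum>m\<in>F. M k m * x m)"
      using insert.hyps lift_F[of k t x] by simp
    moreover have "lift t x f = (t - (\<Sum>m\<in>F. M r m * x m)) / M r f" by (simp add: lift_def)
    ultimately show ?thesis using r(2) by (simp add: diff_divide_distrib right_diff_distrib)
  qed
  have inj': "\<forall>m\<in>F. x m = 0" if x: "\<And>k. k \<in> R' \<Longrightarrow> (\<Sum>m\<in>F. M' k m * x m) = 0" for x
  proof -
    have "(\<Sum>m\<in>insert f F. M k m * lift 0 x m) = 0" if "k \<in> R" for k
      using that lift_r[of 0 x] lift_k[of k 0 x] x[of k] R'(4) by auto
    from insert.prems(3)[OF this] have "\<forall>m\<in>F. lift 0 x m = 0" by simp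
    then show ?thesis using insert.hyps by (auto simp: lift_def split: if_splits)
  qed
  have "\<exists>x. \<forall>k\<in>R'. (\<Sum>m\<in>F. M' k m * x m) = c k - M k f / M r f * c r"
    by (rule insert.IH[OF R'(1,2)]) (rule inj')
  then obtain x where
    x: "\<And>k. k \<in> R' \<Longrightarrow> (\<Sum>m\<in>F. M' k m * x m) = c k - M k f / M r f * c r" by blast
  have "(\<Sum>m\<in>insert f F. M k m * lift (c r) x m) = c k" if "k \<in> R" for k
    using that lift_r[of "c r" x] lift_k[of k "c r" x] x[of k] R'(4) by auto
  then show ?case by blast
qed

section \<open>The Gram matrix of the columns and its blocks\<close>

lemma Gmat_products:
  assumes g: "control_profile g"
  shows "(\<lambda>l. cmod (Gmat g k l * Gmat g l m)) summable_on UNIV" "(\<lambda>l. Gmat g k l * Gmat g l m) summable_on UNIV"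
proof -
  obtain C where C: "0 \<le> C" "\<And>k m. cmod (Gmat g k m) * jap (k - m) ^ 2 \<le> C"
    using Gmat_decay[OF control_profile_smooth[OF g]] by blast
  have d: "cmod (Gmat g k l) \<le> C * kern (k - l)" for k l
    using C(2)[of k l] jap_pos[of "k - l"] by (simp add: kern_def field_simps)
  have "cmod (Gmat g k l * Gmat g l m) \<le> C * C * kern (l - k)" for l
  proof -
    have "cmod (Gmat g l m) \<le> C * 1"
      using mult_left_mono[OF kern_le_1[of "l - m"] C(1)] d[of l m] by linarith
    then have "cmod (Gmat g k l) * cmod (Gmat g l m) \<le> (C * kern (k - l)) * (C * 1)"
      using C(1) by (intro mult_mono d) (auto simp: kern_nonneg)
    then show ?thesis using kern_minus[of "k - l"] by (simp add: norm_mult mult_ac)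
  qed
  note bound = this
  have "(\<lambda>l. kern (l - k)) summable_on UNIV"
    by (rule summable_on_bounded_sums(1)[where B = kern_sum]) (auto simp: kern_nonneg kern_sum_finite)
  note * = summable_on_dominated[OF summable_on_cmult_right[OF this] bound]
  show "(\<lambda>l. cmod (Gmat g k l * Gmat g l m)) summable_on UNIV"
    "(\<lambda>l. Gmat g k l * Gmat g l m) summable_on UNIV"
    by (rule *)+
qed

definition Gsq :: "(real \<Rightarrow> real) \<Rightarrow> int \<Rightarrow> int \<Rightarrow> complex" where
  "Gsq g k m = (\<Sum>\<^sub>\<infinity>l. Gmat g k l * Gmat g l m)"

text \<open>Since \<open>Gmat g\<close> is hermitian, \<open>Gsq g\<close> is the Gram matrix of its columns.\<close>

lemma Gsq_gram:
  assumes g: "control_profile g" and C: "finite C"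
  shows "((\<lambda>l. of_real ((cmod (\<Sum>m\<in>C. Gmat g l m * x m))\<^sup>2)) has_sum
      (\<Sum>k\<in>C. cnj (x k) * (\<Sum>m\<in>C. Gsq g k m * x m))) UNIV"
proof -
  have "((\<lambda>l. \<Sum>k\<in>C. cnj (x k) * (\<Sum>m\<in>C. (Gmat g k l * Gmat g l m) * x m)) has_sum
      (\<Sum>k\<in>C. cnj (x k) * (\<Sum>m\<in>C. Gsq g k m * x m))) UNIV"
    unfolding Gsq_def
    by (intro has_sum_sum' has_sum_cmult_right has_sum_cmult_left has_sum_infsum Gmat_products[OF g])
  also have "(\<lambda>l. \<Sum>k\<in>C. cnj (x k) * (\<Sum>m\<in>C. (Gmat g k l * Gmat g l m) * x m))
      = (\<lambda>l. of_real ((cmod (\<Sum>m\<in>C. Gmat g l m * x m))\<^sup>2))"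
  proof
    fix l
    let ?Z = "\<Sum>k\<in>C. Gmat g l k * x k"
    have "cnj ?Z = (\<Sum>k\<in>C. cnj (x k) * Gmat g k l)"
      by (simp add: Gmat_hermitian mult.commute)
    then have "of_real ((cmod ?Z)\<^sup>2) = (\<Sum>k\<in>C. cnj (x k) * Gmat g k l) * ?Z"
      unfolding complex_norm_square by (simp only: mult.commute)
    also have "\<dots> = (\<Sum>k\<in>C. \<Sum>m\<in>C. (cnj (x k) * Gmat g k l) * (Gmat g l m * x m))"
      by (rule sum_product)
    finally show "(\<Sum>k\<in>C. cnj (x k) * (\<Sum>m\<in>C. (Gmat g k l * Gmat g l m) * x m)) = of_real ((cmod ?Z)\<^sup>2)"
      by (simp only: sum_distrib_left mult.assoc)
  qed
  finally show ?thesis .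
qed

text \<open>Pairing the equations with x turns them into the vanishing of a sum of squares over all
  l. So \<Gamma> x vanishes in every row and not only in the rows of C, as
  \<open>Gmat_injective\<close> requires.\<close>

lemma Gsq_injective:
  assumes g: "control_profile g" and C: "finite C" "0 \<notin> C"
    and zero: "\<And>k. k \<in> C \<Longrightarrow> (\<Sum>m\<in>C. Gsq g k m * x m) = 0"
  shows "\<forall>m\<in>C. x m = 0"
proof -
  let ?z = "\<lambda>l. \<Sum>m\<in>C. Gmat g l m * x m"
  have "((\<lambda>l. of_real ((cmod (?z l))\<^sup>2) :: complex) has_sum 0) UNIV"
    using Gsq_gram[OF g C(1), of x] zero by simp
  from has_sum_Re[OF this] have hs: "((\<lambda>l. (cmod (?z l))\<^sup>2) has_sum 0) UNIV" by simp
  have "?z l = 0" for l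
    using nonneg_has_sum_le_0D[OF hs, of l] by simp
  then show ?thesis using Gmat_injective[OF g C] by blast
qed

lemma Gsq_diag_lower:
  assumes g: "control_profile g"
  shows "(cmod (Gmat g k k))\<^sup>2 \<le> cmod (Gsq g k k)"
proof -
  have "((\<lambda>l. of_real ((cmod (Gmat g l k))\<^sup>2) :: complex) has_sum Gsq g k k) UNIV"
    using Gsq_gram[OF g, of "{k}" "\<lambda>_. 1"] by simp
  from has_sum_Re[OF this] have "((\<lambda>l. (cmod (Gmat g l k))\<^sup>2) has_sum Re (Gsq g k k)) UNIV" by simp
  from finite_sum_le_has_sum[OF this, of "{k}"] have "(cmod (Gmat g k k))\<^sup>2 \<le> Re (Gsq g k k)" by simp
  also have "\<dots> \<le> cmod (Gsq g k k)" by (rule complex_Re_le_cmod)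
  finally show ?thesis .
qed

text \<open>The diagonal entry is 1 / (2 pi) - 2 pi |f k|^2, and |f k| is at most B / |k|. For |k|
  \<ge> 8 pi^2 B^2 the second term takes at most half of the first.\<close>

lemma Gmat_diag_lower:
  assumes g: "control_profile g"
  obtains K :: int where "\<And>k. K \<le> \<bar>k\<bar> \<Longrightarrow> 1 / (4 * pi) \<le> cmod (Gmat g k k)"
proof -
  let ?f = "fcoef (\<lambda>x. complex_of_real (g x))"
  obtain B where B: "0 \<le> B" "\<And>k. jap k ^ 1 * cmod (?f k) \<le> B"
    using fcoef_rapid_decay[OF control_profile_smooth[OF g]] by blast
  define K where "K = \<lceil>8 * pi\<^sup>2 * B\<^sup>2\<rceil>"
  have "1 / (4 * pi) \<le> cmod (Gmat g k k)" if "K \<le> \<bar>k\<bar>" for k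
  proof -
    have "8 * pi\<^sup>2 * B\<^sup>2 \<le> of_int \<bar>k\<bar>" using that unfolding K_def by linarith
    also have "\<dots> \<le> jap k" by (simp add: jap_def)
    also have "\<dots> \<le> jap k * jap k" using jap_ge_1[of k] by simp
    finally have k: "8 * pi\<^sup>2 * B\<^sup>2 \<le> (jap k)\<^sup>2" by (simp add: power2_eq_square)
    have "cmod (?f k) * cmod (?f (- k)) * (jap k)\<^sup>2 = (jap k * cmod (?f k)) * (jap (- k) * cmod (?f (- k)))"
      by (simp add: jap_minus power2_eq_square)
    also have "\<dots> \<le> B * B"
      using B(2)[of k] B(2)[of "- k"] B(1) by (intro mult_mono) (auto simp: jap_nonneg)
    finally have "8 * pi\<^sup>2 * (cmod (?f k) * cmod (?f (- k)) * (jap k)\<^sup>2) \<le> 8 * pi\<^sup>2 * (B * B)"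
      by (rule mult_left_mono) simp
    also have "\<dots> \<le> (jap k)\<^sup>2" using k by (simp add: power2_eq_square)
    finally have "(8 * pi\<^sup>2 * (cmod (?f k) * cmod (?f (- k)))) * (jap k)\<^sup>2 \<le> 1 * (jap k)\<^sup>2" by (simp add: mult_ac)
    then have "8 * pi\<^sup>2 * (cmod (?f k) * cmod (?f (- k))) \<le> 1"
      using jap_pos[of k] by simp
    then have 1: "2 * pi * cmod (?f k) * cmod (?f (- k)) \<le> 1 / (4 * pi)"
      by (simp add: field_simps power2_eq_square)
    have f0: "?f 0 = of_real (1 / (2 * pi))"
      using control_profile_fcoef_0[OF g] by (simp add: field_simps)
    have "cmod (?f 0) \<le> cmod (Gmat g k k) + cmod (2 * of_real pi * ?f k * ?f (- k))"
      using norm_triangle_ineq[of "Gmat g k k" "2 * of_real pi * ?f k * ?f (- k)"] by (simp add: Gmat_def Let_def)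
    moreover have "cmod (?f 0) = 1 / (2 * pi)" unfolding f0 by (simp add: norm_divide)
    moreover have "1 / (2 * pi) = 1 / (4 * pi) + 1 / (4 * pi)" by (simp add: field_simps)
    moreover have "cmod (2 * of_real pi * ?f k * ?f (- k)) = 2 * pi * cmod (?f k) * cmod (?f (- k))"
      by (simp add: norm_mult)
    ultimately show ?thesis using 1 by linarith
  qed
  then show ?thesis using that by blast
qed

text \<open>For all but finitely many indices the block is \<open>1 \<times> 1\<close> and bounded below, so only one finite
  matrix has to be inverted.\<close>

lemma solve_blocks:
  assumes g: "control_profile g"
    and fin: "\<And>k. finite (eig_class a k)"
    and simple: "\<And>k. K1 \<le> \<bar>k\<bar> \<Longrightarrow> card (eig_class a k) = 1"
  obtains B F where "0 \<le> B" "finite F"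
    "\<And>c. c 0 = 0 \<Longrightarrow> \<exists>h. (\<forall>k. (\<Sum>m\<in>eig_class a k. Gsq g k m * h m) = c k) \<and>
       (\<forall>k. cmod (h k) \<le> B * (cmod (c k) + (if k \<in> F then \<Sum>l\<in>F. cmod (c l) else 0)))"
proof -
  obtain K2 where K2: "\<And>k. K2 \<le> \<bar>k\<bar> \<Longrightarrow> 1 / (4 * pi) \<le> cmod (Gmat g k k)"
    using Gmat_diag_lower[OF g] by blast
  define K where "K = max 1 (max K1 K2)"
  \<comment> \<open>The index 0 is left out because its column vanishes, so a block containing it
    would be singular.\<close>
  define F where "F = {k. \<bar>k\<bar> < K \<and> k \<noteq> 0}"
  have "F \<subseteq> {- K..K}" by (auto simp: F_def)
  then have F: "finite F" "0 \<notin> F" by (auto simp: F_def finite_subset)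
  have self: "k \<in> eig_class a k" for k by (simp add: eig_class_def)
  have sym: "m \<in> eig_class a k \<longleftrightarrow> k \<in> eig_class a m" for k m by (auto simp: eig_class_def)
  have out: "eig_class a k = {k}" if "K \<le> \<bar>k\<bar>" for k
    using simple[of k] that self[of k] by (auto simp: K_def card_1_singleton_iff)
  \<comment> \<open>An index of size at least K is alone in its class, so the class of a small index
    consists of small indices and possibly 0.\<close>
  have inF: "eig_class a k \<subseteq> insert 0 F" if "k \<in> F" for k
  proof
    fix m assume m: "m \<in> eig_class a k"
    show "m \<in> insert 0 F"
    proof (rule ccontr)
      assume "m \<notin> insert 0 F"
      then have "K \<le> \<bar>m\<bar>" by (auto simp: F_def)
      then have "k = m" using out[of m] m sym by blast
      then show False using that \<open>m \<notin> insert 0 F\<close> by simp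
    qed
  qed
  define M where "M k m = (if m \<in> eig_class a k then Gsq g k m else 0)" for k m
  have M_sum: "(\<Sum>m\<in>F. M k m * x m) = (\<Sum>m\<in>F \<inter> eig_class a k. Gsq g k m * x m)" for k x
    unfolding sum.inter_restrict[OF F(1)] by (intro sum.cong) (auto simp: M_def)
  have inj: "\<forall>m\<in>F. x m = 0" if x: "\<And>k. k \<in> F \<Longrightarrow> (\<Sum>m\<in>F. M k m * x m) = 0" for x
  proof
    fix k0 assume k0: "k0 \<in> F"
    let ?C = "F \<inter> eig_class a k0"
    have "(\<Sum>m\<in>?C. Gsq g k m * x m) = 0" if "k \<in> ?C" for k
    proof -
      have "eig_class a k = eig_class a k0" using that by (auto simp: eig_class_def)
      then show ?thesis using x[of k] that by (simp add: M_sum)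
    qed
    from Gsq_injective[OF g _ _ this] F have "\<forall>m\<in>?C. x m = 0" by auto
    then show "x k0 = 0" using k0 self by auto
  qed
  have "\<exists>x. \<forall>k\<in>F. (\<Sum>m\<in>F. M k m * x m) = (if k = l then 1 else 0)" for l
    by (rule injective_imp_solvable[OF F(1) F(1) refl inj])
  then obtain N where N: "\<And>k l. k \<in> F \<Longrightarrow> (\<Sum>m\<in>F. M k m * N l m) = (if k = l then 1 else 0)" by metis
  \<comment> \<open>The first summand bounds the inverse of the scalar blocks outside F, the second
    every entry of the inverse of the finite matrix.\<close>
  define B where "B = 16 * pi\<^sup>2 + (\<Sum>l\<in>F. \<Sum>m\<in>F. cmod (N l m))"
  have B0: "0 \<le> (\<Sum>l\<in>F. \<Sum>m\<in>F. cmod (N l m))" by (intro sum_nonneg) auto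
  have NB: "cmod (N l m) \<le> B" if "l \<in> F" "m \<in> F" for l m
  proof -
    have "cmod (N l m) \<le> (\<Sum>m\<in>F. cmod (N l m))"
      using that F by (intro member_le_sum) auto
    also have "\<dots> \<le> (\<Sum>l\<in>F. \<Sum>m\<in>F. cmod (N l m))"
      using that F by (intro member_le_sum[of l F "\<lambda>l. \<Sum>m\<in>F. cmod (N l m)"]) (auto intro: sum_nonneg)
    also have "\<dots> \<le> B" by (simp add: B_def)
    finally show ?thesis .
  qed
  have diag: "1 / (16 * pi\<^sup>2) \<le> cmod (Gsq g k k)" if "K \<le> \<bar>k\<bar>" for k
  proof -
    have "(1 / (4 * pi))\<^sup>2 \<le> (cmod (Gmat g k k))\<^sup>2"
      using K2[of k] that by (intro power_mono) (auto simp: K_def)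
    also have "\<dots> \<le> cmod (Gsq g k k)" by (rule Gsq_diag_lower[OF g])
    finally show ?thesis by (simp add: power_divide power_mult_distrib)
  qed
  show ?thesis
  proof (rule that[of B F])
    show "0 \<le> B" using B0 by (simp add: B_def)
    show "finite F" by (rule F)
    fix c :: "int \<Rightarrow> complex" assume c0: "c 0 = 0"
    \<comment> \<open>The value at 0 is free and set to 0; row 0 of \<open>Gsq g\<close> vanishes,
      so the equation at 0 is just \<open>c 0 = 0\<close>.\<close>
    define h where "h k = (if k = 0 then 0 else if k \<in> F then \<Sum>l\<in>F. N l k * c l else c k / Gsq g k k)" for k
    have "(\<Sum>m\<in>eig_class a k. Gsq g k m * h m) = c k" for k
    proof -
      consider "k = 0" | "k \<in> F" | "K \<le> \<bar>k\<bar>" "k \<noteq> 0" by (force simp: F_def)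
      then show ?thesis
      proof cases
        case 1
        then show ?thesis using c0 by (simp add: Gsq_def Gmat_0_left[OF g])
      next
        case 2
        have "(\<Sum>m\<in>eig_class a k. Gsq g k m * h m) = (\<Sum>m\<in>F \<inter> eig_class a k. Gsq g k m * h m)"
          by (rule sum.mono_neutral_right[OF fin]) (use inF[OF 2] in \<open>auto simp: h_def\<close>)
        also have "\<dots> = (\<Sum>m\<in>F. M k m * (\<Sum>l\<in>F. N l m * c l))"
          unfolding M_sum by (intro sum.cong) (use F in \<open>auto simp: h_def\<close>)
        also have "\<dots> = (\<Sum>l\<in>F. (\<Sum>m\<in>F. M k m * N l m) * c l)"
          unfolding sum_distrib_left sum_distrib_right by (subst sum.swap) (simp only: mult.assoc)
        also have "\<dots> = (\<Sum>l\<in>F. (if k = l then c l else 0))"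
          by (intro sum.cong) (auto simp: N[OF 2])
        also have "\<dots> = c k" using 2 F by simp
        finally show ?thesis .
      next
        case 3
        have "0 < 1 / (16 * pi\<^sup>2)" by simp
        then have "Gsq g k k \<noteq> 0" using diag[OF 3(1)] by auto
        then show ?thesis using 3 by (simp add: out h_def F_def)
      qed
    qed
    moreover have "cmod (h k) \<le> B * (cmod (c k) + (if k \<in> F then \<Sum>l\<in>F. cmod (c l) else 0))" for k
    proof -
      consider "k = 0" | "k \<in> F" | "K \<le> \<bar>k\<bar>" "k \<noteq> 0" by (force simp: F_def)
      then show ?thesis
      proof cases
        case 1
        then show ?thesis using \<open>0 \<le> B\<close> F by (simp add: h_def c0)
      next
        case 2
        have "cmod (h k) \<le> (\<Sum>l\<in>F. cmod (N l k * c l))"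
          using 2 F by (auto simp: h_def intro: norm_sum)
        also have "\<dots> \<le> (\<Sum>l\<in>F. B * cmod (c l))"
          using 2 by (intro sum_mono) (auto simp: norm_mult intro!: mult_right_mono NB)
        also have "\<dots> \<le> B * (cmod (c k) + (\<Sum>l\<in>F. cmod (c l)))"
          using \<open>0 \<le> B\<close> by (simp add: sum_distrib_left distrib_left)
        finally show ?thesis using 2 by simp
      next
        case 3
        have p: "0 < 1 / (16 * pi\<^sup>2)" by simp
        have pos: "0 < cmod (Gsq g k k)" using p diag[OF 3(1)] by linarith
        have "cmod (h k) = cmod (c k) / cmod (Gsq g k k)" using 3 by (simp add: h_def F_def norm_divide)
        also have "\<dots> \<le> cmod (c k) / (1 / (16 * pi\<^sup>2))"
          by (intro divide_left_mono diag 3 mult_pos_pos p pos norm_ge_zero)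
        also have "\<dots> = 16 * pi\<^sup>2 * cmod (c k)" by simp
        also have "\<dots> \<le> B * cmod (c k)"
          by (intro mult_right_mono) (use B0 in \<open>auto simp: B_def\<close>)
        finally show ?thesis using 3 by (simp add: F_def)
      qed
    qed
    ultimately show "\<exists>h. (\<forall>k. (\<Sum>m\<in>eig_class a k. Gsq g k m * h m) = c k) \<and>
       (\<forall>k. cmod (h k) \<le> B * (cmod (c k) + (if k \<in> F then \<Sum>l\<in>F. cmod (c l) else 0)))"
      by blast
  qed
qed

section \<open>Bounded biorthogonal families of exponentials\<close>

text \<open>Functions on [0, T] are extended by zero to the whole line, so that translation needs no
  change of domain. The bound M is explicit because it has to be uniform over families of such
  functions.\<close>

definition bsupp :: "real \<Rightarrow> real \<Rightarrow> (real \<Rightarrow> complex) \<Rightarrow> bool" where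
  "bsupp T M q \<longleftrightarrow> q \<in> borel_measurable borel \<and> (\<forall>t. cmod (q t) \<le> M) \<and> (\<forall>t. t \<notin> {0..T} \<longrightarrow> q t = 0)"

definition moment :: "(real \<Rightarrow> complex) \<Rightarrow> real \<Rightarrow> complex" where
  "moment q \<xi> = (LINT t|lborel. q t * cis (- (\<xi> * t)))"

lemma bsupp_nonneg: "bsupp T M q \<Longrightarrow> 0 \<le> M"
  unfolding bsupp_def using norm_ge_zero order_trans by blast

lemma bsupp_mono: "bsupp T M q \<Longrightarrow> T \<le> T' \<Longrightarrow> M \<le> M' \<Longrightarrow> bsupp T' M' q"
  unfolding bsupp_def by (auto intro: order_trans)

lemma cis_measurable [measurable]: "(\<lambda>t. cis (c * t)) \<in> borel_measurable borel"
  by (intro borel_measurable_continuous_onI continuous_intros)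

lemma cis_measurable_minus [measurable]: "(\<lambda>t. cis (- (c * t))) \<in> borel_measurable borel"
  by (intro borel_measurable_continuous_onI continuous_intros)

lemma integrable_indicator_Icc: "integrable lborel (\<lambda>t::real. M * indicator {0..T} t :: real)"
  by (intro integrable_mult_right integrable_real_indicator) (auto simp: emeasure_lborel_Icc_eq)

lemma bsupp_bound: "bsupp T M q \<Longrightarrow> cmod (q t) \<le> M * indicator {0..T} t"
  by (cases "t \<in> {0..T}") (auto simp: bsupp_def)

lemma bsupp_integrable:
  assumes "bsupp T M q"
  shows "integrable lborel (\<lambda>t. q t * cis (- (\<xi> * t)))"
proof (rule Bochner_Integration.integrable_bound[OF integrable_indicator_Icc[of M T]])
  have [measurable]: "q \<in> borel_measurable borel" using assms by (simp add: bsupp_def)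
  show "(\<lambda>t. q t * cis (- (\<xi> * t))) \<in> borel_measurable lborel" by measurable
  show "AE t in lborel. norm (q t * cis (- (\<xi> * t))) \<le> norm (M * indicator {0..T} t)"
    using bsupp_bound[OF assms] bsupp_nonneg[OF assms] by (auto simp: norm_mult)
qed

lemma moment_bound:
  assumes "bsupp T M q" "0 \<le> T"
  shows "cmod (moment q \<xi>) \<le> M * T"
proof -
  have "cmod (moment q \<xi>) \<le> (LINT t|lborel. norm (q t * cis (- (\<xi> * t))))"
    unfolding moment_def by (rule integral_norm_bound)
  also have "\<dots> \<le> (LINT t|lborel. M * indicator {0..T} t)"
    using bsupp_bound[OF assms(1)]
    by (intro integral_mono integrable_norm bsupp_integrable[OF assms(1)] integrable_indicator_Icc)
       (simp add: norm_mult)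
  finally show ?thesis using assms(2) by simp
qed

lemma moment_shift: "moment (\<lambda>t. q (t - e)) \<xi> = cis (- (\<xi> * e)) * moment q \<xi>"
proof -
  have "cis (- (\<xi> * (e + 1 * t))) = cis (- (\<xi> * e)) * cis (- (\<xi> * t))" for t
    by (simp add: cis_mult algebra_simps)
  then have "moment (\<lambda>t. q (t - e)) \<xi> = (LINT t|lborel. cis (- (\<xi> * e)) * (q t * cis (- (\<xi> * t))))"
    unfolding moment_def
    by (subst lborel_integral_real_affine[where c = 1 and t = e]) (auto simp: mult_ac)
  then show ?thesis by (simp add: moment_def)
qed

lemma moment_diff:
  "bsupp T M q \<Longrightarrow> bsupp T' M' p \<Longrightarrow> moment (\<lambda>t. q t - p t) \<xi> = moment q \<xi> - moment p \<xi>"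
  unfolding moment_def left_diff_distrib
  by (rule Bochner_Integration.integral_diff) (auto intro: bsupp_integrable)

lemma moment_cmult: "moment (\<lambda>t. c * q t) \<xi> = c * moment q \<xi>"
  by (simp add: moment_def mult.assoc)

lemma moment_modulate: "moment (\<lambda>t. q t * cis (\<mu> * t)) \<xi> = moment q (\<xi> - \<mu>)"
  unfolding moment_def by (simp add: mult.assoc cis_mult algebra_simps)

text \<open>An l^1 combination of uniformly bounded functions converges absolutely at every time and
  may be integrated termwise. Nothing is asked of q k where c k = 0, since families are controlled
  on a set of frequencies only.\<close>

lemma moment_infsum:
  fixes c :: "int \<Rightarrow> complex"
  assumes q: "\<And>k. c k \<noteq> 0 \<Longrightarrow> bsupp T M (q k)" and c: "(\<lambda>k. cmod (c k)) summable_on UNIV" and M: "0 \<le> M"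
  shows "bsupp T ((\<Sum>\<^sub>\<infinity>k. cmod (c k)) * M) (\<lambda>t. \<Sum>\<^sub>\<infinity>k. c k * q k t)"
    and "moment (\<lambda>t. \<Sum>\<^sub>\<infinity>k. c k * q k t) \<xi> = (\<Sum>\<^sub>\<infinity>k. c k * moment (q k) \<xi>)"
proof -
  have b: "cmod (c k * q k t) \<le> cmod (c k) * (M * indicator {0..T} t)" for k t
    using bsupp_bound[OF q[of k], of t] by (cases "c k = 0") (auto simp: norm_mult intro: mult_left_mono)
  have m: "(\<lambda>t. c k * q k t) \<in> borel_measurable borel" for k
    using q[of k] by (cases "c k = 0") (auto simp: bsupp_def)
  note s = summable_on_dominated[OF summable_on_cmult_left[OF c] b]
  show "bsupp T ((\<Sum>\<^sub>\<infinity>k. cmod (c k)) * M) (\<lambda>t. \<Sum>\<^sub>\<infinity>k. c k * q k t)"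
    unfolding bsupp_def
  proof (intro conjI allI impI)
    show "(\<lambda>t. \<Sum>\<^sub>\<infinity>k. c k * q k t) \<in> borel_measurable borel"
      by (rule borel_measurable_infsum_int[OF m s(2)])
    show "cmod (\<Sum>\<^sub>\<infinity>k. c k * q k t) \<le> (\<Sum>\<^sub>\<infinity>k. cmod (c k)) * M" for t
    proof -
      have "cmod (\<Sum>\<^sub>\<infinity>k. c k * q k t) \<le> (\<Sum>\<^sub>\<infinity>k. cmod (c k) * (M * indicator {0..T} t))"
        by (rule s(3))
      also have "\<dots> = (\<Sum>\<^sub>\<infinity>k. cmod (c k)) * (M * indicator {0..T} t)" by (rule infsum_cmult_left')
      also have "\<dots> \<le> (\<Sum>\<^sub>\<infinity>k. cmod (c k)) * M"
        using M by (intro mult_left_mono infsum_nonneg) (auto split: split_indicator)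
      finally show ?thesis .
    qed
    show "(\<Sum>\<^sub>\<infinity>k. c k * q k t) = 0" if "t \<notin> {0..T}" for t
    proof (rule infsum_0)
      show "c k * q k t = 0" for k using b[of k t] that by simp
    qed
  qed
  have "moment (\<lambda>t. \<Sum>\<^sub>\<infinity>k. c k * q k t) \<xi> = (LINT t|lborel. (\<Sum>\<^sub>\<infinity>k. (c k * q k t) * cis (- (\<xi> * t))))"
    unfolding moment_def infsum_cmult_left' ..
  also have "\<dots> = (\<Sum>\<^sub>\<infinity>k. LINT t|lborel. (c k * q k t) * cis (- (\<xi> * t)))"
  proof (rule integral_infsum_int(2)[OF _ _ integrable_indicator_Icc[of M T] c])
    show "(\<lambda>t. (c k * q k t) * cis (- (\<xi> * t))) \<in> borel_measurable lborel" for k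
      using m[of k] by measurable
    show "norm ((c k * q k t) * cis (- (\<xi> * t))) \<le> cmod (c k) * (M * indicator {0..T} t)" for k t
      using b[of k t] by (simp add: norm_mult)
  qed simp
  also have "\<dots> = (\<Sum>\<^sub>\<infinity>k. c k * moment (q k) \<xi>)" by (simp add: moment_def mult.assoc)
  finally show "moment (\<lambda>t. \<Sum>\<^sub>\<infinity>k. c k * q k t) \<xi> = (\<Sum>\<^sub>\<infinity>k. c k * moment (q k) \<xi>)" .
qed

text \<open>Ingham's kernel, normalised to have integral 1.\<close>

definition ingham :: "real \<Rightarrow> real \<Rightarrow> complex" where
  "ingham \<alpha> t = indicator {0..pi / \<alpha>} t *\<^sub>R of_real (\<alpha> / 2 * sin (\<alpha> * t))"

lemma ingham_bsupp:
  assumes "\<alpha> > 0"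
  shows "bsupp (pi / \<alpha>) (\<alpha> / 2) (ingham \<alpha>)"
  unfolding bsupp_def
proof (intro conjI allI impI)
  show "ingham \<alpha> \<in> borel_measurable borel" unfolding ingham_def[abs_def] by measurable
  show "cmod (ingham \<alpha> t) \<le> \<alpha> / 2" for t
  proof -
    have "\<bar>\<alpha> / 2 * sin (\<alpha> * t)\<bar> \<le> \<alpha> / 2 * 1"
      unfolding abs_mult using assms by (intro mult_mono) auto
    then show ?thesis using assms by (auto simp: ingham_def norm_mult split: split_indicator)
  qed
qed (simp add: ingham_def)

lemma ingham_modulated_bsupp:
  assumes "\<alpha> > 0"
  shows "bsupp (pi / \<alpha>) (\<alpha> / 2) (\<lambda>t. ingham \<alpha> t * cis (\<mu> * t))"
  using ingham_bsupp[OF assms] unfolding bsupp_def by (auto simp: norm_mult)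

lemma ingham_moment:
  assumes a: "\<alpha> > 0" and x: "\<xi>\<^sup>2 \<noteq> \<alpha>\<^sup>2"
  shows "moment (ingham \<alpha>) \<xi> = of_real (\<alpha>\<^sup>2 / (2 * (\<alpha>\<^sup>2 - \<xi>\<^sup>2))) * (1 + cis (- (\<xi> * (pi / \<alpha>))))"
proof -
  define D where "D = \<alpha>\<^sup>2 - \<xi>\<^sup>2"
  have D: "D \<noteq> 0" using x by (simp add: D_def)
  \<comment> \<open>An explicit antiderivative of the integrand. At both endpoints the sine vanishes
    and only the cosine terms survive, with values - 1 and 1; this produces the factor
    \<open>1 + cis (- (\<xi> * (pi / \<alpha>)))\<close>.\<close>
  define F where "F t = cis (- (\<xi> * t)) * (of_real (\<alpha> / (2 * D)) * (- (\<i> * of_real \<xi>) * of_real (sin (\<alpha> * t)) - of_real (\<alpha> * cos (\<alpha> * t))))" for t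
  have c: "((\<lambda>t. cis (- (\<xi> * t))) has_vector_derivative - (\<i> * of_real \<xi>) * cis (- (\<xi> * t))) (at t within S)" for t S
  proof -
    have "((\<lambda>z. exp (- (\<i> * of_real \<xi>) * z)) has_field_derivative - (\<i> * of_real \<xi>) * exp (- (\<i> * of_real \<xi>) * of_real t)) (at (of_real t))"
      by (auto intro!: derivative_eq_intros)
    from has_vector_derivative_real_field[OF this] show ?thesis
      by (simp add: cis_conv_exp mult.assoc has_vector_derivative_at_within)
  qed
  have s: "((\<lambda>t. complex_of_real (sin (\<alpha> * t))) has_vector_derivative of_real (\<alpha> * cos (\<alpha> * t))) (at t within S)" for t S
  proof -
    have "((\<lambda>t. sin (\<alpha> * t)) has_real_derivative \<alpha> * cos (\<alpha> * t)) (at t within S)"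
      by (auto intro!: derivative_eq_intros)
    then show ?thesis
      by (intro has_vector_derivative_of_real) (simp add: has_real_derivative_iff_has_vector_derivative)
  qed
  have co: "((\<lambda>t. complex_of_real (\<alpha> * cos (\<alpha> * t))) has_vector_derivative of_real (- (\<alpha>\<^sup>2 * sin (\<alpha> * t)))) (at t within S)" for t S
  proof -
    have "((\<lambda>t. \<alpha> * cos (\<alpha> * t)) has_real_derivative - (\<alpha>\<^sup>2 * sin (\<alpha> * t))) (at t within S)"
      by (auto intro!: derivative_eq_intros simp: power2_eq_square)
    then show ?thesis
      by (intro has_vector_derivative_of_real) (simp add: has_real_derivative_iff_has_vector_derivative)
  qed
  have alg: "c * (K * (- (\<i> * x) * (a * C) - (- (a\<^sup>2 * S)))) + (- (\<i> * x) * c) * (K * (- (\<i> * x) * S - a * C))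
      = (K * (a\<^sup>2 - x\<^sup>2) * S) * c" for c K S C a x :: complex
    by (simp add: algebra_simps power2_eq_square)
  have "(F has_vector_derivative of_real (\<alpha> / 2 * sin (\<alpha> * t)) * cis (- (\<xi> * t))) (at t within S)" for t S
  proof -
    have "(F has_vector_derivative
        cis (- (\<xi> * t)) * (of_real (\<alpha> / (2 * D)) * (- (\<i> * of_real \<xi>) * of_real (\<alpha> * cos (\<alpha> * t)) - of_real (- (\<alpha>\<^sup>2 * sin (\<alpha> * t))))) +
        (- (\<i> * of_real \<xi>) * cis (- (\<xi> * t))) * (of_real (\<alpha> / (2 * D)) * (- (\<i> * of_real \<xi>) * of_real (sin (\<alpha> * t)) - of_real (\<alpha> * cos (\<alpha> * t))))) (at t within S)"
      unfolding F_def[abs_def]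
      by (intro has_vector_derivative_mult has_vector_derivative_mult_right has_vector_derivative_diff c s co)
    also have "cis (- (\<xi> * t)) * (of_real (\<alpha> / (2 * D)) * (- (\<i> * of_real \<xi>) * of_real (\<alpha> * cos (\<alpha> * t)) - of_real (- (\<alpha>\<^sup>2 * sin (\<alpha> * t))))) +
        (- (\<i> * of_real \<xi>) * cis (- (\<xi> * t))) * (of_real (\<alpha> / (2 * D)) * (- (\<i> * of_real \<xi>) * of_real (sin (\<alpha> * t)) - of_real (\<alpha> * cos (\<alpha> * t))))
      = (of_real (\<alpha> / (2 * D)) * of_real D * of_real (sin (\<alpha> * t))) * cis (- (\<xi> * t))"
      using alg[of "cis (- (\<xi> * t))" "of_real (\<alpha> / (2 * D))" "of_real \<xi>" "of_real \<alpha>" "of_real (cos (\<alpha> * t))" "of_real (sin (\<alpha> * t))"]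
      by (simp only: D_def of_real_mult of_real_minus of_real_diff of_real_power)
    also have "of_real (\<alpha> / (2 * D)) * of_real D * of_real (sin (\<alpha> * t)) = complex_of_real (\<alpha> / 2 * sin (\<alpha> * t))"
      using D by simp
    finally show ?thesis .
  qed
  then have "has_bochner_integral lborel
      (\<lambda>t. indicator {0..pi / \<alpha>} t *\<^sub>R (of_real (\<alpha> / 2 * sin (\<alpha> * t)) * cis (- (\<xi> * t)))) (F (pi / \<alpha>) - F 0)"
    using a by (intro has_bochner_integral_FTC_Icc) (auto intro!: continuous_intros)
  then have "moment (ingham \<alpha>) \<xi> = F (pi / \<alpha>) - F 0"
    unfolding moment_def ingham_def by (simp add: has_bochner_integral_integral_eq)
  also have "F (pi / \<alpha>) = cis (- (\<xi> * (pi / \<alpha>))) * of_real (\<alpha>\<^sup>2 / (2 * D))"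
    using a by (simp add: F_def power2_eq_square)
  also have "F 0 = - of_real (\<alpha>\<^sup>2 / (2 * D))"
    by (simp add: F_def power2_eq_square)
  finally have m: "moment (ingham \<alpha>) \<xi> = cis (- (\<xi> * (pi / \<alpha>))) * of_real (\<alpha>\<^sup>2 / (2 * D)) - (- of_real (\<alpha>\<^sup>2 / (2 * D)))" .
  have "c * K - (- K) = K * (1 + c)" for c K :: complex by (simp add: algebra_simps)
  then show ?thesis unfolding m D_def by blast
qed

lemma ingham_moment_0: "\<alpha> > 0 \<Longrightarrow> moment (ingham \<alpha>) 0 = 1"
  using ingham_moment[of \<alpha> 0] by simp

text \<open>The half wave of the sine vanishes at both ends of its support, so its transform decays
  quadratically and is summable over separated frequencies.\<close>

lemma ingham_moment_decay:
  assumes a: "\<alpha> > 0" and x: "\<alpha> < \<bar>\<xi>\<bar>"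
  shows "cmod (moment (ingham \<alpha>) \<xi>) \<le> \<alpha>\<^sup>2 / (\<xi>\<^sup>2 - \<alpha>\<^sup>2)"
proof -
  have D: "\<alpha>\<^sup>2 < \<xi>\<^sup>2" using power_strict_mono[OF x, of 2] a by simp
  have "cmod (1 + cis (- (\<xi> * (pi / \<alpha>)))) \<le> 2"
    using norm_triangle_ineq[of 1 "cis (- (\<xi> * (pi / \<alpha>)))"] by simp
  moreover have "cmod (moment (ingham \<alpha>) \<xi>) = \<bar>\<alpha>\<^sup>2 / (2 * (\<alpha>\<^sup>2 - \<xi>\<^sup>2))\<bar> * cmod (1 + cis (- (\<xi> * (pi / \<alpha>))))"
    using D unfolding ingham_moment[OF a less_imp_neq[OF D, symmetric]] norm_mult norm_of_real by simp
  ultimately have "cmod (moment (ingham \<alpha>) \<xi>) \<le> \<bar>\<alpha>\<^sup>2 / (2 * (\<alpha>\<^sup>2 - \<xi>\<^sup>2))\<bar> * 2"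
    by (simp only: mult_left_mono abs_ge_zero)
  also have "\<bar>\<alpha>\<^sup>2 / (2 * (\<alpha>\<^sup>2 - \<xi>\<^sup>2))\<bar> * 2 = \<alpha>\<^sup>2 / (\<xi>\<^sup>2 - \<alpha>\<^sup>2)"
    using D by (simp add: abs_divide abs_mult field_simps)
  finally show ?thesis .
qed

text \<open>A cruder bound valid for all \<xi>, also near \<xi> = \<alpha> and \<xi> = - \<alpha>
  where \<open>ingham_moment\<close> has a vanishing denominator. Below 2 \<alpha> it is the trivial
  bound pi / 2 \<le> 2, from 2 \<alpha> on the quadratic decay.\<close>

lemma ingham_moment_quadratic:
  assumes a: "\<alpha> > 0"
  shows "cmod (moment (ingham \<alpha>) \<xi>) \<le> 2 * (1 + 4 * \<alpha>\<^sup>2) * (1 / (1 + \<xi>\<^sup>2))"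
proof -
  have p: "0 < 1 + \<xi>\<^sup>2" by (simp add: add_pos_nonneg)
  have "cmod (moment (ingham \<alpha>) \<xi>) * (1 + \<xi>\<^sup>2) \<le> 2 * (1 + 4 * \<alpha>\<^sup>2)"
  proof (cases "2 * \<alpha> \<le> \<bar>\<xi>\<bar>")
    case True
    then have "(2 * \<alpha>)\<^sup>2 \<le> \<xi>\<^sup>2" using a abs_le_square_iff[of "2 * \<alpha>" \<xi>] by simp
    then have D: "4 * \<alpha>\<^sup>2 \<le> \<xi>\<^sup>2" by (simp add: power_mult_distrib)
    have a2: "0 < \<alpha>\<^sup>2" using a by simp
    have "cmod (moment (ingham \<alpha>) \<xi>) * (1 + \<xi>\<^sup>2) \<le> \<alpha>\<^sup>2 / (\<xi>\<^sup>2 - \<alpha>\<^sup>2) * (1 + \<xi>\<^sup>2)"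
      using True a p by (intro mult_right_mono ingham_moment_decay) auto
    also have "\<dots> \<le> 2 * (1 + 4 * \<alpha>\<^sup>2)"
    proof -
      have "\<alpha>\<^sup>2 * (1 + \<xi>\<^sup>2) \<le> 2 * (1 + 4 * \<alpha>\<^sup>2) * (\<xi>\<^sup>2 - \<alpha>\<^sup>2)"
      proof -
        have "\<alpha>\<^sup>2 * (4 * \<alpha>\<^sup>2) \<le> \<alpha>\<^sup>2 * \<xi>\<^sup>2"
          using D by (intro mult_left_mono) auto
        moreover have "0 \<le> \<alpha>\<^sup>2 * \<xi>\<^sup>2" by simp
        moreover have "2 * (1 + 4 * \<alpha>\<^sup>2) * (\<xi>\<^sup>2 - \<alpha>\<^sup>2) - \<alpha>\<^sup>2 * (1 + \<xi>\<^sup>2)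
            = 2 * \<xi>\<^sup>2 - 3 * \<alpha>\<^sup>2 + 7 * (\<alpha>\<^sup>2 * \<xi>\<^sup>2) - 2 * (\<alpha>\<^sup>2 * (4 * \<alpha>\<^sup>2))"
          by (simp add: algebra_simps)
        ultimately show ?thesis using D a2 by linarith
      qed
      moreover have "0 < \<xi>\<^sup>2 - \<alpha>\<^sup>2" using D a2 by linarith
      ultimately show ?thesis by (simp add: divide_le_eq)
    qed
    finally show ?thesis .
  next
    case False
    then have "\<bar>\<xi>\<bar> \<le> \<bar>2 * \<alpha>\<bar>" using a by simp
    then have "\<xi>\<^sup>2 \<le> (2 * \<alpha>)\<^sup>2" using abs_le_square_iff by blast
    then have D: "1 + \<xi>\<^sup>2 \<le> 1 + 4 * \<alpha>\<^sup>2" by (simp add: power_mult_distrib)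
    have "cmod (moment (ingham \<alpha>) \<xi>) \<le> \<alpha> / 2 * (pi / \<alpha>)"
      using a by (intro moment_bound ingham_bsupp) auto
    also have "\<dots> \<le> 2" using a pi_less_4 by simp
    finally show ?thesis using D p by (intro mult_mono) auto
  qed
  then show ?thesis using p by (simp add: pos_le_divide_eq)
qed

text \<open>Partial fractions telescope, and the sum over all nonzero integers is exactly 1. Having
  1 here and nothing larger is what brings the time down to the threshold 2 pi / \<gamma>.\<close>

lemma sum_inverse_4sq_le:
  assumes G: "finite G" "(0::int) \<notin> G"
  shows "(\<Sum>n\<in>G. 1 / (4 * (real_of_int n)\<^sup>2 - 1)) \<le> 1"
proof -
  let ?f = "\<lambda>n::int. 1 / (4 * (real_of_int n)\<^sup>2 - 1)"
  have pos: "0 \<le> ?f n" if "n \<noteq> 0" for n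
  proof -
    have "1 \<le> \<bar>real_of_int n\<bar>" using that by (simp flip: of_int_abs)
    then have "1 \<le> (real_of_int n)\<^sup>2" by (simp add: abs_le_square_iff[of 1, simplified])
    then show ?thesis by simp
  qed
  have tele: "(\<Sum>n\<in>{- int N..int N} - {0}. ?f n) = 1 - 1 / (2 * real N + 1)" for N
  proof (induction N)
    case (Suc N)
    have "{- int (Suc N)..int (Suc N)} - {0} = insert (- int N - 1) (insert (int N + 1) ({- int N..int N} - {0}))"
      by auto
    moreover have "?f (int N + 1) = (1 / 2) * (1 / (2 * real N + 1) - 1 / (2 * real (Suc N) + 1))"
    proof -
      have "4 * (real N + 1)\<^sup>2 - 1 = (2 * real N + 1) * (2 * real N + 3)"
        by (simp add: power2_eq_square algebra_simps)
      then have "?f (int N + 1) = 1 / ((2 * real N + 1) * (2 * real N + 3))" by simp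
      then show ?thesis by (simp add: field_simps)
    qed
    moreover have "?f (- int N - 1) = ?f (int N + 1)" by (simp add: power2_eq_square algebra_simps)
    ultimately show ?case using Suc by simp
  qed simp
  define N where "N = nat (Max (insert 0 (abs ` G)))"
  have N: "\<bar>n\<bar> \<le> int N" if "n \<in> G" for n
    unfolding N_def using G that by (auto simp: le_nat_iff)
  have "(\<Sum>n\<in>G. ?f n) \<le> (\<Sum>n\<in>{- int N..int N} - {0}. ?f n)"
    using N G by (intro sum_mono2 pos) (force simp: abs_le_iff)+
  also have "\<dots> \<le> 1" unfolding tele by simp
  finally show ?thesis .
qed

section \<open>Sums over separated frequencies\<close>

definition separated :: "real \<Rightarrow> int set \<Rightarrow> (int \<Rightarrow> real) \<Rightarrow> bool" where
  "separated \<gamma> \<Lambda> lam \<longleftrightarrow> (\<forall>k\<in>\<Lambda>. \<forall>m\<in>\<Lambda>. k \<noteq> m \<longrightarrow> \<gamma> \<le> \<bar>lam k - lam m\<bar>)"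

lemma separated_subset: "separated \<gamma> \<Lambda> lam \<Longrightarrow> \<Lambda>' \<subseteq> \<Lambda> \<Longrightarrow> separated \<gamma> \<Lambda>' lam"
  unfolding separated_def by blast

lemma floor_same_close:
  fixes x y :: real
  assumes "\<gamma> > 0" "\<lfloor>x / \<gamma>\<rfloor> = \<lfloor>y / \<gamma>\<rfloor>"
  shows "\<bar>x - y\<bar> < \<gamma>"
proof -
  have "\<bar>x / \<gamma> - y / \<gamma>\<bar> < 1" using assms(2) by linarith
  then have "\<bar>(x - y) / \<gamma>\<bar> < 1" by (simp add: diff_divide_distrib)
  then show ?thesis using assms(1) by (simp add: abs_divide)
qed

text \<open>A half-open cell of length \<gamma> contains at most one frequency, so the floor is an
  injection into the integers and the sum is compared with \<open>kern\<close>.\<close>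

lemma separated_summable:
  assumes sep: "separated \<gamma> \<Lambda> lam" and \<gamma>: "\<gamma> > 0"
  shows "(\<lambda>k. 1 / (1 + (lam k - \<mu>)\<^sup>2)) summable_on \<Lambda>"
proof -
  define n where "n k = \<lfloor>(lam k - \<mu>) / \<gamma>\<rfloor>" for k
  have inj: "inj_on n \<Lambda>"
  proof (rule inj_onI, rule ccontr)
    fix k m assume km: "k \<in> \<Lambda>" "m \<in> \<Lambda>" "n k = n m" "k \<noteq> m"
    have "\<bar>(lam k - \<mu>) - (lam m - \<mu>)\<bar> < \<gamma>"
      by (rule floor_same_close[OF \<gamma>]) (use km in \<open>simp add: n_def\<close>)
    then show False using sep km unfolding separated_def by fastforce
  qed
  have "kern summable_on n ` \<Lambda>" using kern_summable by (rule summable_on_subset_banach) simp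
  then have s: "(\<lambda>k. kern (n k)) summable_on \<Lambda>"
    using summable_on_reindex[OF inj, of kern] by (simp add: comp_def)
  \<comment> \<open>Chosen for the chain \<open>(\<bar>x\<bar> + 2)\<^sup>2 \<le> 6 + 3 * x\<^sup>2
    \<le> C * (1 + \<gamma>\<^sup>2 * x\<^sup>2)\<close>, where x is the distance to \<mu> in units
    of \<gamma>.\<close>
  define C where "C = 6 + 4 / \<gamma>\<^sup>2"
  have "1 / (1 + (lam k - \<mu>)\<^sup>2) \<le> C * kern (n k)" for k
  proof -
    define x where "x = (lam k - \<mu>) / \<gamma>"
    have x2: "(lam k - \<mu>)\<^sup>2 = \<gamma>\<^sup>2 * x\<^sup>2" using \<gamma> by (simp add: x_def power_divide)
    have "\<bar>real_of_int (n k)\<bar> \<le> \<bar>x\<bar> + 1" unfolding n_def x_def[symmetric] by linarith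
    then have "jap (n k) \<le> \<bar>x\<bar> + 2" by (simp add: jap_def)
    then have "(jap (n k))\<^sup>2 \<le> (\<bar>x\<bar> + 2)\<^sup>2" by (intro power_mono) (simp_all add: jap_nonneg)
    also have "\<dots> \<le> 6 + 3 * x\<^sup>2"
    proof -
      have "0 \<le> 2 * (\<bar>x\<bar> - 1)\<^sup>2" by simp
      moreover have "2 * (\<bar>x\<bar> - 1)\<^sup>2 = 6 + 3 * x\<^sup>2 - (\<bar>x\<bar> + 2)\<^sup>2"
        by (simp add: power2_eq_square algebra_simps)
      ultimately show ?thesis by linarith
    qed
    also have "\<dots> \<le> C * (1 + \<gamma>\<^sup>2 * x\<^sup>2)"
    proof -
      have "C * (1 + \<gamma>\<^sup>2 * x\<^sup>2) = C + 6 * (\<gamma>\<^sup>2 * x\<^sup>2) + 4 * x\<^sup>2"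
        using \<gamma> by (simp add: C_def field_simps)
      moreover have "6 \<le> C" by (simp add: C_def)
      moreover have "0 \<le> \<gamma>\<^sup>2 * x\<^sup>2" "0 \<le> x\<^sup>2" by simp_all
      ultimately show ?thesis by linarith
    qed
    finally have "(jap (n k))\<^sup>2 \<le> C * (1 + (lam k - \<mu>)\<^sup>2)" by (simp add: x2)
    moreover have "0 < 1 + (lam k - \<mu>)\<^sup>2" by (simp add: add_pos_nonneg)
    ultimately show ?thesis using jap_pos[of "n k"] by (simp add: kern_def field_simps)
  qed
  then show ?thesis
    by (intro summable_on_dominated(2)[OF summable_on_cmult_right[OF s]]) simp
qed

text \<open>Ingham's estimate. The frequencies other than lam m are numbered injectively by nonzero
  integers n with |n| \<gamma> at most their distance to lam m. Since 2 \<alpha> < \<gamma>, each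
  term is at most 4 \<alpha>^2 / \<gamma>^2 times 1 / (4 n^2 - 1), and those fractions sum to at
  most 1.\<close>

lemma ingham_sum_le:
  assumes sep: "separated \<gamma> \<Lambda> lam" and a: "\<alpha> > 0" and \<gamma>: "2 * \<alpha> < \<gamma>"
    and m: "m \<in> \<Lambda>" and F: "finite F" "F \<subseteq> \<Lambda> - {m}"
  shows "(\<Sum>k\<in>F. cmod (moment (ingham \<alpha>) (lam k - lam m))) \<le> 4 * \<alpha>\<^sup>2 / \<gamma>\<^sup>2"
proof -
  have \<gamma>0: "\<gamma> > 0" using a \<gamma> by linarith
  have "(2 * \<alpha>)\<^sup>2 < \<gamma>\<^sup>2" using a \<gamma> by (intro power_strict_mono) auto
  then have \<gamma>2: "4 * \<alpha>\<^sup>2 < \<gamma>\<^sup>2" by (simp add: power_mult_distrib)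
  \<comment> \<open>Rounding towards zero on both sides of lam m: the floor of a negative quotient
    would overstate the distance.\<close>
  define n where "n k = (if lam k \<ge> lam m then \<lfloor>(lam k - lam m) / \<gamma>\<rfloor> else - \<lfloor>(lam m - lam k) / \<gamma>\<rfloor>)" for k
  have far: "\<gamma> \<le> \<bar>lam k - lam m\<bar>" if "k \<in> F" for k
    using sep that F m unfolding separated_def by blast
  have n1: "1 \<le> \<bar>n k\<bar>" "\<bar>of_int (n k)\<bar> * \<gamma> \<le> \<bar>lam k - lam m\<bar>"
    and sgn: "n k > 0 \<longleftrightarrow> lam k \<ge> lam m" if "k \<in> F" for k
  proof -
    define y where "y = \<bar>lam k - lam m\<bar> / \<gamma>"
    have y: "1 \<le> y" using far[OF that] \<gamma>0 by (simp add: y_def)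
    have nk: "n k = (if lam k \<ge> lam m then \<lfloor>y\<rfloor> else - \<lfloor>y\<rfloor>)" by (auto simp: n_def y_def abs_real_def)
    have f: "1 \<le> \<lfloor>y\<rfloor>" using y by linarith
    then show "1 \<le> \<bar>n k\<bar>" "n k > 0 \<longleftrightarrow> lam k \<ge> lam m" by (auto simp: nk)
    have "of_int \<bar>n k\<bar> = real_of_int \<lfloor>y\<rfloor>" using f by (auto simp: nk)
    also have "\<dots> \<le> y" by linarith
    finally have "\<bar>real_of_int (n k)\<bar> \<le> y" by simp
    then show "\<bar>of_int (n k)\<bar> * \<gamma> \<le> \<bar>lam k - lam m\<bar>"
      using \<gamma>0 by (simp add: y_def pos_le_divide_eq)
  qed
  have inj: "inj_on n F"
  proof (rule inj_onI, rule ccontr)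
    fix k j assume kj: "k \<in> F" "j \<in> F" "n k = n j" "k \<noteq> j"
    have "\<bar>lam k - lam j\<bar> < \<gamma>"
    proof (cases "lam k \<ge> lam m")
      case True
      then have "lam j \<ge> lam m" using sgn kj by metis
      then have "\<lfloor>(lam k - lam m) / \<gamma>\<rfloor> = \<lfloor>(lam j - lam m) / \<gamma>\<rfloor>" using True kj by (simp add: n_def)
      from floor_same_close[OF \<gamma>0 this] show ?thesis by simp
    next
      case False
      then have "\<not> lam j \<ge> lam m" using sgn kj by metis
      then have "\<lfloor>(lam m - lam k) / \<gamma>\<rfloor> = \<lfloor>(lam m - lam j) / \<gamma>\<rfloor>" using False kj by (simp add: n_def)
      from floor_same_close[OF \<gamma>0 this] show ?thesis by (simp add: abs_minus_commute)
    qed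
    moreover have "\<gamma> \<le> \<bar>lam k - lam j\<bar>" using sep kj F unfolding separated_def by blast
    ultimately show False by simp
  qed
  have "cmod (moment (ingham \<alpha>) (lam k - lam m)) \<le> 4 * \<alpha>\<^sup>2 / \<gamma>\<^sup>2 * (1 / (4 * (real_of_int (n k))\<^sup>2 - 1))" if "k \<in> F" for k
  proof -
    let ?x = "lam k - lam m" and ?n = "real_of_int (n k)"
    have nn: "1 \<le> ?n\<^sup>2"
    proof -
      have "1 \<le> \<bar>?n\<bar>" using n1(1)[OF that] by (simp flip: of_int_abs)
      then show ?thesis by (simp add: abs_le_square_iff[of 1, simplified])
    qed
    have "(\<bar>?n\<bar> * \<gamma>)\<^sup>2 \<le> \<bar>?x\<bar>\<^sup>2"
      using n1(2)[OF that] \<gamma>0 by (intro power_mono) auto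
    then have x: "?n\<^sup>2 * \<gamma>\<^sup>2 \<le> ?x\<^sup>2" by (simp add: power_mult_distrib)
    have "1 * \<gamma>\<^sup>2 \<le> ?n\<^sup>2 * \<gamma>\<^sup>2" using nn by (intro mult_right_mono) auto
    then have p: "0 < ?n\<^sup>2 * \<gamma>\<^sup>2 - \<alpha>\<^sup>2" using \<gamma>2 zero_less_power[OF a, of 2] by linarith
    have "cmod (moment (ingham \<alpha>) ?x) \<le> \<alpha>\<^sup>2 / (?x\<^sup>2 - \<alpha>\<^sup>2)"
      using a far[OF that] \<gamma> by (intro ingham_moment_decay) auto
    also have "\<dots> \<le> \<alpha>\<^sup>2 / (?n\<^sup>2 * \<gamma>\<^sup>2 - \<alpha>\<^sup>2)"
      using x p by (intro divide_left_mono mult_pos_pos) auto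
    also have "\<dots> \<le> 4 * \<alpha>\<^sup>2 / (\<gamma>\<^sup>2 * (4 * ?n\<^sup>2 - 1))"
    proof -
      have "\<gamma>\<^sup>2 * (4 * ?n\<^sup>2 - 1) \<le> 4 * (?n\<^sup>2 * \<gamma>\<^sup>2 - \<alpha>\<^sup>2)" using \<gamma>2 by (simp add: algebra_simps)
      then have "\<alpha>\<^sup>2 * (\<gamma>\<^sup>2 * (4 * ?n\<^sup>2 - 1)) \<le> \<alpha>\<^sup>2 * (4 * (?n\<^sup>2 * \<gamma>\<^sup>2 - \<alpha>\<^sup>2))" by (rule mult_left_mono) simp
      moreover have "0 < \<gamma>\<^sup>2 * (4 * ?n\<^sup>2 - 1)" using nn \<gamma>0 by (intro mult_pos_pos) auto
      ultimately show ?thesis using p by (simp add: frac_le_eq divide_le_0_iff field_simps)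
    qed
    finally show ?thesis by simp
  qed
  then have "(\<Sum>k\<in>F. cmod (moment (ingham \<alpha>) (lam k - lam m)))
      \<le> (\<Sum>k\<in>F. 4 * \<alpha>\<^sup>2 / \<gamma>\<^sup>2 * (1 / (4 * (real_of_int (n k))\<^sup>2 - 1)))"
    by (rule sum_mono)
  also have "\<dots> = 4 * \<alpha>\<^sup>2 / \<gamma>\<^sup>2 * (\<Sum>j\<in>n ` F. 1 / (4 * (real_of_int j)\<^sup>2 - 1))"
    by (simp only: sum_distrib_left[symmetric] sum.reindex[OF inj] comp_def)
  also have "\<dots> \<le> 4 * \<alpha>\<^sup>2 / \<gamma>\<^sup>2 * 1"
    using n1(1) F by (intro mult_left_mono sum_inverse_4sq_le) force+
  finally show ?thesis by simp
qed

section \<open>Neumann series for matrices with small column sums\<close>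

lemma l1_matrix_step:
  fixes E :: "int \<Rightarrow> int \<Rightarrow> complex"
  assumes E: "\<And>m F. finite F \<Longrightarrow> (\<Sum>k\<in>F. cmod (E k m)) \<le> \<theta>"
    and x: "(\<lambda>m. cmod (x m)) summable_on UNIV"
  shows "(\<lambda>m. cmod (E k m * x m)) summable_on UNIV"
    and "(\<Sum>\<^sub>\<infinity>m. cmod (E k m * x m)) \<le> \<theta> * (\<Sum>\<^sub>\<infinity>m. cmod (x m))"
    and "(\<lambda>k. cmod (\<Sum>\<^sub>\<infinity>m. E k m * x m)) summable_on UNIV"
    and "(\<Sum>\<^sub>\<infinity>k. cmod (\<Sum>\<^sub>\<infinity>m. E k m * x m)) \<le> \<theta> * (\<Sum>\<^sub>\<infinity>m. cmod (x m))"
proof -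
  have b: "cmod (E k m * x m) \<le> \<theta> * cmod (x m)" for k m
    using E[of "{k}" m] by (simp add: norm_mult mult_right_mono)
  note s = summable_on_cmult_right[OF x, of \<theta>]
  show sm: "(\<lambda>m. cmod (E k m * x m)) summable_on UNIV" for k
    by (rule summable_on_dominated(1)[OF s b])
  show "(\<Sum>\<^sub>\<infinity>m. cmod (E k m * x m)) \<le> \<theta> * (\<Sum>\<^sub>\<infinity>m. cmod (x m))"
    using infsum_mono[OF sm s b, of k] by (simp add: infsum_cmult_right')
  \<comment> \<open>With finitely many rows at a time the interchange of sums is elementary, and it
    exposes the column sums.\<close>
  have fin: "(\<Sum>k\<in>F. cmod (\<Sum>\<^sub>\<infinity>m. E k m * x m)) \<le> \<theta> * (\<Sum>\<^sub>\<infinity>m. cmod (x m))" if "finite F" for F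
  proof -
    have "(\<Sum>k\<in>F. cmod (\<Sum>\<^sub>\<infinity>m. E k m * x m)) \<le> (\<Sum>k\<in>F. \<Sum>\<^sub>\<infinity>m. cmod (E k m * x m))"
      by (intro sum_mono norm_infsum_bound sm)
    also have "\<dots> = (\<Sum>\<^sub>\<infinity>m. \<Sum>k\<in>F. cmod (E k m * x m))"
      by (rule infsum_sum'[symmetric]) (rule sm)
    also have "\<dots> \<le> (\<Sum>\<^sub>\<infinity>m. \<theta> * cmod (x m))"
    proof (intro infsum_mono summable_on_sum' sm s)
      show "(\<Sum>k\<in>F. cmod (E k m * x m)) \<le> \<theta> * cmod (x m)" for m
        unfolding norm_mult sum_distrib_right[symmetric] using E[OF that, of m] by (rule mult_right_mono) simp
    qed
    finally show ?thesis by (simp add: infsum_cmult_right')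
  qed
  show "(\<lambda>k. cmod (\<Sum>\<^sub>\<infinity>m. E k m * x m)) summable_on UNIV"
    "(\<Sum>\<^sub>\<infinity>k. cmod (\<Sum>\<^sub>\<infinity>m. E k m * x m)) \<le> \<theta> * (\<Sum>\<^sub>\<infinity>m. cmod (x m))"
    using summable_on_bounded_sums[OF _ fin, of UNIV] by auto
qed

text \<open>B is column j of the inverse of 1 - E, the sum of the powers of E applied to the j-th
  unit vector; absolute summability of the double series lets E pass under the sum. The l^1 bound is
  independent of j, which later makes the biorthogonal functions uniformly bounded.\<close>

lemma neumann_l1:
  fixes E :: "int \<Rightarrow> int \<Rightarrow> complex"
  assumes E: "\<And>m F. finite F \<Longrightarrow> (\<Sum>k\<in>F. cmod (E k m)) \<le> \<theta>" and \<theta>: "0 \<le> \<theta>" "\<theta> < 1"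
  shows "\<exists>B. (\<lambda>k. cmod (B k)) summable_on UNIV \<and> (\<Sum>\<^sub>\<infinity>k. cmod (B k)) \<le> 1 / (1 - \<theta>) \<and>
    (\<forall>k. B k = (if k = j then 1 else 0) + (\<Sum>\<^sub>\<infinity>m. E k m * B m))"
proof -
  define b where "b n = ((\<lambda>x k. \<Sum>\<^sub>\<infinity>m. E k m * x m) ^^ n) (\<lambda>k. if k = j then 1 else 0)" for n
  have b0: "b 0 k = (if k = j then 1 else 0)" and bS: "b (Suc n) k = (\<Sum>\<^sub>\<infinity>m. E k m * b n m)" for n k
    by (simp_all add: b_def)
  have b: "(\<lambda>k. cmod (b n k)) summable_on UNIV \<and> (\<Sum>\<^sub>\<infinity>k. cmod (b n k)) \<le> \<theta> ^ n" for n
  proof (induction n)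
    case 0
    have "(\<Sum>k\<in>F. cmod (b 0 k)) \<le> 1" if "finite F" for F
    proof -
      have "(\<Sum>k\<in>F. cmod (b 0 k)) = (\<Sum>k\<in>F. if k = j then 1 else 0)"
        by (intro sum.cong) (auto simp: b0)
      then show ?thesis using that by simp
    qed
    then show ?case using summable_on_bounded_sums[of UNIV "\<lambda>k. cmod (b 0 k)" 1] by simp
  next
    case (Suc n)
    have "\<theta> * (\<Sum>\<^sub>\<infinity>k. cmod (b n k)) \<le> \<theta> * \<theta> ^ n" using Suc \<theta> by (intro mult_left_mono) auto
    then show ?case
      using l1_matrix_step(3,4)[where E = E and x = "b n", OF E conjunct1[OF Suc]] unfolding bS by auto
  qed
  have geo: "((\<lambda>n. \<theta> ^ n) has_sum 1 / (1 - \<theta>)) UNIV"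
    using \<theta> by (intro sums_nonneg_imp_has_sum geometric_sums) auto
  have bk: "cmod (b n k) \<le> \<theta> ^ n" for n k
  proof -
    have "(\<Sum>k\<in>{k}. cmod (b n k)) \<le> (\<Sum>\<^sub>\<infinity>k. cmod (b n k))"
      using b by (intro finite_sum_le_infsum) auto
    then show ?thesis using b[of n] by simp
  qed
  note sb = summable_on_dominated[OF has_sum_imp_summable[OF geo] bk]
  define B where "B k = (\<Sum>\<^sub>\<infinity>n. b n k)" for k
  have fin: "(\<Sum>k\<in>F. cmod (B k)) \<le> 1 / (1 - \<theta>)" if "finite F" for F
  proof -
    have "(\<Sum>k\<in>F. cmod (B k)) \<le> (\<Sum>k\<in>F. \<Sum>\<^sub>\<infinity>n. cmod (b n k))"
      unfolding B_def by (intro sum_mono norm_infsum_bound sb)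
    also have "\<dots> = (\<Sum>\<^sub>\<infinity>n. \<Sum>k\<in>F. cmod (b n k))"
      by (rule infsum_sum'[symmetric]) (rule sb)
    also have "\<dots> \<le> (\<Sum>\<^sub>\<infinity>n. \<theta> ^ n)"
    proof (intro infsum_mono summable_on_sum' sb has_sum_imp_summable[OF geo])
      show "(\<Sum>k\<in>F. cmod (b n k)) \<le> \<theta> ^ n" for n
        using finite_sum_le_infsum[of "\<lambda>k. cmod (b n k)" UNIV F] b[of n] that by auto
    qed
    finally show ?thesis using infsumI[OF geo] by simp
  qed
  note B = summable_on_bounded_sums[OF _ fin, of UNIV, simplified]
  have eq: "B k = (if k = j then 1 else 0) + (\<Sum>\<^sub>\<infinity>m. E k m * B m)" for k
  proof -
    have "Infinite_Sum.abs_summable_on (\<lambda>(n, m). E k m * b n m) (UNIV \<times> UNIV)"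
      unfolding Infinite_Sum.abs_summable_on_Sigma_iff
    proof (intro conjI ballI)
      show "(\<lambda>m. norm (case (n, m) of (n, m) \<Rightarrow> E k m * b n m)) summable_on UNIV" for n
        using l1_matrix_step(1)[where E = E and x = "b n", OF E conjunct1[OF b]] by simp
      have "(\<Sum>\<^sub>\<infinity>m. cmod (E k m * b n m)) \<le> \<theta> * \<theta> ^ n" for n
        using l1_matrix_step(2)[where E = E and x = "b n" and k = k, OF E conjunct1[OF b[of n]]] b[of n] \<theta>
        by (meson mult_left_mono order_trans)
      then show "(\<lambda>n. norm (\<Sum>\<^sub>\<infinity>m. norm (case (n, m) of (n, m) \<Rightarrow> E k m * b n m))) summable_on UNIV"
        by (intro summable_on_dominated(1)[OF summable_on_cmult_right[OF has_sum_imp_summable[OF geo], of \<theta>]])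
           (simp add: infsum_nonneg)
    qed
    then have "(\<lambda>(n, m). E k m * b n m) summable_on (UNIV \<times> UNIV)"
      by (rule abs_summable_summable)
    from infsum_swap_banach[OF this]
    have "(\<Sum>\<^sub>\<infinity>n. b (Suc n) k) = (\<Sum>\<^sub>\<infinity>m. E k m * B m)"
      by (simp add: bS B_def infsum_cmult_right')
    moreover have "B k = b 0 k + (\<Sum>\<^sub>\<infinity>n. b (Suc n) k)"
    proof -
      have s1: "(\<lambda>n. b n k) summable_on range Suc"
        by (rule summable_on_subset_banach[OF sb(2)]) simp
      have "UNIV = {0} \<union> range Suc" by (auto simp: image_iff) (metis not0_implies_Suc)
      then have "B k = infsum (\<lambda>n. b n k) {0} + infsum (\<lambda>n. b n k) (range Suc)"
        unfolding B_def using s1 by (subst infsum_Un_disjoint[symmetric]) auto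
      also have "infsum (\<lambda>n. b n k) (range Suc) = (\<Sum>\<^sub>\<infinity>n. b (Suc n) k)"
        by (subst infsum_reindex) (auto simp: comp_def)
      finally show ?thesis by simp
    qed
    ultimately show ?thesis by (simp add: b0)
  qed
  show ?thesis using B eq by blast
qed


text \<open>M is quantified before j: one bound for the whole family is the point of the
  definition.\<close>

definition biorthogonal :: "real \<Rightarrow> int set \<Rightarrow> (int \<Rightarrow> real) \<Rightarrow> bool" where
  "biorthogonal T \<Lambda> lam \<longleftrightarrow> (\<exists>M q. \<forall>j\<in>\<Lambda>. bsupp T M (q j) \<and>
     (\<forall>k\<in>\<Lambda>. moment (q j) (lam k) = (if j = k then 1 else 0)))"

lemma biorthogonal_mono:
  assumes "biorthogonal T \<Lambda> lam" "T \<le> T'"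
  shows "biorthogonal T' \<Lambda> lam"
  using assms bsupp_mono[of T _ _ T'] unfolding biorthogonal_def by blast

text \<open>Ingham's estimate makes the matrix of moments of \<open>ingham \<alpha> t e\<^sup>i\<^sup>\<lambda>\<^sup>t\<close> strictly diagonally dominant, so it is
  inverted by a Neumann series in \<open>\<ell>\<^sup>1\<close>.\<close>

lemma biorthogonal_separated:
  assumes sep: "separated \<gamma> \<Lambda> lam" and a: "\<alpha> > 0" and \<gamma>: "2 * \<alpha> < \<gamma>"
  shows "biorthogonal (pi / \<alpha>) \<Lambda> lam"
proof -
  let ?R = "\<lambda>k m. moment (ingham \<alpha>) (lam k - lam m)"
  define \<theta> where "\<theta> = 4 * \<alpha>\<^sup>2 / \<gamma>\<^sup>2"
  have "(2 * \<alpha>)\<^sup>2 < \<gamma>\<^sup>2" using a \<gamma> by (intro power_strict_mono) auto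
  then have "4 * \<alpha>\<^sup>2 < \<gamma>\<^sup>2" by (simp add: power_mult_distrib)
  then have \<theta>: "0 \<le> \<theta>" "\<theta> < 1" using a \<gamma> by (auto simp: \<theta>_def)
  \<comment> \<open>The sign makes 1 - E the matrix of moments on \<Lambda>, whose diagonal entries
    are 1 because the kernel has integral 1.\<close>
  define E where "E k m = (if k \<in> \<Lambda> \<and> m \<in> \<Lambda> \<and> k \<noteq> m then - ?R k m else 0)" for k m
  have E: "(\<Sum>k\<in>F. cmod (E k m)) \<le> \<theta>" if F: "finite F" for m F
  proof (cases "m \<in> \<Lambda>")
    case True
    have "(\<Sum>k\<in>F. cmod (E k m)) = (\<Sum>k\<in>F \<inter> (\<Lambda> - {m}). cmod (?R k m))"
      unfolding sum.inter_restrict[OF F] by (intro sum.cong) (auto simp: E_def True)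
    also have "\<dots> \<le> \<theta>"
      unfolding \<theta>_def using F by (intro ingham_sum_le[OF sep a \<gamma> True]) auto
    finally show ?thesis .
  qed (simp add: E_def \<theta>)
  have "\<exists>q. bsupp (pi / \<alpha>) (1 / (1 - \<theta>) * (\<alpha> / 2)) q \<and>
      (\<forall>k\<in>\<Lambda>. moment q (lam k) = (if j = k then 1 else 0))" if j: "j \<in> \<Lambda>" for j
  proof -
    have "\<exists>B. (\<lambda>k. cmod (B k)) summable_on UNIV \<and> (\<Sum>\<^sub>\<infinity>k. cmod (B k)) \<le> 1 / (1 - \<theta>) \<and>
        (\<forall>k. B k = (if k = j then 1 else 0) + (\<Sum>\<^sub>\<infinity>m. E k m * B m))"
      by (rule neumann_l1[OF E \<theta>])
    then obtain B where B: "(\<lambda>k. cmod (B k)) summable_on UNIV" "(\<Sum>\<^sub>\<infinity>k. cmod (B k)) \<le> 1 / (1 - \<theta>)"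
      and eq: "\<And>k. B k = (if k = j then 1 else 0) + (\<Sum>\<^sub>\<infinity>m. E k m * B m)" by blast
    \<comment> \<open>Rows of E outside \<Lambda> vanish, so the fixed-point equation leaves only
      the unit vector, and j lies in \<Lambda>.\<close>
    have B0: "B k = 0" if "k \<notin> \<Lambda>" for k
      using eq[of k] that j by (auto simp: E_def)
    let ?q = "\<lambda>m t. ingham \<alpha> t * cis (lam m * t)"
    define q where "q t = (\<Sum>\<^sub>\<infinity>m. B m * ?q m t)" for t
    have a2: "0 \<le> \<alpha> / 2" using a by simp
    note q = moment_infsum[where q = ?q and c = B, OF ingham_modulated_bsupp[OF a] B(1) a2]
    have "bsupp (pi / \<alpha>) (1 / (1 - \<theta>) * (\<alpha> / 2)) q"
      unfolding q_def[abs_def] by (rule bsupp_mono[OF q(1) order_refl mult_right_mono[OF B(2) a2]])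
    moreover have "moment q (lam k) = (if j = k then 1 else 0)" if k: "k \<in> \<Lambda>" for k
    proof -
      have "moment q (lam k) = (\<Sum>\<^sub>\<infinity>m. B m * ?R k m)"
        unfolding q_def[abs_def] q(2) moment_modulate ..
      also have "\<dots> = (\<Sum>\<^sub>\<infinity>m. (if m = k then B k else 0) + - (E k m * B m))"
        by (intro infsum_cong) (use k B0 ingham_moment_0[OF a] in \<open>auto simp: E_def\<close>)
      also have "\<dots> = (\<Sum>\<^sub>\<infinity>m. (if m = k then B k else 0)) + (\<Sum>\<^sub>\<infinity>m. - (E k m * B m))"
      proof (rule infsum_add)
        show "(\<lambda>m. if m = k then B k else 0) summable_on UNIV"
        proof -
          have "(\<lambda>m. if m = k then B k else 0) summable_on {k}" by simp
          then show ?thesis by (rule summable_on_cong_neutral[THEN iffD1, rotated -1]) auto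
        qed
        show "(\<lambda>m. - (E k m * B m)) summable_on UNIV"
          unfolding summable_on_uminus
          by (rule abs_summable_summable[OF l1_matrix_step(1)[where E = E, OF E B(1)]])
      qed
      also have "(\<Sum>\<^sub>\<infinity>m. (if m = k then B k else 0)) = (\<Sum>\<^sub>\<infinity>m\<in>{k}. B k)"
        by (rule infsum_cong_neutral) auto
      also have "(\<Sum>\<^sub>\<infinity>m\<in>{k}. B k) + (\<Sum>\<^sub>\<infinity>m. - (E k m * B m)) = (if j = k then 1 else 0)"
        using eq[of k] by (simp add: infsum_uminus)
      finally show ?thesis .
    qed
    ultimately show ?thesis by blast
  qed
  then show ?thesis unfolding biorthogonal_def by metis
qed

text \<open>One more frequency costs an arbitrarily small amount of time: each \<open>q j\<close> is combined with a
  translate of itself so that its moment at the new frequency vanishes, where the translation length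
  depends on \<open>j\<close> and is chosen to avoid a small denominator.\<close>

lemma biorthogonal_insert:
  assumes bi: "biorthogonal T \<Lambda> lam" and T: "0 \<le> T" and i: "i \<notin> \<Lambda>" and \<delta>: "\<delta> > 0"
    and sep: "separated \<gamma> (insert i \<Lambda>) lam" and \<gamma>: "\<gamma> > 0"
  shows "biorthogonal (T + \<delta>) (insert i \<Lambda>) lam"
proof -
  obtain M0 q where q0: "\<And>j. j \<in> \<Lambda> \<Longrightarrow> bsupp T M0 (q j)"
    "\<And>j k. j \<in> \<Lambda> \<Longrightarrow> k \<in> \<Lambda> \<Longrightarrow> moment (q j) (lam k) = (if j = k then 1 else 0)"
    using bi unfolding biorthogonal_def by blast
  \<comment> \<open>For empty \<Lambda> the number M0 is unconstrained; the absolute value makes it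
    nonnegative in every case.\<close>
  define M where "M = \<bar>M0\<bar>"
  have M: "0 \<le> M" by (simp add: M_def)
  have q: "bsupp T M (q j)" if "j \<in> \<Lambda>" for j
    by (rule bsupp_mono[OF q0(1)[OF that]]) (simp_all add: M_def)
  let ?\<mu> = "lam i"
  define d where "d j = lam j - ?\<mu>" for j
  have d: "\<gamma> \<le> \<bar>d j\<bar>" if "j \<in> \<Lambda>" for j
    using sep that i unfolding separated_def d_def by auto
  \<comment> \<open>The translation is at most \<delta>, and the phase e j * |d j| = min (\<delta>
    |d j|) pi does not exceed pi, so the chord bound applies. As |d j| \<ge> \<gamma>, this gives
    the lower bound c on |z j|, the same for all j.\<close>
  define e where "e j = min \<delta> (pi / \<bar>d j\<bar>)" for j
  define c where "c = 2 * min (\<delta> * \<gamma>) pi / pi"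
  have c: "0 < c" using \<delta> \<gamma> by (simp add: c_def)
  define z where "z j = 1 - cis (- (e j * d j))" for j
  have e: "0 < e j" "e j \<le> \<delta>" and z: "c \<le> cmod (z j)" if "j \<in> \<Lambda>" for j
  proof -
    have dj: "0 < \<bar>d j\<bar>" using d[OF that] \<gamma> by linarith
    then show "0 < e j" "e j \<le> \<delta>" using \<delta> by (auto simp: e_def)
    have ed: "\<bar>- (e j * d j)\<bar> = min (\<delta> * \<bar>d j\<bar>) pi"
    proof -
      have "\<bar>- (e j * d j)\<bar> = e j * \<bar>d j\<bar>" using \<open>0 < e j\<close> by (simp add: abs_mult)
      then show ?thesis unfolding e_def min_def using dj by (auto simp: pos_le_divide_eq)
    qed
    have "2 * \<bar>- (e j * d j)\<bar> / pi \<le> cmod (exp (\<i> * of_real (- (e j * d j))) - 1)"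
      by (rule chord_lower_bound) (simp only: ed min.cobounded2)
    moreover have "c \<le> 2 * \<bar>- (e j * d j)\<bar> / pi"
      unfolding c_def ed using d[OF that] \<delta>
      by (intro divide_right_mono mult_left_mono min.mono mult_left_mono) auto
    ultimately show "c \<le> cmod (z j)" unfolding z_def cis_conv_exp by (simp only: norm_minus_commute)
  qed
  \<comment> \<open>The moment of p j at \<xi> is that of q j times (1 - cis (e j * (lam i -
    \<xi>))) / z j. This factor is 0 at lam i and 1 at lam j, and at the other old frequencies the
    moment of q j is already 0.\<close>
  define p where "p j t = (1 / z j) * (q j t - cis (e j * ?\<mu>) * q j (t - e j))" for j t
  have pb: "bsupp (T + \<delta>) (2 * M / c) (p j)" if j: "j \<in> \<Lambda>" for j
    unfolding bsupp_def
  proof (intro conjI allI impI)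
    have [measurable]: "q j \<in> borel_measurable borel" using q[OF j] by (simp add: bsupp_def)
    show "p j \<in> borel_measurable borel" unfolding p_def[abs_def] by measurable
    show "cmod (p j t) \<le> 2 * M / c" for t
    proof -
      have "cmod (q j t - cis (e j * ?\<mu>) * q j (t - e j)) \<le> cmod (q j t) + cmod (cis (e j * ?\<mu>) * q j (t - e j))"
        by (rule norm_triangle_ineq4)
      also have "\<dots> \<le> M + M" using q[OF j] by (intro add_mono) (auto simp: bsupp_def norm_mult)
      finally have "cmod (q j t - cis (e j * ?\<mu>) * q j (t - e j)) \<le> 2 * M" by simp
      then have "cmod (p j t) \<le> (1 / cmod (z j)) * (2 * M)"
        unfolding p_def norm_mult norm_divide norm_one by (rule mult_left_mono) simp
      also have "\<dots> \<le> (1 / c) * (2 * M)"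
        using z[OF j] c M by (intro mult_right_mono divide_left_mono mult_pos_pos) auto
      finally show ?thesis by simp
    qed
    show "p j t = 0" if "t \<notin> {0..T + \<delta>}" for t
    proof -
      have "q j t = 0" "q j (t - e j) = 0" using q[OF j] that e[OF j] \<delta> by (auto simp: bsupp_def)
      then show ?thesis by (simp add: p_def)
    qed
  qed
  have pm: "moment (p j) \<xi> = (1 / z j) * (1 - cis (e j * (?\<mu> - \<xi>))) * moment (q j) \<xi>" if j: "j \<in> \<Lambda>" for j \<xi>
  proof -
    have sh: "bsupp (T + \<delta>) M (\<lambda>t. cis (e j * ?\<mu>) * q j (t - e j))"
      using q[OF j] e[OF j] \<delta> unfolding bsupp_def by (auto simp: norm_mult)
    have "moment (p j) \<xi> = (1 / z j) * (moment (q j) \<xi> - cis (e j * ?\<mu>) * (cis (- (\<xi> * e j)) * moment (q j) \<xi>))"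
      unfolding p_def moment_cmult moment_diff[OF q[OF j] sh] moment_shift ..
    also have "cis (e j * ?\<mu>) * (cis (- (\<xi> * e j)) * moment (q j) \<xi>) = cis (e j * (?\<mu> - \<xi>)) * moment (q j) \<xi>"
    proof -
      have "cis (e j * ?\<mu>) * cis (- (\<xi> * e j)) = cis (e j * (?\<mu> - \<xi>))" by (simp add: cis_mult algebra_simps)
      then show ?thesis by (simp only: mult.assoc[symmetric])
    qed
    finally show ?thesis by (simp add: algebra_simps)
  qed
  have p_i: "moment (p j) ?\<mu> = 0" if "j \<in> \<Lambda>" for j using pm[OF that] by simp
  have p_k: "moment (p j) (lam k) = (if j = k then 1 else 0)" if j: "j \<in> \<Lambda>" and k: "k \<in> \<Lambda>" for j k
  proof (cases "j = k")
    case True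
    have "e j * (?\<mu> - lam j) = - (e j * d j)" by (simp add: d_def algebra_simps)
    then have "1 - cis (e j * (?\<mu> - lam j)) = z j" by (simp add: z_def)
    moreover have "z j \<noteq> 0" using z[OF j] c by auto
    ultimately show ?thesis using True pm[OF j, of "lam j"] q0(2)[OF j j] by simp
  qed (simp add: pm[OF j] q0(2)[OF j k])
  \<comment> \<open>A kernel living on [0, \<delta>] only. Here \<alpha> may be large compared with
    the gap: diagonal dominance is not sought, just summability of the moments P.\<close>
  define \<alpha> where "\<alpha> = pi / \<delta>"
  have \<alpha>: "\<alpha> > 0" and \<alpha>\<delta>: "pi / \<alpha> = \<delta>" using \<delta> by (simp_all add: \<alpha>_def)
  \<comment> \<open>The moments of the modulated kernel at the old frequencies. Subtracting these
    multiples of the p k cancels them and leaves the moment 1 at lam i untouched, since every p k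
    vanishes there.\<close>
  define P where "P k = (if k \<in> \<Lambda> then moment (ingham \<alpha>) (lam k - ?\<mu>) else 0)" for k
  have Ps: "(\<lambda>k. cmod (P k)) summable_on UNIV"
  proof -
    have "(\<lambda>k. 1 / (1 + (lam k - ?\<mu>)\<^sup>2)) summable_on \<Lambda>"
      by (rule separated_summable[OF separated_subset[OF sep] \<gamma>]) auto
    from summable_on_dominated(1)[OF summable_on_cmult_right[OF this] ingham_moment_quadratic[OF \<alpha>]]
    have "(\<lambda>k. cmod (moment (ingham \<alpha>) (lam k - ?\<mu>))) summable_on \<Lambda>" .
    then show ?thesis
      by (rule summable_on_cong_neutral[THEN iffD1, rotated -1]) (auto simp: P_def)
  qed
  have Pn: "j \<in> \<Lambda>" if "P j \<noteq> 0" for j using that by (auto simp: P_def split: if_splits)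
  have cM: "0 \<le> 2 * M / c" using c M by simp
  have S: "bsupp (T + \<delta>) ((\<Sum>\<^sub>\<infinity>k. cmod (P k)) * (2 * M / c)) (\<lambda>t. \<Sum>\<^sub>\<infinity>k. P k * p k t)"
    "moment (\<lambda>t. \<Sum>\<^sub>\<infinity>k. P k * p k t) \<xi> = (\<Sum>\<^sub>\<infinity>k. P k * moment (p k) \<xi>)" for \<xi>
    by (rule moment_infsum[OF _ Ps cM]; blast intro: pb Pn)+
  let ?S = "\<lambda>t. \<Sum>\<^sub>\<infinity>k. P k * p k t" and ?g = "\<lambda>t. ingham \<alpha> t * cis (?\<mu> * t)"
  have gb: "bsupp (T + \<delta>) (\<alpha> / 2) ?g"
    using ingham_modulated_bsupp[OF \<alpha>] by (rule bsupp_mono) (use T \<alpha>\<delta> in auto)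
  define M' where "M' = \<alpha> / 2 + (\<Sum>\<^sub>\<infinity>k. cmod (P k)) * (2 * M / c)"
  have qi: "bsupp (T + \<delta>) M' (\<lambda>t. ?g t - ?S t)"
    unfolding bsupp_def
  proof (intro conjI allI impI)
    show "(\<lambda>t. ?g t - ?S t) \<in> borel_measurable borel"
      using gb S(1) unfolding bsupp_def by (intro borel_measurable_diff) auto
    show "cmod (?g t - ?S t) \<le> M'" for t
      unfolding M'_def using gb S(1) unfolding bsupp_def
      by (intro order_trans[OF norm_triangle_ineq4] add_mono) auto
    show "?g t - ?S t = 0" if "t \<notin> {0..T + \<delta>}" for t
      using gb S(1) that unfolding bsupp_def by auto
  qed
  have mi: "moment (\<lambda>t. ?g t - ?S t) \<xi> = moment (ingham \<alpha>) (\<xi> - ?\<mu>) - (\<Sum>\<^sub>\<infinity>k. P k * moment (p k) \<xi>)" for \<xi>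
    using moment_diff[OF gb S(1), of \<xi>] by (simp only: S(2) moment_modulate)
  have mi_i: "moment (\<lambda>t. ?g t - ?S t) ?\<mu> = 1"
  proof -
    have "(\<Sum>\<^sub>\<infinity>k. P k * moment (p k) ?\<mu>) = 0"
    proof (rule infsum_0)
      show "P k * moment (p k) ?\<mu> = 0" for k
        using p_i[of k] by (cases "k \<in> \<Lambda>") (simp_all add: P_def)
    qed
    then show ?thesis unfolding mi by (simp add: ingham_moment_0[OF \<alpha>])
  qed
  have mi_k: "moment (\<lambda>t. ?g t - ?S t) (lam k) = 0" if k: "k \<in> \<Lambda>" for k
  proof -
    have "(\<Sum>\<^sub>\<infinity>j. P j * moment (p j) (lam k)) = (\<Sum>\<^sub>\<infinity>j\<in>{k}. P k)"
    proof (rule infsum_cong_neutral)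
      show "P j * moment (p j) (lam k) = 0" if "j \<in> UNIV - {k}" for j
        using p_k[of j k] k that by (cases "j \<in> \<Lambda>") (simp_all add: P_def)
      show "P j * moment (p j) (lam k) = P k" if "j \<in> UNIV \<inter> {k}" for j
        using p_k[of k k] k that by simp
    qed simp
    then show ?thesis unfolding mi using k by (simp add: P_def)
  qed
  show ?thesis
    unfolding biorthogonal_def
  proof (intro exI ballI conjI)
    let ?q = "\<lambda>j. if j = i then (\<lambda>t. ?g t - ?S t) else p j"
    fix j assume j: "j \<in> insert i \<Lambda>"
    show "bsupp (T + \<delta>) (max M' (2 * M / c)) (?q j)"
    proof (cases "j = i")
      case True
      show ?thesis unfolding if_P[OF True] by (rule bsupp_mono[OF qi order_refl max.cobounded1])
    next
      case False
      with j have "j \<in> \<Lambda>" by blast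
      then have "bsupp (T + \<delta>) (max M' (2 * M / c)) (p j)"
        using bsupp_mono[OF pb order_refl, of j "max M' (2 * M / c)"] by simp
      then show ?thesis unfolding if_not_P[OF False] .
    qed
    fix k assume k: "k \<in> insert i \<Lambda>"
    show "moment (?q j) (lam k) = (if j = k then 1 else 0)"
    proof (cases "j = i")
      case True
      show ?thesis
      proof (cases "k = i")
        case False
        with k have "k \<in> \<Lambda>" by blast
        then show ?thesis unfolding if_P[OF \<open>j = i\<close>] using mi_k[of k] True False by simp
      qed (use True mi_i in simp)
    next
      case False
      with j have j: "j \<in> \<Lambda>" by blast
      show ?thesis
      proof (cases "k = i")
        case True
        then show ?thesis using p_i[OF j] False by simp
      next
        case k': False
        with k have "k \<in> \<Lambda>" by blast
        then show ?thesis using p_k[OF j, of k] False by simp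
      qed
    qed
  qed
qed

lemma biorthogonal_Un_finite:
  assumes "finite S" and bi: "biorthogonal T \<Lambda> lam" and T: "0 \<le> T"
    and sep: "separated \<gamma> (S \<union> \<Lambda>) lam" and \<gamma>: "\<gamma> > 0" and "T < T'"
  shows "biorthogonal T' (S \<union> \<Lambda>) lam"
  using assms(1,4,6)
proof (induction S arbitrary: T' rule: finite_induct)
  case empty
  then show ?case using biorthogonal_mono[OF bi, of T'] by simp
next
  case (insert i S)
  show ?case
  proof (cases "i \<in> \<Lambda>")
    case True
    then have "insert i S \<union> \<Lambda> = S \<union> \<Lambda>" by auto
    then show ?thesis using insert by simp
  next
    case False
    \<comment> \<open>The midpoint reserves positive time both for the earlier insertions and for
      the present one.\<close>
    define T'' where "T'' = (T + T') / 2"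
    have T'': "T < T''" "0 < T' - T''" using insert.prems by (auto simp: T''_def)
    have "biorthogonal T'' (S \<union> \<Lambda>) lam"
      using insert.prems T'' by (intro insert.IH separated_subset[OF insert.prems(1)]) auto
    from biorthogonal_insert[OF this _ _ T''(2) _ \<gamma>, of i] show ?thesis
      using False insert T T'' by auto
  qed
qed

text \<open>The two gaps have separate roles: the tail gap determines the time, through the
  frequencies left after removal of a finite set S; positivity of the full gap allows the
  frequencies in S to be inserted again.\<close>

lemma biorthogonal_gap:
  assumes gap: "gap a \<I> > 0" and T: "ereal T > ereal (2 * pi) / tail_gap a \<I>" and tail: "tail_gap a \<I> > 0"
  shows "biorthogonal T \<I> (eigval a)" "T > 0"
proof -
  have dist: "gap a J \<le> ereal \<bar>eigval a k - eigval a n\<bar>" if "k \<in> J" "n \<in> J" "k \<noteq> n" for J k n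
    unfolding gap_def using that by (intro INF_lower2[of "(k, n)"]) auto
  have sep: "separated \<gamma> J (eigval a)" if "ereal \<gamma> \<le> gap a J" for J \<gamma>
    unfolding separated_def using dist[of _ J] that by (meson ereal_less_eq(3) order_trans)
  show T0: "T > 0"
  proof -
    have "0 \<le> ereal (2 * pi) / tail_gap a \<I>" using tail by (cases "tail_gap a \<I>") auto
    then have "0 < ereal T" using T by (rule le_less_trans)
    then show ?thesis by simp
  qed
  have "ereal (2 * pi / T) < tail_gap a \<I>"
  proof (cases "tail_gap a \<I>")
    case (real \<tau>)
    then have "2 * pi / \<tau> < T" "0 < \<tau>" using T tail by auto
    then show ?thesis using real T0 by (simp add: field_simps)
  qed (use tail in auto)
  then obtain S where S: "finite S" "S \<subseteq> \<I>" "ereal (2 * pi / T) < gap a (\<I> - S)"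
    unfolding tail_gap_def less_SUP_iff by blast
  obtain \<gamma> where \<gamma>: "ereal (2 * pi / T) < ereal \<gamma>" "ereal \<gamma> \<le> gap a (\<I> - S)"
    using ereal_dense2[OF S(3)] by (auto intro: less_imp_le)
  obtain \<gamma>0 where \<gamma>0: "0 < ereal \<gamma>0" "ereal \<gamma>0 \<le> gap a \<I>"
    using ereal_dense2[OF gap] by (auto intro: less_imp_le)
  \<comment> \<open>The midpoint of pi / T and \<gamma> / 2: the first inequality makes the kernel
    shorter than T, strictly, which leaves time for the insertions; the second is Ingham's
    condition.\<close>
  define \<alpha> where "\<alpha> = (pi / T + \<gamma> / 2) / 2"
  have p: "0 < pi / T" using T0 by simp
  have "2 * (pi / T) < \<gamma>" using \<gamma>(1) by simp
  moreover have "0 < (x + y / 2) / 2 \<and> 2 * ((x + y / 2) / 2) < y \<and> x < (x + y / 2) / 2"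
    if "0 < x" "2 * x < y" for x y :: real
    using that by auto
  ultimately have \<alpha>: "0 < \<alpha>" "2 * \<alpha> < \<gamma>" "pi / T < \<alpha>"
    using p unfolding \<alpha>_def by blast+
  have "pi / \<alpha> < T" using \<alpha> T0 by (simp add: field_simps)
  have "biorthogonal (pi / \<alpha>) (\<I> - S) (eigval a)"
    using \<alpha> by (intro biorthogonal_separated[OF sep[OF \<gamma>(2)]]) auto
  note * = biorthogonal_Un_finite[OF S(1) this _ _ _ \<open>pi / \<alpha> < T\<close>, of \<gamma>0]
  show "biorthogonal T \<I> (eigval a)"
  proof -
    have "S \<union> (\<I> - S) = \<I>" using S(2) by blast
    with * \<alpha> \<gamma>0(1) sep[OF \<gamma>0(2)] show ?thesis by simp
  qed
qed

section \<open>Integration of dominated functions with values in a Sobolev space\<close>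

text \<open>The majorant c does not depend on t. The property passes through G, with another
  majorant, and through the evolution, and it reduces vector-valued integrals to scalar
  ones.\<close>

definition dominated :: "real \<Rightarrow> (int \<Rightarrow> real) \<Rightarrow> 'a measure \<Rightarrow> ('a \<Rightarrow> pdist) \<Rightarrow> bool" where
  "dominated s c M f \<longleftrightarrow> finite_measure M \<and> wl2 s c \<and> (\<forall>k. 0 \<le> c k) \<and>
     (\<forall>k. (\<lambda>t. fourier_coeff (f t) k) \<in> borel_measurable M) \<and>
     (\<forall>t\<in>space M. \<forall>k. cmod (fourier_coeff (f t) k) \<le> c k)"

lemma sobolev_boundI:
  assumes "wl2 s c" "\<And>k. cmod (fourier_coeff v k) \<le> c k"
  shows "v \<in> sobolev s" "sobolev_norm s v \<le> wnorm s c"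
  unfolding sobolev_wl2 sobolev_norm_wnorm
  using wl2_mono[OF assms(1), of "\<lambda>k. cmod (fourier_coeff v k)"] order_trans[OF assms(2) abs_ge_self] by auto

lemma sobolev_add:
  assumes "u \<in> sobolev s" "v \<in> sobolev s"
  shows "u + v \<in> sobolev s"
proof (rule sobolev_boundI(1))
  show "wl2 s (\<lambda>k. cmod (fourier_coeff u k) + cmod (fourier_coeff v k))"
    using assms by (intro wl2_add(1)) (simp_all add: sobolev_wl2)
qed (simp add: norm_triangle_ineq)

lemma sobolev_diff:
  assumes "u \<in> sobolev s" "v \<in> sobolev s"
  shows "u - v \<in> sobolev s"
proof (rule sobolev_boundI(1))
  show "wl2 s (\<lambda>k. cmod (fourier_coeff u k) + cmod (fourier_coeff v k))"
    using assms by (intro wl2_add(1)) (simp_all add: sobolev_wl2)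
qed (simp add: norm_triangle_ineq4)

lemma sobolev_scaleR: "v \<in> sobolev s \<Longrightarrow> r *\<^sub>R v \<in> sobolev s"
  by (rule sobolev_boundI(1)[OF wl2_cmult(1)[where r = "\<bar>r\<bar>"]]) (auto simp: sobolev_wl2)

lemma sobolev_zero: "0 \<in> sobolev s"
  by (simp add: sobolev_def)

lemma sobolev_sum: "(\<And>i. i \<in> I \<Longrightarrow> f i \<in> sobolev s) \<Longrightarrow> (\<Sum>i\<in>I. f i) \<in> sobolev s"
  by (induction I rule: infinite_finite_induct) (auto intro: sobolev_zero sobolev_add)

lemma sobolev_coeff_le:
  "v \<in> sobolev s \<Longrightarrow> cmod (fourier_coeff v k) \<le> jap k powr (- s) * sobolev_norm s v"
  using wl2_coordinate[of s "\<lambda>k. cmod (fourier_coeff v k)" k] by (simp add: sobolev_wl2 sobolev_norm_wnorm)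

lemma wnorm_tendsto_zero:
  assumes lim: "\<And>k. ((\<lambda>x. d x k) \<longlongrightarrow> 0) F"
    and dom: "eventually (\<lambda>x. \<forall>k. \<bar>d x k\<bar> \<le> c k) F" and c: "wl2 s c"
  shows "((\<lambda>x. wnorm s (d x)) \<longlongrightarrow> 0) F"
proof -
  have "((\<lambda>x. \<Sum>\<^sub>\<infinity>k. jap k powr (2 * s) * (d x k)\<^sup>2) \<longlongrightarrow> 0) F"
  proof (rule infsum_tendsto_zero_dominated[OF _ _ c[unfolded wl2_def]])
    show "((\<lambda>x. jap k powr (2 * s) * (d x k)\<^sup>2) \<longlongrightarrow> 0) F" for k
    proof (rule tendsto_mult_right_zero)
      show "((\<lambda>x. (d x k)\<^sup>2) \<longlongrightarrow> 0) F" using tendsto_power[OF lim[of k], of 2] by simp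
    qed
    show "\<forall>\<^sub>F x in F. \<forall>k. \<bar>jap k powr (2 * s) * (d x k)\<^sup>2\<bar> \<le> jap k powr (2 * s) * (c k)\<^sup>2"
      using dom
    proof eventually_elim
      case (elim x)
      show ?case
      proof
        fix k
        have "\<bar>d x k\<bar>\<^sup>2 \<le> (c k)\<^sup>2" using elim by (intro power_mono) auto
        then show "\<bar>jap k powr (2 * s) * (d x k)\<^sup>2\<bar> \<le> jap k powr (2 * s) * (c k)\<^sup>2"
          by (simp add: abs_mult mult_left_mono)
      qed
    qed
  qed
  then have "((\<lambda>x. sqrt (2 * pi * (\<Sum>\<^sub>\<infinity>k. jap k powr (2 * s) * (d x k)\<^sup>2))) \<longlongrightarrow> sqrt (2 * pi * 0)) F"
    by (intro tendsto_intros)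
  then show ?thesis by (simp add: wnorm_def)
qed

lemma sobolev_norm_measurable:
  assumes "\<And>k. (\<lambda>t. fourier_coeff (f t) k) \<in> borel_measurable M" "\<And>t. t \<in> space M \<Longrightarrow> f t \<in> sobolev s"
  shows "(\<lambda>t. sobolev_norm s (f t)) \<in> borel_measurable M"
proof -
  have [measurable]: "(\<lambda>t. \<Sum>\<^sub>\<infinity>k. jap k powr (2 * s) * (cmod (fourier_coeff (f t) k))\<^sup>2) \<in> borel_measurable M"
  proof (rule borel_measurable_infsum_int)
    show "(\<lambda>t. jap k powr (2 * s) * (cmod (fourier_coeff (f t) k))\<^sup>2) \<in> borel_measurable M" for k
      using assms(1)[of k] by measurable
  qed (use assms(2) in \<open>simp add: sobolev_wl2 wl2_def\<close>)
  show ?thesis unfolding sobolev_norm_wnorm wnorm_def by measurable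
qed

lemma dominatedD:
  assumes "dominated s c M f"
  shows "finite_measure M" "wl2 s c" "0 \<le> c k" "(\<lambda>t. fourier_coeff (f t) k) \<in> borel_measurable M"
    "t \<in> space M \<Longrightarrow> cmod (fourier_coeff (f t) k) \<le> c k" "t \<in> space M \<Longrightarrow> f t \<in> sobolev s"
    "t \<in> space M \<Longrightarrow> sobolev_norm s (f t) \<le> wnorm s c"
    "integrable M (\<lambda>t. fourier_coeff (f t) k)"
proof -
  show 1: "finite_measure M" "wl2 s c" "0 \<le> c k" "(\<lambda>t. fourier_coeff (f t) k) \<in> borel_measurable M"
    and 2: "t \<in> space M \<Longrightarrow> cmod (fourier_coeff (f t) k) \<le> c k" for k t
    using assms unfolding dominated_def by auto
  show "t \<in> space M \<Longrightarrow> f t \<in> sobolev s" "t \<in> space M \<Longrightarrow> sobolev_norm s (f t) \<le> wnorm s c"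
    using sobolev_boundI[OF 1(2), of "f t"] 2 by auto
  show "integrable M (\<lambda>t. fourier_coeff (f t) k)"
    by (rule finite_measure.integrable_const_bound[OF 1(1) AE_I2[OF 2] 1(4)])
qed

definition pd_mode :: "int \<Rightarrow> pdist" where
  "pd_mode j = pd_of_coeffs (\<lambda>k. if k = j then 1 else 0)"

lemma fourier_coeff_pd_mode: "fourier_coeff (pd_mode j) k = (if k = j then 1 else 0)"
  unfolding pd_mode_def
  by (rule fourier_coeff_pd_of_coeffs[of 0], rule wl2_finite[of "{j}"]) auto

text \<open>Each coefficient is approximated by scalar simple functions, and the n-th step keeps the
  modes with |k| \<le> n, so its values form a finite set. The factor 2 comes from
  \<open>borel_measurable_implies_sequence_metric\<close>, which at most doubles the distance to
  0.\<close>

lemma dominated_simple_approx: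
  assumes f: "dominated s c M f"
  shows "\<exists>\<sigma> :: nat \<Rightarrow> 'a \<Rightarrow> pdist. \<forall>n. simple_function M (\<sigma> n) \<and> (\<forall>t\<in>space M. \<sigma> n t \<in> sobolev s \<and>
    (\<forall>k. cmod (fourier_coeff (\<sigma> n t) k) \<le> 2 * c k \<and>
      (\<lambda>n. fourier_coeff (\<sigma> n t) k) \<longlonglongrightarrow> fourier_coeff (f t) k))"
proof -
  note D = dominatedD[OF f]
  have "\<exists>F. (\<forall>i. simple_function M (F i)) \<and> (\<forall>t\<in>space M. (\<lambda>i. F i t) \<longlonglongrightarrow> fourier_coeff (f t) k) \<and>
      (\<forall>i. \<forall>t\<in>space M. dist (F i t) 0 \<le> 2 * dist (fourier_coeff (f t) k) 0)" for k
    by (rule borel_measurable_implies_sequence_metric[OF D(4)])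
  then obtain F where F: "\<And>k i. simple_function M (F k i)"
    "\<And>k t. t \<in> space M \<Longrightarrow> (\<lambda>i. F k i t) \<longlonglongrightarrow> fourier_coeff (f t) k"
    "\<And>k i t. t \<in> space M \<Longrightarrow> cmod (F k i t) \<le> 2 * cmod (fourier_coeff (f t) k)"
    by simp metis
  define \<sigma> where "\<sigma> n t = (\<Sum>j\<in>{- int n..int n}. pd_scale (F j n t) (pd_mode j))" for n t
  have co: "fourier_coeff (\<sigma> n t) k = (if \<bar>k\<bar> \<le> int n then F k n t else 0)" for n t k
  proof -
    have "fourier_coeff (\<sigma> n t) k = (\<Sum>j\<in>{- int n..int n}. if j = k then F k n t else 0)"
      unfolding \<sigma>_def fourier_coeff_sum by (intro sum.cong) (auto simp: fourier_coeff_pd_mode)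
    then show ?thesis by (auto simp: abs_le_iff)
  qed
  show ?thesis
  proof (intro exI[of _ \<sigma>] allI ballI conjI)
    show "simple_function M (\<sigma> n)" for n
      unfolding \<sigma>_def[abs_def] by (intro simple_function_sum simple_function_compose1[OF F(1)])
    show le: "cmod (fourier_coeff (\<sigma> n t) k) \<le> 2 * c k" if "t \<in> space M" for n t k
      using F(3)[OF that, of k n] D(5)[OF that, of k] D(3)[of k] unfolding co by auto
    show "\<sigma> n t \<in> sobolev s" if "t \<in> space M" for n t
      by (rule sobolev_boundI(1)[OF wl2_cmult(1)[OF D(2)] le[OF that]])
    show "(\<lambda>n. fourier_coeff (\<sigma> n t) k) \<longlonglongrightarrow> fourier_coeff (f t) k" if "t \<in> space M" for t k
    proof (rule Lim_transform_eventually[OF F(2)[OF that]])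
      show "\<forall>\<^sub>F n in sequentially. F k n t = fourier_coeff (\<sigma> n t) k"
        using eventually_ge_at_top[of "nat \<bar>k\<bar>"] by eventually_elim (auto simp: co)
    qed
  qed
qed

lemma dominated_approx_tendsto:
  assumes f: "dominated s c M f" and t: "t \<in> space M"
    and v: "\<And>n k. cmod (fourier_coeff (v n) k) \<le> 2 * c k" 
    "\<And>k. (\<lambda>n. fourier_coeff (v n) k) \<longlonglongrightarrow> fourier_coeff (f t) k"
  shows "(\<lambda>n. sobolev_norm s (f t - v n)) \<longlonglongrightarrow> 0"
    and "sobolev_norm s (f t - v n) \<le> wnorm s (\<lambda>k. 3 * c k)"
proof -
  note D = dominatedD[OF f]
  have b: "cmod (fourier_coeff (f t - v n) k) \<le> 3 * c k" for n k
    using norm_triangle_ineq4[of "fourier_coeff (f t) k" "fourier_coeff (v n) k"] D(5)[OF t, of k] v(1)[of n k]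
    by simp
  show "sobolev_norm s (f t - v n) \<le> wnorm s (\<lambda>k. 3 * c k)"
    by (rule sobolev_boundI(2)[OF wl2_cmult(1)[OF D(2)] b])
  show "(\<lambda>n. sobolev_norm s (f t - v n)) \<longlonglongrightarrow> 0"
    unfolding sobolev_norm_wnorm
  proof (rule wnorm_tendsto_zero[OF _ _ wl2_cmult(1)[OF D(2), of 3]])
    show "(\<lambda>n. cmod (fourier_coeff (f t - v n) k)) \<longlonglongrightarrow> 0" for k
      using tendsto_norm_zero[OF LIM_zero[OF v(2)[of k]]] by (simp add: norm_minus_commute)
  qed (use b in auto)
qed

lemma dominated_sobolev_measurable:
  assumes f: "dominated s c M f"
  shows "sobolev_measurable s M f"
proof -
  obtain \<sigma> where \<sigma>: "\<And>n. simple_function M (\<sigma> n)" "\<And>n t. t \<in> space M \<Longrightarrow> \<sigma> n t \<in> sobolev s"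
    "\<And>n t k. t \<in> space M \<Longrightarrow> cmod (fourier_coeff (\<sigma> n t) k) \<le> 2 * c k"
    "\<And>t k. t \<in> space M \<Longrightarrow> (\<lambda>n. fourier_coeff (\<sigma> n t) k) \<longlonglongrightarrow> fourier_coeff (f t) k"
    using dominated_simple_approx[OF f] by blast
  show ?thesis
    unfolding sobolev_measurable_def
  proof (intro conjI exI[of _ \<sigma>] ballI allI AE_I2)
    show "(\<lambda>n. sobolev_norm s (f t - \<sigma> n t)) \<longlonglongrightarrow> 0" if "t \<in> space M" for t
      by (rule dominated_approx_tendsto(1)[where v = "\<lambda>n. \<sigma> n t", OF f that \<sigma>(3,4)[OF that]])
  qed (use \<sigma> dominatedD(6)[OF f] in auto)
qed

text \<open>The candidate is the distribution with the scalar integrals as coefficients. Dominated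
  convergence in t, with a constant majorant, gives the first limit in the definition of the
  integral; dominated convergence in t and then in k gives the second.\<close>

lemma dominated_has_sobolev_integral:
  assumes f: "dominated s c M f"
  shows "has_sobolev_integral s M f (pd_of_coeffs (\<lambda>k. integral\<^sup>L M (\<lambda>t. fourier_coeff (f t) k)))"
    and "fourier_coeff (pd_of_coeffs (\<lambda>k. integral\<^sup>L M (\<lambda>t. fourier_coeff (f t) k))) k
      = integral\<^sup>L M (\<lambda>t. fourier_coeff (f t) k)"
proof -
  note D = dominatedD[OF f]
  interpret finite_measure M by (rule D(1))
  define \<mu> where "\<mu> = measure M (space M)"
  have \<mu>: "0 \<le> \<mu>" by (simp add: \<mu>_def)
  define J where "J = pd_of_coeffs (\<lambda>k. integral\<^sup>L M (\<lambda>t. fourier_coeff (f t) k))"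
  have ib: "cmod (integral\<^sup>L M F) \<le> b * \<mu>" if "integrable M F" "\<And>t. t \<in> space M \<Longrightarrow> cmod (F t) \<le> b" for F b
  proof -
    have "cmod (integral\<^sup>L M F) \<le> integral\<^sup>L M (\<lambda>t. cmod (F t))" by (rule integral_norm_bound)
    also have "\<dots> \<le> integral\<^sup>L M (\<lambda>t. b)" using that by (intro integral_mono) auto
    finally show ?thesis by (simp add: \<mu>_def mult.commute)
  qed
  have Jb: "cmod (integral\<^sup>L M (\<lambda>t. fourier_coeff (f t) k)) \<le> \<mu> * c k" for k
    using ib[OF D(8)[of k] D(5)] by (simp add: mult.commute)
  have wJ: "wl2 s (\<lambda>k. cmod (integral\<^sup>L M (\<lambda>t. fourier_coeff (f t) k)))"
    by (rule wl2_mono(1)[OF wl2_cmult(1)[OF D(2), of \<mu>]]) (use Jb D(3) \<mu> in auto)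
  have Jc: "fourier_coeff J k = integral\<^sup>L M (\<lambda>t. fourier_coeff (f t) k)" for k
    unfolding J_def by (rule fourier_coeff_pd_of_coeffs[OF wJ])
  then show "fourier_coeff (pd_of_coeffs (\<lambda>k. integral\<^sup>L M (\<lambda>t. fourier_coeff (f t) k))) k
      = integral\<^sup>L M (\<lambda>t. fourier_coeff (f t) k)" by (simp add: J_def)
  have J: "J \<in> sobolev s" using wJ by (simp add: sobolev_wl2 Jc)
  obtain \<sigma> where \<sigma>: "\<And>n. simple_function M (\<sigma> n)" "\<And>n t. t \<in> space M \<Longrightarrow> \<sigma> n t \<in> sobolev s"
    "\<And>n t k. t \<in> space M \<Longrightarrow> cmod (fourier_coeff (\<sigma> n t) k) \<le> 2 * c k"
    "\<And>t k. t \<in> space M \<Longrightarrow> (\<lambda>n. fourier_coeff (\<sigma> n t) k) \<longlonglongrightarrow> fourier_coeff (f t) k"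
    using dominated_simple_approx[OF f] by blast
  have approx0: "(\<lambda>n. sobolev_norm s (f t - \<sigma> n t)) \<longlonglongrightarrow> 0"
    and approx3: "sobolev_norm s (f t - \<sigma> n t) \<le> wnorm s (\<lambda>k. 3 * c k)" if "t \<in> space M" for n t
    using dominated_approx_tendsto[where v = "\<lambda>n. \<sigma> n t", OF f that \<sigma>(3,4)[OF that]] by auto
  have si: "Bochner_Integration.simple_bochner_integrable M (\<sigma> n)" for n
    by (rule simple_bochner_integrable.intros[OF \<sigma>(1)]) simp
  have sfc: "simple_function M (\<lambda>t. fourier_coeff (\<sigma> n t) k)" for n k
    by (rule simple_function_compose1[OF \<sigma>(1)])
  have sic: "Bochner_Integration.simple_bochner_integrable M (\<lambda>t. fourier_coeff (\<sigma> n t) k)" for n k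
    by (rule simple_bochner_integrable.intros[OF sfc]) simp
  have me: "(\<lambda>t. fourier_coeff (\<sigma> n t) k) \<in> borel_measurable M" for n k
    by (rule borel_measurable_simple_function[OF sfc])
  \<comment> \<open>For simple functions the integral is a finite sum, so the linear coefficient map
    passes through it.\<close>
  have int_co: "fourier_coeff (Bochner_Integration.simple_bochner_integral M (\<sigma> n)) k
      = integral\<^sup>L M (\<lambda>t. fourier_coeff (\<sigma> n t) k)" for n k
    using simple_bochner_integral_linear[OF linear_fourier_coeff[of k] si[of n]]
      simple_bochner_integrable_eq_integral[OF sic] by simp
  have "(\<lambda>n. \<integral>\<^sup>+t. ennreal (sobolev_norm s (f t - \<sigma> n t)) \<partial>M) \<longlonglongrightarrow> (\<integral>\<^sup>+t. 0 \<partial>M)"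
  proof (rule nn_integral_dominated_convergence[where w = "\<lambda>_. ennreal (wnorm s (\<lambda>k. 3 * c k))"])
    show "(\<lambda>t. ennreal (sobolev_norm s (f t - \<sigma> n t))) \<in> borel_measurable M" for n
    proof -
      have "(\<lambda>t. sobolev_norm s (f t - \<sigma> n t)) \<in> borel_measurable M"
      proof (rule sobolev_norm_measurable)
        show "(\<lambda>t. fourier_coeff (f t - \<sigma> n t) k) \<in> borel_measurable M" for k
          using D(4)[of k] me[of n k] by simp
      qed (use sobolev_diff D(6) \<sigma>(2) in blast)
      then show ?thesis by measurable
    qed
    show "AE t in M. ennreal (sobolev_norm s (f t - \<sigma> n t)) \<le> ennreal (wnorm s (\<lambda>k. 3 * c k))" for n
      by (intro AE_I2 ennreal_leI approx3)
    show "(\<integral>\<^sup>+t. ennreal (wnorm s (\<lambda>k. 3 * c k)) \<partial>M) < \<infinity>"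
      by (simp add: ennreal_mult_less_top emeasure_eq_measure)
    show "AE t in M. (\<lambda>n. ennreal (sobolev_norm s (f t - \<sigma> n t))) \<longlonglongrightarrow> 0"
      using tendsto_ennrealI[OF approx0] by (intro AE_I2) simp
  qed auto
  then have lim1: "(\<lambda>n. \<integral>\<^sup>+t. ennreal (sobolev_norm s (f t - \<sigma> n t)) \<partial>M) \<longlonglongrightarrow> 0" by simp
  have lim2: "(\<lambda>n. sobolev_norm s (Bochner_Integration.simple_bochner_integral M (\<sigma> n) - J)) \<longlonglongrightarrow> 0"
    unfolding sobolev_norm_wnorm
  proof (rule wnorm_tendsto_zero[OF _ _ wl2_cmult(1)[OF D(2), of "3 * \<mu>"]])
    show "(\<lambda>n. cmod (fourier_coeff (Bochner_Integration.simple_bochner_integral M (\<sigma> n) - J) k)) \<longlonglongrightarrow> 0" for k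
    proof -
      have "(\<lambda>n. integral\<^sup>L M (\<lambda>t. fourier_coeff (\<sigma> n t) k)) \<longlonglongrightarrow> integral\<^sup>L M (\<lambda>t. fourier_coeff (f t) k)"
        by (rule integral_dominated_convergence[where w = "\<lambda>_. 2 * c k"])
           (use D(4) me \<sigma>(3,4) in auto)
      from tendsto_norm_zero[OF LIM_zero[OF this]] show ?thesis by (simp add: int_co Jc)
    qed
    have "cmod (fourier_coeff (Bochner_Integration.simple_bochner_integral M (\<sigma> n) - J) k) \<le> 3 * \<mu> * c k" for n k
    proof -
      have "integrable M (\<lambda>t. fourier_coeff (\<sigma> n t) k)"
        by (rule integrable_const_bound[where B = "2 * c k"]) (use \<sigma>(3) me in auto)
      from ib[OF this \<sigma>(3)] Jb[of k]
        norm_triangle_ineq4[of "integral\<^sup>L M (\<lambda>t. fourier_coeff (\<sigma> n t) k)" "integral\<^sup>L M (\<lambda>t. fourier_coeff (f t) k)"]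
      show ?thesis by (simp add: int_co Jc mult_ac)
    qed
    then show "\<forall>\<^sub>F n in sequentially. \<forall>k. \<bar>cmod (fourier_coeff (Bochner_Integration.simple_bochner_integral M (\<sigma> n) - J) k)\<bar> \<le> 3 * \<mu> * c k"
      by simp
  qed
  show "has_sobolev_integral s M f (pd_of_coeffs (\<lambda>k. integral\<^sup>L M (\<lambda>t. fourier_coeff (f t) k)))"
    unfolding has_sobolev_integral_def J_def[symmetric]
    using dominated_sobolev_measurable[OF f] J si \<sigma>(2) lim1 lim2 by blast
qed

text \<open>The definition of the integral admits any approximating simple functions, without
  domination. Each Fourier coefficient is a bounded functional on the Sobolev space, so it survives
  both limits in that definition. Uniqueness of the mild solution rests on this.\<close>

lemma dominated_sobolev_integral_unique:
  assumes f: "dominated s c M f" and I: "has_sobolev_integral s M f J"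
  shows "fourier_coeff J k = integral\<^sup>L M (\<lambda>t. fourier_coeff (f t) k)"
proof -
  note D = dominatedD[OF f]
  have J: "J \<in> sobolev s" using I by (simp add: has_sobolev_integral_def)
  from I[unfolded has_sobolev_integral_def, THEN conjunct2, THEN conjunct2] obtain \<sigma> where
    \<sigma>0: "\<forall>n. Bochner_Integration.simple_bochner_integrable M (\<sigma> n)" "\<forall>n. \<forall>t\<in>space M. \<sigma> n t \<in> sobolev s"
    and lim1: "(\<lambda>n. \<integral>\<^sup>+t. ennreal (sobolev_norm s (f t - \<sigma> n t)) \<partial>M) \<longlonglongrightarrow> 0"
    and lim2: "(\<lambda>n. sobolev_norm s (Bochner_Integration.simple_bochner_integral M (\<sigma> n) - J)) \<longlonglongrightarrow> 0"
    by (elim exE conjE)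
  have \<sigma>: "Bochner_Integration.simple_bochner_integrable M (\<sigma> n)"
    "t \<in> space M \<Longrightarrow> \<sigma> n t \<in> sobolev s" for n t using \<sigma>0 by auto
  let ?C = "jap k powr (- s)"
  let ?I = "\<lambda>n. Bochner_Integration.simple_bochner_integral M (\<sigma> n)"
  have sfc: "simple_function M (\<lambda>t. fourier_coeff (\<sigma> n t) j)" for n j
  proof (rule simple_function_compose1[where f = "\<sigma> n"])
    show "simple_function M (\<sigma> n)"
      using \<sigma>(1)[of n] by (auto elim: simple_bochner_integrable.cases)
  qed
  have me: "(\<lambda>t. fourier_coeff (\<sigma> n t) j) \<in> borel_measurable M" for n j
    by (rule borel_measurable_simple_function[OF sfc])
  have sic: "Bochner_Integration.simple_bochner_integrable M (\<lambda>t. fourier_coeff (\<sigma> n t) k)" for n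
    using simple_bochner_integrable_compose2[where p = "\<lambda>x y. fourier_coeff x k", OF _ \<sigma>(1) \<sigma>(1)] by simp
  have int_co: "fourier_coeff (?I n) k = integral\<^sup>L M (\<lambda>t. fourier_coeff (\<sigma> n t) k)" for n
    using simple_bochner_integral_linear[OF linear_fourier_coeff[of k] \<sigma>(1)[of n]]
      simple_bochner_integrable_eq_integral[OF sic] by simp
  have si: "integrable M (\<lambda>t. fourier_coeff (\<sigma> n t) k)" for n
    using has_bochner_integral_simple_bochner_integrable[OF sic] by (rule integrable.intros)
  have Is: "?I n \<in> sobolev s" for n
    unfolding simple_bochner_integral_def using \<sigma>(2) by (intro sobolev_sum sobolev_scaleR) auto
  have "(\<lambda>n. fourier_coeff (?I n) k) \<longlonglongrightarrow> fourier_coeff J k"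
  proof (rule LIM_zero_cancel, rule Lim_null_comparison)
    show "\<forall>\<^sub>F n in sequentially. norm (fourier_coeff (?I n) k - fourier_coeff J k) \<le> ?C * sobolev_norm s (?I n - J)"
      using sobolev_coeff_le[OF sobolev_diff[OF Is J], where k = k] by simp
    show "(\<lambda>n. ?C * sobolev_norm s (?I n - J)) \<longlonglongrightarrow> 0"
      using tendsto_mult_right_zero[OF lim2] .
  qed
  moreover have "(\<lambda>n. fourier_coeff (?I n) k) \<longlonglongrightarrow> integral\<^sup>L M (\<lambda>t. fourier_coeff (f t) k)"
  proof (rule LIM_zero_cancel, rule tendsto_norm_zero_cancel)
    have meN: "(\<lambda>t. sobolev_norm s (f t - \<sigma> n t)) \<in> borel_measurable M" for n
    proof (rule sobolev_norm_measurable)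
      show "(\<lambda>t. fourier_coeff (f t - \<sigma> n t) k) \<in> borel_measurable M" for k
        using D(4)[of k] me[of n k] by simp
    qed (use sobolev_diff D(6) \<sigma>(2) in blast)
    have le: "ennreal (norm (fourier_coeff (?I n) k - integral\<^sup>L M (\<lambda>t. fourier_coeff (f t) k)))
        \<le> ennreal ?C * (\<integral>\<^sup>+t. ennreal (sobolev_norm s (f t - \<sigma> n t)) \<partial>M)" for n
    proof -
      have i: "integrable M (\<lambda>t. fourier_coeff (\<sigma> n t) k - fourier_coeff (f t) k)" using si D(8) by simp
      have "fourier_coeff (?I n) k - integral\<^sup>L M (\<lambda>t. fourier_coeff (f t) k)
          = integral\<^sup>L M (\<lambda>t. fourier_coeff (\<sigma> n t) k - fourier_coeff (f t) k)"
        using si[of n] D(8)[of k] by (simp add: int_co)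
      then have "ennreal (norm (fourier_coeff (?I n) k - integral\<^sup>L M (\<lambda>t. fourier_coeff (f t) k)))
          \<le> (\<integral>\<^sup>+t. ennreal (norm (fourier_coeff (\<sigma> n t) k - fourier_coeff (f t) k)) \<partial>M)"
        using integral_norm_bound_ennreal[OF i] by simp
      also have "\<dots> \<le> (\<integral>\<^sup>+t. ennreal ?C * ennreal (sobolev_norm s (f t - \<sigma> n t)) \<partial>M)"
      proof (rule nn_integral_mono)
        fix t assume "t \<in> space M"
        then have "f t - \<sigma> n t \<in> sobolev s" using sobolev_diff D(6) \<sigma>(2) by blast
        from sobolev_coeff_le[OF this, of k]
        show "ennreal (norm (fourier_coeff (\<sigma> n t) k - fourier_coeff (f t) k)) \<le> ennreal ?C * ennreal (sobolev_norm s (f t - \<sigma> n t))"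
          by (simp add: norm_minus_commute ennreal_leI flip: ennreal_mult')
      qed
      also have "\<dots> = ennreal ?C * (\<integral>\<^sup>+t. ennreal (sobolev_norm s (f t - \<sigma> n t)) \<partial>M)"
        using meN by (intro nn_integral_cmult) measurable
      finally show ?thesis .
    qed
    have "(\<lambda>n. ennreal ?C * (\<integral>\<^sup>+t. ennreal (sobolev_norm s (f t - \<sigma> n t)) \<partial>M)) \<longlonglongrightarrow> ennreal ?C * 0"
      by (intro tendsto_mult_ennreal tendsto_const lim1) auto
    then have up: "(\<lambda>n. ennreal ?C * (\<integral>\<^sup>+t. ennreal (sobolev_norm s (f t - \<sigma> n t)) \<partial>M)) \<longlonglongrightarrow> 0" by simp
    have "(\<lambda>n. ennreal (norm (fourier_coeff (?I n) k - integral\<^sup>L M (\<lambda>t. fourier_coeff (f t) k)))) \<longlonglongrightarrow> ennreal 0"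
      unfolding ennreal_0 by (rule tendsto_sandwich[OF _ _ tendsto_const up]) (simp_all add: le)
    then show "(\<lambda>n. norm (fourier_coeff (?I n) k - integral\<^sup>L M (\<lambda>t. fourier_coeff (f t) k))) \<longlonglongrightarrow> 0"
      by (rule tendsto_ennrealD) auto
  qed
  ultimately show ?thesis by (rule LIMSEQ_unique)
qed

text \<open>The majorant makes the tails in k uniformly small in t, so continuity of the single
  coefficients suffices.\<close>

lemma sobolev_continuous_onI:
  assumes c: "wl2 s c" and b: "\<And>t k. t \<in> S \<Longrightarrow> cmod (fourier_coeff (u t) k) \<le> c k"
    and cont: "\<And>k. continuous_on S (\<lambda>t. fourier_coeff (u t) k)"
  shows "sobolev_continuous_on s S u"
  unfolding sobolev_continuous_on_def
proof (intro conjI ballI)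
  show "u t \<in> sobolev s" if "t \<in> S" for t by (rule sobolev_boundI(1)[OF c b[OF that]])
  fix t assume t: "t \<in> S"
  show "((\<lambda>t'. sobolev_norm s (u t' - u t)) \<longlongrightarrow> 0) (at t within S)"
    unfolding sobolev_norm_wnorm
  proof (rule wnorm_tendsto_zero[OF _ _ wl2_cmult(1)[OF c, of 2]])
    show "((\<lambda>t'. cmod (fourier_coeff (u t' - u t) k)) \<longlongrightarrow> 0) (at t within S)" for k
      using tendsto_norm_zero[OF LIM_zero[OF cont[unfolded continuous_on_def, rule_format, OF t, of k]]] by simp
    show "\<forall>\<^sub>F t' in at t within S. \<forall>k. \<bar>cmod (fourier_coeff (u t' - u t) k)\<bar> \<le> 2 * c k"
      unfolding eventually_at_filter
    proof (intro always_eventually allI impI)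
      fix t' k assume "t' \<in> S"
      then show "\<bar>cmod (fourier_coeff (u t' - u t) k)\<bar> \<le> 2 * c k"
        using b[of t' k] b[OF t, of k] norm_triangle_ineq4[of "fourier_coeff (u t') k" "fourier_coeff (u t) k"]
        by simp
    qed
  qed
qed

text \<open>The factor \<phi> stands for the exponentials of the moment problem: the second claim
  says that G commutes with taking moments in time.\<close>

lemma dominated_control_op:
  assumes g: "control_profile g" and f: "dominated s c M f"
  shows "dominated s (\<lambda>k. \<Sum>\<^sub>\<infinity>m. cmod (Gmat g k m) * c m) M (\<lambda>t. control_op g (f t))"
    and "\<lbrakk>\<phi> \<in> borel_measurable M; \<And>t. cmod (\<phi> t) \<le> 1\<rbrakk> \<Longrightarrow>
      integral\<^sup>L M (\<lambda>t. \<phi> t * fourier_coeff (control_op g (f t)) k)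
      = (\<Sum>\<^sub>\<infinity>l. Gmat g k l * integral\<^sup>L M (\<lambda>t. \<phi> t * fourier_coeff (f t) l))"
proof -
  note D = dominatedD[OF f]
  interpret finite_measure M by (rule D(1))
  have G: "(\<lambda>m. cmod (Gmat g k m) * c m) summable_on UNIV" "wl2 s (\<lambda>k. \<Sum>\<^sub>\<infinity>m. cmod (Gmat g k m) * c m)" for k
    using Gmat_bounded[OF control_profile_smooth[OF g], of s] D(2,3) by auto
  have b: "cmod (Gmat g k m * fourier_coeff (f t) m) \<le> cmod (Gmat g k m) * c m" if "t \<in> space M" for t k m
    using D(5)[OF that] by (simp add: norm_mult mult_left_mono)
  have me: "(\<lambda>t. Gmat g k m * fourier_coeff (f t) m) \<in> borel_measurable M" for k m
    using D(4)[of m] by measurable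
  have eq: "fourier_coeff (control_op g (f t)) k = (\<Sum>\<^sub>\<infinity>m. Gmat g k m * fourier_coeff (f t) m)" if "t \<in> space M" for t k
    by (rule fourier_coeff_control_op[OF g D(6)[OF that]])
  show "dominated s (\<lambda>k. \<Sum>\<^sub>\<infinity>m. cmod (Gmat g k m) * c m) M (\<lambda>t. control_op g (f t))"
    unfolding dominated_def
  proof (intro conjI allI ballI)
    show "(\<lambda>t. fourier_coeff (control_op g (f t)) k) \<in> borel_measurable M" for k
    proof -
      have "(\<lambda>t. \<Sum>\<^sub>\<infinity>m. Gmat g k m * fourier_coeff (f t) m) \<in> borel_measurable M"
        by (rule borel_measurable_infsum_int[OF me summable_on_dominated(2)[OF G(1) b]])
      then show ?thesis by (subst measurable_cong[OF eq])
    qed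
    show "cmod (fourier_coeff (control_op g (f t)) k) \<le> (\<Sum>\<^sub>\<infinity>m. cmod (Gmat g k m) * c m)" if "t \<in> space M" for t k
      unfolding eq[OF that] by (rule summable_on_dominated(3)[OF G(1) b[OF that]])
    show "0 \<le> (\<Sum>\<^sub>\<infinity>m. cmod (Gmat g k m) * c m)" for k
      by (intro infsum_nonneg mult_nonneg_nonneg D(3)) auto
  qed (fact D(1) G(2))+
  assume \<phi>: "\<phi> \<in> borel_measurable M" "\<And>t. cmod (\<phi> t) \<le> 1"
  have "integral\<^sup>L M (\<lambda>t. \<phi> t * fourier_coeff (control_op g (f t)) k)
      = integral\<^sup>L M (\<lambda>t. \<Sum>\<^sub>\<infinity>m. \<phi> t * (Gmat g k m * fourier_coeff (f t) m))"
    by (rule Bochner_Integration.integral_cong) (simp_all add: eq infsum_cmult_right')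
  also have "\<dots> = (\<Sum>\<^sub>\<infinity>m. integral\<^sup>L M (\<lambda>t. \<phi> t * (Gmat g k m * fourier_coeff (f t) m)))"
  proof (rule integral_infsum_int(2)[where b = "\<lambda>_. 1", OF _ _ _ G(1)])
    show "(\<lambda>t. \<phi> t * (Gmat g k m * fourier_coeff (f t) m)) \<in> borel_measurable M" for m
      using \<phi>(1) me[of k m] by measurable
    show "norm (\<phi> t * (Gmat g k m * fourier_coeff (f t) m)) \<le> cmod (Gmat g k m) * c m * 1" if "t \<in> space M" for m t
    proof -
      have "cmod (\<phi> t) * cmod (Gmat g k m * fourier_coeff (f t) m) \<le> 1 * (cmod (Gmat g k m) * c m)"
        by (intro mult_mono \<phi>(2) b[OF that]) auto
      then show ?thesis by (simp add: norm_mult)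
    qed
  qed (use D(3) in auto)
  also have "\<dots> = (\<Sum>\<^sub>\<infinity>l. Gmat g k l * integral\<^sup>L M (\<lambda>t. \<phi> t * fourier_coeff (f t) l))"
    by (simp only: mult.left_commute[of "\<phi> _"] integral_mult_right_zero)
  finally show "integral\<^sup>L M (\<lambda>t. \<phi> t * fourier_coeff (control_op g (f t)) k)
      = (\<Sum>\<^sub>\<infinity>l. Gmat g k l * integral\<^sup>L M (\<lambda>t. \<phi> t * fourier_coeff (f t) l))" .
qed

section \<open>The controlled system\<close>

lemma lebesgue_on_interval_finite: "finite_measure (lebesgue_on {0..t::real})"
  by (rule finite_measure_lebesgue_on) (metis cbox_interval lmeasurable_cbox)

lemma borel_measurable_lebesgue_on:
  "f \<in> borel_measurable borel \<Longrightarrow> f \<in> borel_measurable (lebesgue_on S)"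
  by (intro measurable_restrict_space1 measurable_completion) simp

lemma integral_lebesgue_on_const:
  assumes "0 \<le> t"
  shows "integral\<^sup>L (lebesgue_on {0..t}) (\<lambda>_. b) = t * (b :: real)"
  using lebesgue_integral_eq_integral[of "{0..t}" "\<lambda>_. b"] assms by simp

lemma integral_lebesgue_on_bound:
  fixes f :: "real \<Rightarrow> complex"
  assumes "integrable (lebesgue_on {0..t}) f" "\<And>x. x \<in> {0..t} \<Longrightarrow> cmod (f x) \<le> b" "0 \<le> t"
  shows "cmod (integral\<^sup>L (lebesgue_on {0..t}) f) \<le> t * b"
proof -
  have "cmod (integral\<^sup>L (lebesgue_on {0..t}) f) \<le> integral\<^sup>L (lebesgue_on {0..t}) (\<lambda>x. cmod (f x))"
    by (rule integral_norm_bound)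
  also have "\<dots> \<le> integral\<^sup>L (lebesgue_on {0..t}) (\<lambda>_. b)"
    using assms by (intro integral_mono) auto
  finally show ?thesis by (simp only: integral_lebesgue_on_const[OF assms(3)])
qed

lemma moment_lebesgue_on:
  assumes q: "bsupp T M q"
  shows "integral\<^sup>L (lebesgue_on {0..T}) (\<lambda>t. q t * cis (- (\<xi> * t))) = moment q \<xi>"
proof -
  have [measurable]: "q \<in> borel_measurable borel" using q by (simp add: bsupp_def)
  have "integral\<^sup>L (lebesgue_on {0..T}) (\<lambda>t. q t * cis (- (\<xi> * t)))
      = integral\<^sup>L lebesgue (\<lambda>t. indicator {0..T} t *\<^sub>R (q t * cis (- (\<xi> * t))))"
    by (rule integral_restrict_space) simp
  also have "(\<lambda>t. indicator {0..T} t *\<^sub>R (q t * cis (- (\<xi> * t)))) = (\<lambda>t. q t * cis (- (\<xi> * t)))"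
    using q by (auto simp: bsupp_def indicator_def)
  also have "integral\<^sup>L lebesgue (\<lambda>t. q t * cis (- (\<xi> * t))) = moment q \<xi>"
    unfolding moment_def by (rule integral_completion) measurable
  finally show ?thesis .
qed

lemma eigval_growth:
  assumes r: "r \<ge> 1" and C: "C > 0" and growth: "\<And>k. \<bar>k\<bar> \<ge> k0 \<Longrightarrow> \<bar>a k\<bar> \<le> C * of_int \<bar>k\<bar> powr (r - 1)"
  obtains C' where "0 \<le> C'" "\<And>k. \<bar>eigval a k\<bar> \<le> C' * jap k powr r"
proof -
  \<comment> \<open>Absorbs the finitely many indices for which the growth condition says
    nothing.\<close>
  define S where "S = (\<Sum>k\<in>{- k0..k0}. \<bar>eigval a k\<bar>)"
  have S: "0 \<le> S" unfolding S_def by (intro sum_nonneg) simp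
  have "\<bar>eigval a k\<bar> \<le> (C + S) * jap k powr r" for k
  proof (cases "\<bar>k\<bar> \<ge> k0 \<and> k \<noteq> 0")
    case True
    have "\<bar>eigval a k\<bar> \<le> of_int \<bar>k\<bar> * (C * of_int \<bar>k\<bar> powr (r - 1))"
      unfolding eigval_def abs_mult using growth[of k] True by (auto intro: mult_left_mono)
    also have "\<dots> = C * of_int \<bar>k\<bar> powr r"
      using True powr_add[of "of_int \<bar>k\<bar>" 1 "r - 1"] by (simp add: mult_ac)
    also have "\<dots> \<le> C * jap k powr r"
      using C r by (intro mult_left_mono powr_mono2) (auto simp: jap_def)
    also have "\<dots> \<le> (C + S) * jap k powr r" using S by (intro mult_right_mono) auto
    finally show ?thesis .
  next
    case False
    then have "\<bar>eigval a k\<bar> \<le> S"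
    proof (cases "k = 0")
      case True
      then show ?thesis using S by (simp add: eigval_def)
    next
      case k: False
      show ?thesis unfolding S_def using False k by (intro member_le_sum) auto
    qed
    also have "\<dots> \<le> (C + S) * 1" using C by simp
    also have "\<dots> \<le> (C + S) * jap k powr r"
      using C S r jap_ge_1[of k] by (intro mult_left_mono ge_one_powr_ge_zero) auto
    finally show ?thesis .
  qed
  then show ?thesis using that[of "C + S"] S C by simp
qed

lemma pd_deriv_multiplier_sobolev:
  assumes A: "multiplier_with_symbol A a" and C': "0 \<le> C'" "\<And>k. \<bar>eigval a k\<bar> \<le> C' * jap k powr r"
    and v: "v \<in> sobolev s"
  shows "pd_deriv (A v) \<in> sobolev (s - r)"
proof (rule sobolev_boundI(1))
  let ?v = "\<lambda>k. cmod (fourier_coeff v k)"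
  have "jap k powr (2 * (s - r)) * (C' * jap k powr r * ?v k)\<^sup>2 = C'\<^sup>2 * (jap k powr (2 * s) * (?v k)\<^sup>2)" for k
  proof -
    have "jap k powr (2 * (s - r)) * (jap k powr r)\<^sup>2 = jap k powr (2 * s)"
      by (simp add: power2_eq_square flip: powr_add)
    then show ?thesis by (simp add: power_mult_distrib mult_ac)
  qed
  then show "wl2 (s - r) (\<lambda>k. C' * jap k powr r * ?v k)"
    using v unfolding sobolev_wl2 wl2_def by (simp add: summable_on_cmult_right)
  show "cmod (fourier_coeff (pd_deriv (A v)) k) \<le> C' * jap k powr r * ?v k" for k
  proof -
    have "fourier_coeff (pd_deriv (A v)) k = \<i> * of_real (eigval a k) * fourier_coeff v k"
      using A by (simp add: fourier_coeff_pd_deriv multiplier_with_symbol_def eigval_def)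
    then show ?thesis using C'(2)[of k] by (simp add: norm_mult mult_right_mono)
  qed
qed

text \<open>The evolution only rotates phases, so the majorant stays the same. The phase depending
  on t is split off, which turns Duhamel's integrand into that of the moment problem.\<close>

lemma dominated_evol:
  assumes f: "dominated s c (lebesgue_on S) f"
  shows "dominated s c (lebesgue_on S) (\<lambda>\<tau>. evol a (t - \<tau>) (f \<tau>))"
    and "\<tau> \<in> S \<Longrightarrow> fourier_coeff (evol a (t - \<tau>) (f \<tau>)) k
       = cis (eigval a k * t) * (cis (- (eigval a k * \<tau>)) * fourier_coeff (f \<tau>) k)"
proof -
  note D = dominatedD[OF f]
  have eq: "fourier_coeff (evol a (t - \<tau>) (f \<tau>)) k
       = cis (eigval a k * t) * (cis (- (eigval a k * \<tau>)) * fourier_coeff (f \<tau>) k)" if "\<tau> \<in> S" for \<tau> k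
  proof -
    have "f \<tau> \<in> sobolev s" using D(6)[of \<tau>] that by simp
    moreover have "cis (eigval a k * (t - \<tau>)) = cis (eigval a k * t) * cis (- (eigval a k * \<tau>))"
      by (simp add: cis_mult algebra_simps)
    ultimately show ?thesis by (simp only: fourier_coeff_evol cis_conv_exp[symmetric] mult.assoc)
  qed
  then show "\<tau> \<in> S \<Longrightarrow> fourier_coeff (evol a (t - \<tau>) (f \<tau>)) k
       = cis (eigval a k * t) * (cis (- (eigval a k * \<tau>)) * fourier_coeff (f \<tau>) k)" .
  show "dominated s c (lebesgue_on S) (\<lambda>\<tau>. evol a (t - \<tau>) (f \<tau>))"
    unfolding dominated_def
  proof (intro conjI allI ballI)
    show "(\<lambda>\<tau>. fourier_coeff (evol a (t - \<tau>) (f \<tau>)) k) \<in> borel_measurable (lebesgue_on S)" for k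
    proof -
      have [measurable]: "(\<lambda>\<tau>. cis (- (eigval a k * \<tau>))) \<in> borel_measurable (lebesgue_on S)"
        by (rule borel_measurable_lebesgue_on[OF cis_measurable_minus])
      have [measurable]: "(\<lambda>\<tau>. fourier_coeff (f \<tau>) k) \<in> borel_measurable (lebesgue_on S)" by (rule D(4))
      have "(\<lambda>\<tau>. cis (eigval a k * t) * (cis (- (eigval a k * \<tau>)) * fourier_coeff (f \<tau>) k)) \<in> borel_measurable (lebesgue_on S)"
        by measurable
      then show ?thesis by (subst measurable_cong[OF eq]) auto
    qed
    show "cmod (fourier_coeff (evol a (t - \<tau>) (f \<tau>)) k) \<le> c k" if "\<tau> \<in> space (lebesgue_on S)" for \<tau> k
      using D(5)[OF that, of k] that by (simp add: eq norm_mult)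
  qed (use D in auto)
qed

text \<open>Duhamel's formula defines u, and by coefficients continuity reduces to that of scalar
  indefinite integrals. Domination is assumed on every [0, t] because the measure in Duhamel's
  integral changes with t. The last conclusion is the bridge to control: prescribing u(T) means
  prescribing moments.\<close>

lemma mild_solution_dominated:
  assumes A: "multiplier_with_symbol A a" and r: "r \<ge> 0"
    and C': "0 \<le> C'" "\<And>k. \<bar>eigval a k\<bar> \<le> C' * jap k powr r"
    and g: "control_profile g" and T: "0 < T" and u0: "u0 \<in> sobolev s"
    and h: "\<And>t. 0 \<le> t \<Longrightarrow> t \<le> T \<Longrightarrow> dominated s c (lebesgue_on {0..t}) h"
  obtains u where "mild_solution T s r A a g h u0 u"
    "\<And>v. mild_solution T s r A a g h u0 v \<Longrightarrow> \<forall>t\<in>{0..T}. v t = u t"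
    "\<And>k. fourier_coeff (u T) k = cis (eigval a k * T) * (fourier_coeff u0 k +
       integral\<^sup>L (lebesgue_on {0..T}) (\<lambda>\<tau>. cis (- (eigval a k * \<tau>)) * fourier_coeff (control_op g (h \<tau>)) k))"
proof -
  let ?L = "\<lambda>t. lebesgue_on {0..t}"
  let ?f = "\<lambda>\<tau>. control_op g (h \<tau>)"
  define d where "d k = (\<Sum>\<^sub>\<infinity>m. cmod (Gmat g k m) * c m)" for k
  have f: "dominated s d (?L t) ?f" if "t \<in> {0..T}" for t
    unfolding d_def[abs_def] using dominated_control_op(1)[OF g h] that by auto
  let ?e = "\<lambda>t \<tau>. evol a (t - \<tau>) (?f \<tau>)"
  have e: "dominated s d (?L t) (?e t)" if "t \<in> {0..T}" for t
    by (rule dominated_evol(1)[OF f[OF that]])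
  define J where "J t = pd_of_coeffs (\<lambda>k. integral\<^sup>L (?L t) (\<lambda>\<tau>. fourier_coeff (?e t \<tau>) k))" for t
  define u where "u t = evol a t u0 + J t" for t
  let ?P = "\<lambda>k \<tau>. cis (- (eigval a k * \<tau>)) * fourier_coeff (?f \<tau>) k"
  have J: "has_sobolev_integral s (?L t) (?e t) (J t)"
    and Jc: "fourier_coeff (J t) k = integral\<^sup>L (?L t) (\<lambda>\<tau>. fourier_coeff (?e t \<tau>) k)" if "t \<in> {0..T}" for t k
    unfolding J_def by (rule dominated_has_sobolev_integral[OF e[OF that]])+
  have u0c: "fourier_coeff (evol a t u0) k = cis (eigval a k * t) * fourier_coeff u0 k" for t k
    using fourier_coeff_evol[OF u0] by (simp only: cis_conv_exp)
  have Pi: "integrable (?L t) (?P k)" if "t \<in> {0..T}" for t k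
  proof (rule finite_measure.integrable_const_bound[OF lebesgue_on_interval_finite, where B = "d k"])
    show "AE \<tau> in ?L t. norm (?P k \<tau>) \<le> d k"
      using dominatedD(5)[OF f[OF that], of _ k] by (intro AE_I2) (simp add: norm_mult)
    have [measurable]: "(\<lambda>\<tau>. cis (- (eigval a k * \<tau>))) \<in> borel_measurable (?L t)"
      by (rule borel_measurable_lebesgue_on[OF cis_measurable_minus])
    have [measurable]: "(\<lambda>\<tau>. fourier_coeff (?f \<tau>) k) \<in> borel_measurable (?L t)"
      by (rule dominatedD(4)[OF f[OF that]])
    show "?P k \<in> borel_measurable (?L t)" by measurable
  qed
  have uc: "fourier_coeff (u t) k = cis (eigval a k * t) * (fourier_coeff u0 k + integral\<^sup>L (?L t) (?P k))"
    if t: "t \<in> {0..T}" for t k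
  proof -
    have "integral\<^sup>L (?L t) (\<lambda>\<tau>. fourier_coeff (?e t \<tau>) k) = integral\<^sup>L (?L t) (\<lambda>\<tau>. cis (eigval a k * t) * ?P k \<tau>)"
      by (rule Bochner_Integration.integral_cong[OF refl]) (simp add: dominated_evol(2)[OF f[OF t]])
    then show ?thesis by (simp add: u_def u0c Jc[OF t] distrib_left)
  qed
  \<comment> \<open>A majorant of u valid at all times up to T, as required for continuity in the
    Sobolev norm.\<close>
  define b where "b k = cmod (fourier_coeff u0 k) + T * d k" for k
  have d: "wl2 s d" "0 \<le> d k" for k using dominatedD(2,3)[OF f[of T]] T by auto
  have b: "wl2 s b"
    unfolding b_def[abs_def] using u0 by (intro wl2_add(1) wl2_cmult(1) d) (simp add: sobolev_wl2)
  have ub: "cmod (fourier_coeff (u t) k) \<le> b k" if t: "t \<in> {0..T}" for t k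
  proof -
    have "cmod (integral\<^sup>L (?L t) (?P k)) \<le> t * d k"
      using t dominatedD(5)[OF f[OF t], of _ k]
      by (intro integral_lebesgue_on_bound Pi) (auto simp: norm_mult)
    also have "\<dots> \<le> T * d k" using t d(2) by (intro mult_right_mono) auto
    finally have "cmod (fourier_coeff u0 k + integral\<^sup>L (?L t) (?P k)) \<le> b k"
      unfolding b_def by (intro order_trans[OF norm_triangle_ineq] add_left_mono)
    then show ?thesis unfolding uc[OF t] by (simp add: norm_mult)
  qed
  have us: "u t \<in> sobolev s" if "t \<in> {0..T}" for t
    by (rule sobolev_boundI(1)[OF b ub[OF that]])
  have cont: "sobolev_continuous_on s {0..T} u"
  proof (rule sobolev_continuous_onI[OF b ub])
    show "continuous_on {0..T} (\<lambda>t. fourier_coeff (u t) k)" for k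
    proof -
      have eq: "integral\<^sup>L (?L t) (?P k) = integral {0..t} (?P k)" if "t \<in> {0..T}" for t
        by (rule lebesgue_integral_eq_integral[OF Pi[OF that]]) simp
      have "?P k integrable_on {0..T}"
        by (rule integrable_on_lebesgue_on[OF Pi]) (use T in auto)
      then have "continuous_on {0..T} (\<lambda>t. cis (eigval a k * t) * (fourier_coeff u0 k + integral {0..t} (?P k)))"
        by (intro continuous_intros indefinite_integral_continuous_1)
      then show ?thesis by (rule continuous_on_eq) (simp add: uc eq)
    qed
  qed
  have u_0: "u 0 = u0"
  proof (rule pdist_eqI)
    have "integral\<^sup>L (?L 0) (?P k) = 0" for k
      using lebesgue_integral_eq_integral[OF Pi[of 0 k]] T by simp
    then show "fourier_coeff (u 0) k = fourier_coeff u0 k" for k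
      using T by (simp add: uc)
  qed
  have hs: "h t \<in> sobolev s" if "t \<in> {0..T}" for t
    using dominatedD(6)[OF h[of T], of t] T that by simp
  have m: "mild_solution T s r A a g h u0 u"
    unfolding mild_solution_def
  proof (intro conjI ballI)
    fix t assume t: "t \<in> {0<..<T}"
    have 1: "pd_deriv (A (u t)) \<in> sobolev (s - r)"
      by (rule pd_deriv_multiplier_sobolev[OF A C' us]) (use t in auto)
    have "control_op g (h t) \<in> sobolev s" by (rule control_op_sobolev[OF g hs]) (use t in auto)
    then have "control_op g (h t) \<in> sobolev (s - r)"
      using r unfolding sobolev_wl2 by (rule_tac wl2_weaken) auto
    with 1 show "pd_deriv (A (u t)) + control_op g (h t) \<in> sobolev (s - r)" by (rule sobolev_add)
  next
    fix t assume t: "t \<in> {0..T}"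
    show "\<exists>J. has_sobolev_integral s (?L t) (?e t) J \<and> u t = evol a t u0 + J"
      using J[OF t] by (auto simp: u_def)
  qed (fact cont u_0)+
  have uniq: "\<forall>t\<in>{0..T}. v t = u t" if v: "mild_solution T s r A a g h u0 v" for v
  proof
    fix t assume t: "t \<in> {0..T}"
    then obtain J' where J': "has_sobolev_integral s (?L t) (?e t) J'" "v t = evol a t u0 + J'"
      using v unfolding mild_solution_def by blast
    have "J' = J t"
      by (rule pdist_eqI) (simp add: Jc[OF t] dominated_sobolev_integral_unique[OF e[OF t] J'(1)])
    then show "v t = u t" by (simp add: u_def J'(2))
  qed
  have "fourier_coeff (u T) k = cis (eigval a k * T) * (fourier_coeff u0 k + integral\<^sup>L (?L T) (?P k))" for k
    using T by (intro uc) auto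
  with that m uniq show ?thesis by blast
qed

lemma dominated_L2_sobolev:
  assumes h: "dominated s c (lebesgue_on {0..T}) h" and T: "0 \<le> T"
  shows "h \<in> L2_sobolev T s" "L2_sobolev_norm T s h \<le> sqrt T * wnorm s c"
proof -
  let ?L = "lebesgue_on {0..T}"
  note D = dominatedD[OF h]
  have le: "(sobolev_norm s (h t))\<^sup>2 \<le> (wnorm s c)\<^sup>2" if "t \<in> space ?L" for t
    using D(7)[OF that] by (intro power_mono) (auto simp: sobolev_norm_wnorm wnorm_nonneg)
  have [measurable]: "(\<lambda>t. sobolev_norm s (h t)) \<in> borel_measurable ?L"
    by (rule sobolev_norm_measurable[OF D(4,6)])
  have int: "integrable ?L (\<lambda>t. (sobolev_norm s (h t))\<^sup>2)"
    by (rule finite_measure.integrable_const_bound[OF D(1), where B = "(wnorm s c)\<^sup>2"])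
       (use le in \<open>auto intro!: AE_I2\<close>)
  then show "h \<in> L2_sobolev T s"
    using dominated_sobolev_measurable[OF h] by (simp add: L2_sobolev_def)
  have "integral\<^sup>L ?L (\<lambda>t. (sobolev_norm s (h t))\<^sup>2) \<le> integral\<^sup>L ?L (\<lambda>_. (wnorm s c)\<^sup>2)"
    using int le finite_measure.integrable_const[OF D(1)] by (intro integral_mono) auto
  then have "L2_sobolev_norm T s h \<le> sqrt (T * (wnorm s c)\<^sup>2)"
    unfolding L2_sobolev_norm_def integral_lebesgue_on_const[OF T] by (rule real_sqrt_le_mono)
  then show "L2_sobolev_norm T s h \<le> sqrt T * wnorm s c"
    by (simp add: real_sqrt_mult wnorm_nonneg)
qed

text \<open>Converts the pointwise bound of \<open>solve_blocks\<close> into a norm bound. The extra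
  term is a multiple of the indicator of the finite set F, and its height is controlled by single
  coordinates of c.\<close>

lemma wnorm_localized:
  assumes "finite F"
  obtains Y where "0 \<le> Y" "\<And>c. wl2 s c \<Longrightarrow> (\<And>k. 0 \<le> c k) \<Longrightarrow>
    wl2 s (\<lambda>k. c k + (if k \<in> F then \<Sum>l\<in>F. c l else 0)) \<and>
    wnorm s (\<lambda>k. c k + (if k \<in> F then \<Sum>l\<in>F. c l else 0)) \<le> Y * wnorm s c"
proof -
  let ?i = "\<lambda>k. if k \<in> F then 1 else 0 :: real"
  have i: "wl2 s ?i" by (rule wl2_finite[OF assms]) simp
  define X where "X = (\<Sum>l\<in>F. jap l powr (- s))"
  have X: "0 \<le> X" unfolding X_def by (intro sum_nonneg) simp
  have "wl2 s (\<lambda>k. c k + (if k \<in> F then \<Sum>l\<in>F. c l else 0)) \<and>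
    wnorm s (\<lambda>k. c k + (if k \<in> F then \<Sum>l\<in>F. c l else 0)) \<le> 2 * (1 + X * wnorm s ?i) * wnorm s c"
    if c: "wl2 s c" and c0: "\<And>k. 0 \<le> c k" for c
  proof -
    let ?S = "\<Sum>l\<in>F. c l"
    have eq: "(\<lambda>k. if k \<in> F then ?S else 0) = (\<lambda>k. ?S * ?i k)" by auto
    have S0: "0 \<le> ?S" using c0 by (intro sum_nonneg) auto
    have "?S \<le> (\<Sum>l\<in>F. jap l powr (- s) * wnorm s c)"
      using wl2_coordinate[OF c] c0 by (intro sum_mono) (auto intro: order_trans[OF abs_ge_self])
    then have S: "?S \<le> X * wnorm s c" by (simp add: X_def sum_distrib_right)
    have d: "wl2 s (\<lambda>k. if k \<in> F then ?S else 0)"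
      "wnorm s (\<lambda>k. if k \<in> F then ?S else 0) = ?S * wnorm s ?i"
      unfolding eq using wl2_cmult[OF i, of ?S] S0 by auto
    have "?S * wnorm s ?i \<le> X * wnorm s c * wnorm s ?i"
      by (intro mult_right_mono S wnorm_nonneg)
    then have "2 * (wnorm s c + ?S * wnorm s ?i) \<le> 2 * (1 + X * wnorm s ?i) * wnorm s c"
      by (simp add: algebra_simps)
    with wl2_add[OF c d(1)] show ?thesis unfolding d(2) by auto
  qed
  then show ?thesis
    by (intro that[of "2 * (1 + X * wnorm s ?i)"]) (auto intro!: mult_nonneg_nonneg add_nonneg_nonneg X wnorm_nonneg)
qed

section \<open>The control as a solution of the moment problem\<close>

lemma distinct_index_rep:
  assumes "distinct_index_set a \<I>"
  obtains rep where "\<And>k. rep k \<in> \<I>" "\<And>k. eigval a (rep k) = eigval a k"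
    "\<And>k m. rep m = rep k \<longleftrightarrow> m \<in> eig_class a k"
proof -
  define rep where "rep k = (THE j. j \<in> \<I> \<inter> eig_class a k)" for k
  have r: "rep k \<in> \<I> \<inter> eig_class a k" for k
    unfolding rep_def by (rule theI') (use assms in \<open>simp add: distinct_index_set_def\<close>)
  have u: "i = j" if "i \<in> \<I> \<inter> eig_class a k" "j \<in> \<I> \<inter> eig_class a k" for i j k
    using assms that unfolding distinct_index_set_def by blast
  have e: "eigval a (rep k) = eigval a k" for k using r[of k] by (simp add: eig_class_def)
  have "rep m = rep k \<longleftrightarrow> m \<in> eig_class a k" for k m
  proof
    assume "rep m = rep k"
    then show "m \<in> eig_class a k" using e[of m] e[of k] by (simp add: eig_class_def)
  next
    assume "m \<in> eig_class a k"
    then have "eig_class a m = eig_class a k" by (auto simp: eig_class_def)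
    then show "rep m = rep k" using r[of m] r[of k] u by metis
  qed
  with r e that show ?thesis by blast
qed

text \<open>The control is \<open>G\<close> applied to \<open>\<Sum>\<^sub>m h m q\<^bsub>rep m\<^esub>(t) e\<^sup>i\<^sup>m\<^sup>x\<close>: by biorthogonality only the indices in
  the class of \<open>k\<close> contribute to the \<open>k\<close>-th moment, which makes the moment problem block diagonal.\<close>

lemma control_moments:
  assumes g: "control_profile g" and fin: "\<And>k. finite (eig_class a k)"
    and rep: "\<And>k. rep k \<in> \<I>" "\<And>k. eigval a (rep k) = eigval a k" "\<And>k m. rep m = rep k \<longleftrightarrow> m \<in> eig_class a k"
    and q: "\<And>j. j \<in> \<I> \<Longrightarrow> bsupp T M (q j)"
      "\<And>j k. j \<in> \<I> \<Longrightarrow> k \<in> \<I> \<Longrightarrow> moment (q j) (eigval a k) = (if j = k then 1 else 0)"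
    and h: "wl2 s (\<lambda>m. cmod (h m))"
  defines "w \<equiv> \<lambda>t. pd_of_coeffs (\<lambda>m. h m * q (rep m) t)"
  shows "dominated s (\<lambda>m. M * cmod (h m)) (lebesgue_on {0..t}) w"
    and "integral\<^sup>L (lebesgue_on {0..T}) (\<lambda>\<tau>. cis (- (eigval a k * \<tau>)) *
        fourier_coeff (control_op g (control_op g (w \<tau>))) k) = (\<Sum>m\<in>eig_class a k. Gsq g k m * h m)"
proof -
  have M: "0 \<le> M" using bsupp_nonneg[OF q(1)[OF rep(1)[of 0]]] .
  have qb: "cmod (q (rep m) t) \<le> M" and qm: "q (rep m) \<in> borel_measurable borel" for m t
    using q(1)[OF rep(1)[of m]] by (auto simp: bsupp_def)
  have Mh: "wl2 s (\<lambda>m. M * cmod (h m))" by (rule wl2_cmult(1)[OF h])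
  have hq: "cmod (h m * q (rep m) t) \<le> M * cmod (h m)" for m t
    using mult_left_mono[OF qb[of m t], of "cmod (h m)"] by (simp add: norm_mult mult.commute)
  have wc: "fourier_coeff (w t) m = h m * q (rep m) t" for t m
    unfolding w_def
    by (rule fourier_coeff_pd_of_coeffs[of s], rule wl2_mono(1)[OF Mh]) (use hq M in \<open>auto intro: order_trans\<close>)
  show w: "dominated s (\<lambda>m. M * cmod (h m)) (lebesgue_on {0..t}) w" for t
    unfolding dominated_def
  proof (intro conjI allI ballI)
    show "(\<lambda>t. fourier_coeff (w t) m) \<in> borel_measurable (lebesgue_on {0..t})" for m
      unfolding wc by (intro borel_measurable_times borel_measurable_const borel_measurable_lebesgue_on qm)
  qed (use Mh M hq lebesgue_on_interval_finite in \<open>auto simp: wc\<close>)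
  let ?L = "lebesgue_on {0..T}" and ?C = "eig_class a k"
  let ?\<phi> = "\<lambda>\<tau>. cis (- (eigval a k * \<tau>))"
  have \<phi>: "?\<phi> \<in> borel_measurable ?L" "\<And>\<tau>. cmod (?\<phi> \<tau>) \<le> 1"
    by (auto intro: borel_measurable_lebesgue_on cis_measurable_minus)
  have m0: "integral\<^sup>L ?L (\<lambda>\<tau>. ?\<phi> \<tau> * fourier_coeff (w \<tau>) m) = (if m \<in> ?C then h m else 0)" for m
  proof -
    have "integral\<^sup>L ?L (\<lambda>\<tau>. ?\<phi> \<tau> * fourier_coeff (w \<tau>) m)
        = integral\<^sup>L ?L (\<lambda>\<tau>. h m * (q (rep m) \<tau> * cis (- (eigval a k * \<tau>))))"
      by (simp add: wc mult_ac)
    also have "\<dots> = h m * moment (q (rep m)) (eigval a (rep k))"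
      using moment_lebesgue_on[OF q(1)[OF rep(1)[of m]], of "eigval a k"] rep(2)[of k] by simp
    also have "\<dots> = (if m \<in> ?C then h m else 0)"
      using q(2)[OF rep(1)[of m] rep(1)[of k]] rep(3)[of m k] by simp
    finally show ?thesis .
  qed
  \<comment> \<open>The moments of w vanish outside the class of k, so after the inner G only a
    finite sum over this class remains.\<close>
  have m1: "integral\<^sup>L ?L (\<lambda>\<tau>. ?\<phi> \<tau> * fourier_coeff (control_op g (w \<tau>)) l) = (\<Sum>m\<in>?C. Gmat g l m * h m)" for l
  proof -
    have "integral\<^sup>L ?L (\<lambda>\<tau>. ?\<phi> \<tau> * fourier_coeff (control_op g (w \<tau>)) l)
        = (\<Sum>\<^sub>\<infinity>m. Gmat g l m * (if m \<in> ?C then h m else 0))"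
      unfolding dominated_control_op(2)[OF g w \<phi>] m0 ..
    also have "\<dots> = (\<Sum>\<^sub>\<infinity>m\<in>?C. Gmat g l m * h m)"
      by (rule infsum_cong_neutral) auto
    also have "\<dots> = (\<Sum>m\<in>?C. Gmat g l m * h m)" by (rule infsum_finite[OF fin])
    finally show ?thesis .
  qed
  have "integral\<^sup>L ?L (\<lambda>\<tau>. ?\<phi> \<tau> * fourier_coeff (control_op g (control_op g (w \<tau>))) k)
      = (\<Sum>\<^sub>\<infinity>l. Gmat g k l * (\<Sum>m\<in>?C. Gmat g l m * h m))"
    unfolding dominated_control_op(2)[OF g dominated_control_op(1)[OF g w] \<phi>] m1 ..
  also have "\<dots> = (\<Sum>\<^sub>\<infinity>l. \<Sum>m\<in>?C. (Gmat g k l * Gmat g l m) * h m)"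
    by (simp add: sum_distrib_left mult.assoc)
  also have "\<dots> = (\<Sum>m\<in>?C. \<Sum>\<^sub>\<infinity>l. (Gmat g k l * Gmat g l m) * h m)"
    by (intro infsum_sum' summable_on_cmult_left Gmat_products(2)[OF g])
  also have "\<dots> = (\<Sum>m\<in>?C. Gsq g k m * h m)"
    unfolding Gsq_def infsum_cmult_left' ..
  finally show "integral\<^sup>L ?L (\<lambda>\<tau>. ?\<phi> \<tau> * fourier_coeff (control_op g (control_op g (w \<tau>))) k)
      = (\<Sum>m\<in>?C. Gsq g k m * h m)" .
qed

theorem theorem1p3:
  fixes s r C T :: real and k0 :: int
    and A :: "pdist \<Rightarrow> pdist" and a :: "int \<Rightarrow> real"
    and g :: "real \<Rightarrow> real" and \<I> :: "int set"
  assumes A: "multiplier_with_symbol A a"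
    and growth: "r \<ge> 1" "k0 \<ge> 0" "C > 0"
      "\<And>k. \<bar>k\<bar> \<ge> k0 \<Longrightarrow> \<bar>a k\<bar> \<le> C * of_int \<bar>k\<bar> powr (r - 1)"
    and g: "control_profile g"
    and hyp_a: "\<And>k. pd_deriv (A (fourier_basis k))
      = pd_scale (\<i> * of_real (eigval a k)) (fourier_basis k)"
    and hyp_b: "\<exists>n0::nat. \<forall>k1. finite (eig_class a k1) \<and> card (eig_class a k1) \<le> n0"
    and hyp_c: "\<exists>k1s::nat. \<forall>k1. \<bar>k1\<bar> \<ge> int k1s \<longrightarrow> card (eig_class a k1) = 1"
    and \<I>: "distinct_index_set a \<I>"
    and gamma: "gap a \<I> > 0"
    and gamma': "tail_gap a \<I> > 0"
    and T: "ereal T > ereal (2 * pi) / tail_gap a \<I>"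
  shows "\<exists>\<nu>>0. \<forall>u0\<in>sobolev s. \<forall>u1\<in>sobolev s. fourier_coeff u0 0 = fourier_coeff u1 0 \<longrightarrow>
    (\<exists>h\<in>L2_sobolev T s.
       (\<exists>u. mild_solution T s r A a g h u0 u \<and>
            (\<forall>v. mild_solution T s r A a g h u0 v \<longrightarrow> (\<forall>t\<in>{0..T}. v t = u t)) \<and>
            u T = u1) \<and>
       L2_sobolev_norm T s h \<le> \<nu> * (sobolev_norm s u0 + sobolev_norm s u1))"
proof -
  have bi: "biorthogonal T \<I> (eigval a)" and T0: "T > 0"
    by (rule biorthogonal_gap[OF gamma T gamma'])+
  obtain M q where q: "\<And>j. j \<in> \<I> \<Longrightarrow> bsupp T M (q j)"
    "\<And>j k. j \<in> \<I> \<Longrightarrow> k \<in> \<I> \<Longrightarrow> moment (q j) (eigval a k) = (if j = k then 1 else 0)"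
    using bi unfolding biorthogonal_def by blast
  obtain rep where rep: "\<And>k. rep k \<in> \<I>" "\<And>k. eigval a (rep k) = eigval a k"
    "\<And>k m. rep m = rep k \<longleftrightarrow> m \<in> eig_class a k"
    by (rule distinct_index_rep[OF \<I>]) blast
  have M: "0 \<le> M" using bsupp_nonneg[OF q(1)[OF rep(1)[of 0]]] .
  have fin: "finite (eig_class a k)" for k using hyp_b by blast
  obtain k1s :: nat where k1s: "card (eig_class a k) = 1" if "int k1s \<le> \<bar>k\<bar>" for k using hyp_c by blast
  obtain B F where B: "0 \<le> B" and F: "finite F"
    and solve: "\<And>c. c 0 = 0 \<Longrightarrow> \<exists>h. (\<forall>k. (\<Sum>m\<in>eig_class a k. Gsq g k m * h m) = c k) \<and>
       (\<forall>k. cmod (h k) \<le> B * (cmod (c k) + (if k \<in> F then \<Sum>l\<in>F. cmod (c l) else 0)))"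
    by (rule solve_blocks[OF g fin k1s]) blast+
  obtain Y where Y: "0 \<le> Y" "\<And>c. wl2 s c \<Longrightarrow> (\<And>k. 0 \<le> c k) \<Longrightarrow>
    wl2 s (\<lambda>k. c k + (if k \<in> F then \<Sum>l\<in>F. c l else 0)) \<and>
    wnorm s (\<lambda>k. c k + (if k \<in> F then \<Sum>l\<in>F. c l else 0)) \<le> Y * wnorm s c"
    by (rule wnorm_localized[OF F, of s]) blast
  obtain D where D: "0 \<le> D" "\<And>c. (\<And>m. 0 \<le> c m) \<Longrightarrow> wl2 s c \<Longrightarrow>
     wnorm s (\<lambda>k. \<Sum>\<^sub>\<infinity>m. cmod (Gmat g k m) * c m) \<le> D * wnorm s c"
    using Gmat_bounded[OF control_profile_smooth[OF g], of s] by blast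
  obtain C' where C': "0 \<le> C'" "\<And>k. \<bar>eigval a k\<bar> \<le> C' * jap k powr r"
    by (rule eigval_growth[OF growth(1,3,4)]) blast+
  \<comment> \<open>The losses from the inside out: Y and B for solving the blocks, M for the
    biorthogonal functions, D for G, and the square root of T for the norm in time. In
    \<open>2 * K + 1\<close> below, the 2 is the factor of \<open>wl2_add\<close> and the 1 ensures
    positivity. None of these depends on u0 or u1.\<close>
  define K where "K = sqrt T * (D * (M * (B * Y)))"
  have K: "0 \<le> K" unfolding K_def using T0 D M B Y by simp
  show ?thesis
  proof (intro exI[of _ "2 * K + 1"] conjI ballI impI)
    show "0 < 2 * K + 1" using K by simp
    fix u0 u1 assume u: "u0 \<in> sobolev s" "u1 \<in> sobolev s" and eq0: "fourier_coeff u0 0 = fourier_coeff u1 0"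
    \<comment> \<open>The equation u(T) = u1 read in the coefficient formula for the solution: the
      k-th moment of G h must equal c k.\<close>
    define c where "c k = cis (- (eigval a k * T)) * fourier_coeff u1 k - fourier_coeff u0 k" for k
    let ?U = "\<lambda>k. cmod (fourier_coeff u0 k) + cmod (fourier_coeff u1 k)"
    have cU: "cmod (c k) \<le> ?U k" for k
      using norm_triangle_ineq4[of "cis (- (eigval a k * T)) * fourier_coeff u1 k" "fourier_coeff u0 k"]
      by (simp add: c_def norm_mult)
    note U = wl2_add[OF u[unfolded sobolev_wl2]]
    have cw: "wl2 s (\<lambda>k. cmod (c k))" "wnorm s (\<lambda>k. cmod (c k)) \<le> wnorm s ?U"
      using wl2_mono[OF U(1), of "\<lambda>k. cmod (c k)"] cU by auto
    \<comment> \<open>The eigenvalue at 0 is 0, so the phase is 1 and equality of the zeroth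
      coefficients gives solvability at 0.\<close>
    have "c 0 = 0" by (simp add: c_def eigval_def eq0)
    then obtain h where h: "\<And>k. (\<Sum>m\<in>eig_class a k. Gsq g k m * h m) = c k"
      "\<And>k. cmod (h k) \<le> B * (cmod (c k) + (if k \<in> F then \<Sum>l\<in>F. cmod (c l) else 0))"
      using solve by blast
    let ?d = "\<lambda>k. cmod (c k) + (if k \<in> F then \<Sum>l\<in>F. cmod (c l) else 0)"
    have d: "wl2 s ?d" "wnorm s ?d \<le> Y * wnorm s (\<lambda>k. cmod (c k))"
      using Y(2)[OF cw(1)] by auto
    have hw: "wl2 s (\<lambda>k. cmod (h k))" "wnorm s (\<lambda>k. cmod (h k)) \<le> B * wnorm s ?d"
      using wl2_mono[OF wl2_cmult(1)[OF d(1), of B], of "\<lambda>k. cmod (h k)"] h(2) B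
      by (auto simp: wl2_cmult(2)[OF d(1)] intro: order_trans[OF _ abs_ge_self])
    define w where "w t = pd_of_coeffs (\<lambda>m. h m * q (rep m) t)" for t
    have w: "dominated s (\<lambda>m. M * cmod (h m)) (lebesgue_on {0..t}) w"
      and wm: "integral\<^sup>L (lebesgue_on {0..T}) (\<lambda>\<tau>. cis (- (eigval a k * \<tau>)) *
        fourier_coeff (control_op g (control_op g (w \<tau>))) k) = (\<Sum>m\<in>eig_class a k. Gsq g k m * h m)" for t k
      unfolding w_def[abs_def] by (rule control_moments[OF g fin rep _ _ hw(1)]; blast intro: q)+
    define H where "H t = control_op g (w t)" for t
    let ?e = "\<lambda>k. \<Sum>\<^sub>\<infinity>m. cmod (Gmat g k m) * (M * cmod (h m))"
    have H: "dominated s ?e (lebesgue_on {0..t}) H" for t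
      unfolding H_def[abs_def] by (rule dominated_control_op(1)[OF g w])
    have r0: "0 \<le> r" using growth(1) by simp
    obtain v where v: "mild_solution T s r A a g H u0 v"
      "\<And>v'. mild_solution T s r A a g H u0 v' \<Longrightarrow> \<forall>t\<in>{0..T}. v' t = v t"
      "\<And>k. fourier_coeff (v T) k = cis (eigval a k * T) * (fourier_coeff u0 k +
       integral\<^sup>L (lebesgue_on {0..T}) (\<lambda>\<tau>. cis (- (eigval a k * \<tau>)) * fourier_coeff (control_op g (H \<tau>)) k))"
      by (rule mild_solution_dominated[OF A r0 C' g T0 u(1) H]) blast
    have "v T = u1"
    proof (rule pdist_eqI)
      fix k
      have "fourier_coeff (v T) k = cis (eigval a k * T) * (fourier_coeff u0 k + c k)"
        unfolding v(3) H_def wm h(1) ..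
      also have "\<dots> = (cis (eigval a k * T) * cis (- (eigval a k * T))) * fourier_coeff u1 k"
        by (simp add: c_def mult.assoc)
      also have "\<dots> = fourier_coeff u1 k" by (simp add: cis_mult)
      finally show "fourier_coeff (v T) k = fourier_coeff u1 k" .
    qed
    moreover have "H \<in> L2_sobolev T s" and LH: "L2_sobolev_norm T s H \<le> sqrt T * wnorm s ?e"
      using dominated_L2_sobolev[OF H] T0 by auto
    moreover have "L2_sobolev_norm T s H \<le> (2 * K + 1) * (sobolev_norm s u0 + sobolev_norm s u1)"
    proof -
      have "wnorm s ?e \<le> D * wnorm s (\<lambda>m. M * cmod (h m))"
        by (rule D(2)[OF _ wl2_cmult(1)[OF hw(1)]]) (use M in simp)
      also have "\<dots> = D * (M * wnorm s (\<lambda>m. cmod (h m)))"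
        using M by (simp add: wl2_cmult(2)[OF hw(1)])
      also have "\<dots> \<le> D * (M * (B * (Y * wnorm s ?U)))"
        using hw(2) d(2) cw(2) D(1) M B Y(1)
        by (intro mult_left_mono order_trans[OF hw(2)] order_trans[OF d(2)]) auto
      finally have "sqrt T * wnorm s ?e \<le> sqrt T * (D * (M * (B * (Y * wnorm s ?U))))"
        using T0 by (intro mult_left_mono) auto
      also have "\<dots> = K * wnorm s ?U" by (simp add: K_def mult_ac)
      also have "\<dots> \<le> K * (2 * (sobolev_norm s u0 + sobolev_norm s u1))"
        unfolding sobolev_norm_wnorm by (intro mult_left_mono U(2) K)
      also have "\<dots> \<le> (2 * K + 1) * (sobolev_norm s u0 + sobolev_norm s u1)"
      proof -
        have "0 \<le> sobolev_norm s u0 + sobolev_norm s u1"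
          by (simp add: sobolev_norm_wnorm wnorm_nonneg)
        moreover have "0 \<le> x \<Longrightarrow> K * (2 * x) \<le> (2 * K + 1) * x" for x :: real
          by (simp add: algebra_simps)
        ultimately show ?thesis by blast
      qed
      finally show ?thesis using LH by linarith
    qed
    ultimately show "\<exists>h\<in>L2_sobolev T s.
       (\<exists>u. mild_solution T s r A a g h u0 u \<and>
            (\<forall>v. mild_solution T s r A a g h u0 v \<longrightarrow> (\<forall>t\<in>{0..T}. v t = u t)) \<and>
            u T = u1) \<and>
       L2_sobolev_norm T s h \<le> (2 * K + 1) * (sobolev_norm s u0 + sobolev_norm s u1)"
      using v(1,2) by blast
  qed
qed

end
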